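(* Consider the trigonometric $R$-matrix. Let $(W,Y_W)$ be a $\phi$-coordinated $V(R)$-module. There exists a unique structure of restricted $\mathrm Y_h(\overline R)$-module over $W$ such that $$\mathcal T(z)_W=Y_W(L^+(0)\mathbf1,z).$$ Moreover, if $W_1\subset W$ is a ($\phi$-coordinated) $V(R)$-submodule, then it is also a $\mathrm Y_h(\overline R)$-submodule.
   Context: Trigonometric $R$-matrix. $N\geqslant2$ is an integer, $h$ a formal parameter, $e_{ij}$ matrix units, $$\overline R(z_1,z_2)=(z_1e^{-h/2}-z_2e^{h/2})\sum_{i}e_{ii}\otimes e_{ii}+(z_1-z_2)\sum_{i\neq j}e_{ii}\otimes e_{jj}+(e^{-h/2}-e^{h/2})z_1\sum_{i>j}e_{ij}\otimes e_{ji}+(e^{-h/2}-e^{h/2})z_2\sum_{i<j}e_{ij}\otimes e_{ji},$$ $g(z)=-e^{h/2}(1-ze^h)^{-1}$, $R(z)=g(z)\overline R(z,1)\in(\mathrm{End}\,\mathbb{C}^N)^{\otimes2}[[z,h]]$, $R(e^u)=g(e^u)\overline R(e^u,1)\in(\mathrm{End}\,\mathbb{C}^N)^{\otimes2}((u))[[h]]$, with $(1-e^{u+h})^{-1}$ expanded in $\mathbb{C}((u))[[h]]$. $R(ze^{u-v})$ is regarded as an element of $(\mathrm{End}\,\mathbb{C}^N)^{\otimes2}(z)[[u,v,h]]$ via $\frac1{1-ze^{u-v+h}}=\sum_{k\geqslant0}\frac{(e^{u-v+h}-1)^kz^k}{k!}\frac{\partial^k}{\partial z^k}\frac1{1-z}$.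 Generalized $h$-Yangian $\mathrm Y_h(\overline R)$: put $\overline R(z)=e^{-h/2}\,\overline R(z,1)=e^{-h/2}g(z)^{-1}R(z)\in(\mathrm{End}\,\mathbb{C}^N)^{\otimes2}[[h]][z]$. $\mathrm Y_h(\overline R)$ is the associative algebra over $\mathbb{C}[[h]]$ generated by $\tau_{ij}^{(r)}$ ($r\in\mathbb{Z}$, $i,j=1,\ldots,N$) subject to $$\overline R(z_1/z_2)\mathcal T_1(z_1)\mathcal T_2(z_2)=\mathcal T_2(z_2)\mathcal T_1(z_1)\overline R(z_1/z_2),\quad\mathcal T(z)=\sum_{i,j}e_{ij}\otimes\tau_{ij}(z),\quad\tau_{ij}(z)=\sum_{r\in\mathbb{Z}}\tau_{ij}^{(-r)}z^r.$$ A $\mathrm Y_h(\overline R)$-module $W$ is restricted if it is a topologically free $\mathbb{C}[[h]]$-module and the action $\mathcal T(z)_W$ of $\mathcal T(z)$ on $W$ satisfies $\mathcal T(z)_W\in\mathrm{End}\,\mathbb{C}^N\otimes\mathrm{Hom}(W,W((z))_h)$. Conventions. Functions of $e^{u_1+u_2+\cdots}$ are expanded according to the order in which the variables are written ($e^{u-v}$ in $\mathbb{C}((u))((v))[[h]]$, etc.); arguments $z+u$ are expanded in nonnegative powers of $u$. $\iota_{x,y}$ denotes expansion of rational functions in $x,y$ in $\mathbb{C}((x))((y))$, applied to each coefficient of $h$. Subscripts of matrices indicate tensor copies. A $\mathbb{C}[[h]]$-module is topologically free if it is isomorphic to $V_0[[h]]$ for a vector space $V_0$; tensor products are $h$-adically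 completed; $W((z))_h$ is the $h$-adic completion of $W((z))$. "$A\in X$ mod $h^k$" means that $A$ belongs to $X$ up to an element divisible by $h^k$; $A\big|^{\mathrm{mod}\,h^k}_{\ldots}$ means that the substitution is applied to the truncation of $A$ modulo $h^k$. Algebra $V(R)$: the topologically free associative unital algebra over $\mathbb{C}[[h]]$ generated by $l_{ij}^{(-r)}$ ($r\geqslant1$, $i,j=1,\ldots,N$) subject to $$R_{21}(e^{-u+v})L_1^+(u)L_2^+(v)=L_2^+(v)L_1^+(u)R_{12}(e^{u-v}),\quad L^+(u)=\sum_{i,j}e_{ij}\otimes l_{ij}^+(u),\quad l^+_{ij}(u)=\sum_{r\geqslant1}l_{ij}^{(-r)}u^{r-1}.$$ Its unit is $\mathbf1$; $L^+(u)$ acts by left multiplication. Let $L(u)\in\mathrm{End}\,\mathbb{C}^N\otimes\mathrm{Hom}(V(R),V(R)((u))_h)$ be uniquely determined by $L_0(u_0)L_1^+(u_1)\cdots L_n^+(u_n)\mathbf1=R_{0n}(e^{u_0-u_n})^{-1}\cdots R_{01}(e^{u_0-u_1})^{-1}L_0^+(u_0)\cdots L_n^+(u_n)\mathbf1$ for $n\geqslant0$. Put $L^+_{[n]}(u)=L_1^+(u_1)\cdots L_n^+(u_n)$ and $L_{[n]}(u)=R_{[n]}(e^u)L_1(u_1)\cdots L_n(u_n)$ with $R_{[n]}(e^u)=\prod^{\rightarrow}_{i=1,\ldots,n-1}\prod^{\rightarrow}_{j=i+1,\ldots,n}R_{ij}(e^{u_i-u_j})$ (arrows: $\rightarrow$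 increasing, $\leftarrow$ decreasing index from left to right). The vertex operator map $Y(\cdot,z):V(R)\to\mathrm{Hom}(V(R),V(R)((z))_h)$ is given by $Y(\mathbf1,z)=1$, $Y(L^+_{[n]}(u)\mathbf1,z)=L_{[n]}(z+u_1,\ldots,z+u_n)$. The map $\sigma(z):V(R)\otimes V(R)\to V(R)\otimes V(R)\otimes\mathbb{C}(z)[[h]]$ is the unique $\mathbb{C}[[h]]$-module map with $$\sigma(z)\big(L_{[n]}^{+13}(u)L_{[m]}^{+24}(v)(\mathbf1\otimes\mathbf1)\big)=R_{nm}^{\bar1\bar2}(ze^{u-v})L_{[n]}^{+13}(u)L_{[m]}^{+24}(v)R_{nm}^{12}(ze^{u-v})^{-1}(\mathbf1\otimes\mathbf1),$$ where, with $R_{ij}=R_{ij}(ze^{u_i-v_{j-n}})$, $R_{nm}^{12}(ze^{u-v})=\prod^{\rightarrow}_{i=1,\ldots,n}\prod^{\leftarrow}_{j=n+1,\ldots,n+m}R_{ij}$ and $R_{nm}^{\bar1\bar2}(ze^{u-v})=\prod^{\leftarrow}_{i=1,\ldots,n}\prod^{\rightarrow}_{j=n+1,\ldots,n+m}R_{ij}$, and the superscripts $1,2,3,4$ refer to $(\mathrm{End}\,\mathbb{C}^N)^{\otimes n}\otimes(\mathrm{End}\,\mathbb{C}^N)^{\otimes m}\otimes V(R)\otimes V(R)$. $\phi$-coordinated $V(R)$-module (with $\phi(z_2,z_0)=z_2e^{z_0}$): a pair $(W,Y_W)$, where $W$ is a topologically free $\mathbb{C}[[h]]$-module and $Y_W(z):V(R)\otimes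 W\to W[[z^{\pm1}]]$, $u\otimes w\mapsto Y_W(u,z)w$, is a $\mathbb{C}[[h]]$-module map such that: $Y_W(\mathbf1,z)w=w$ for all $w\in W$; $Y_W(v,z)\in\mathrm{Hom}(W,W((z))_h)$ for all $v\in V(R)$; (weak associativity) for all $u,v\in V(R)$, $k\geqslant0$ there is $r\geqslant0$ with $(z_1-z_2)^rY_W(u,z_1)Y_W(v,z_2)\in\mathrm{Hom}(W,W((z_1,z_2)))$ mod $h^k$ and $$\big((z_1-z_2)^rY_W(u,z_1)Y_W(v,z_2)\big)\big|^{\mathrm{mod}\,h^k}_{z_1=z_2e^{z_0}}-z_2^r(e^{z_0}-1)^rY_W(Y(u,z_0)v,z_2)\in h^k\mathrm{Hom}(W,W[[z_0^{\pm1},z_2^{\pm1}]]);$$ ($\sigma$-locality) for all $u,v\in V(R)$, $k\geqslant0$ there is $r\geqslant0$ such that for all $w\in W$ $$(z_1-z_2)^rY_W(z_1)(1\otimes Y_W(z_2))\iota_{z_1,z_2}\big(\sigma(z_1/z_2)(u\otimes v)\otimes w\big)-(z_1-z_2)^rY_W(z_2)(1\otimes Y_W(z_1))(v\otimes u\otimes w)\in h^kW[[z_1^{\pm1},z_2^{\pm1}]].$$ If $U\subset W$ is a topologically free $\mathbb{C}[[h]]$-submodule, then $(U,Y_U)$ is a $\phi$-coordinated $V(R)$-submodule of $W$ if it is a $\phi$-coordinated $V(R)$-module with $Y_U(v,z)u=Y_W(v,z)u$ for all $v\in V(R)$, $u\in U$. *)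

theory Defs
  imports
    "HOL-Analysis.Analysis"
    "HOL-Library.Poly_Mapping"
    "HOL-Computational_Algebra.Computational_Algebra"
begin

no_notation fps_nth (infixl \<open>$\<close> 75)

section \<open>Modules over the ring of formal power series in h\<close>

text \<open>
  The ring \<open>\<complex>[[h]]\<close> is the type \<^typ>\<open>complex fps\<close>, with \<open>h\<close> = \<^term>\<open>fps_X\<close>.  Modules over it form a
  type class; submodules are carrier sets in such a type.
\<close>

class hmodule = ab_group_add +
  fixes hscale :: "complex fps \<Rightarrow> 'a \<Rightarrow> 'a"  (infixr \<open>\<odot>\<close> 75)
  assumes hscale_right_distrib: "c \<odot> (x + y) = c \<odot> x + c \<odot> y"
    and hscale_left_distrib: "(c + d) \<odot> x = c \<odot> x + d \<odot> x"
    and hscale_hscale: "c \<odot> (d \<odot> x) = (c * d) \<odot> x"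
    and hscale_one: "1 \<odot> x = x"

global_interpretation hmod: module "hscale :: complex fps \<Rightarrow> 'a \<Rightarrow> 'a :: hmodule"
  by standard (rule hscale_right_distrib hscale_left_distrib hscale_hscale hscale_one)+

definition hpow :: "nat \<Rightarrow> 'a::hmodule set \<Rightarrow> 'a set"
  where "hpow k W = (\<lambda>x. fps_X ^ k \<odot> x) ` W"

text \<open>
  \<open>W\<close> is isomorphic to \<open>V\<^sub>0[[h]]\<close>, whose elements are the sequences of coefficients of the
  powers of \<open>h\<close>.  The complex vector space \<open>V\<^sub>0\<close> may be taken inside the ambient type of \<open>W\<close>: any such
  isomorphism embeds it there.
\<close>

definition topologically_free :: "'a::hmodule set \<Rightarrow> bool"
  where "topologically_free W \<longleftrightarrow>
    (\<exists>V\<^sub>0 (\<phi> :: (nat \<Rightarrow> 'a) \<Rightarrow> 'a).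
       0 \<in> V\<^sub>0 \<and> (\<forall>x\<in>V\<^sub>0. \<forall>y\<in>V\<^sub>0. x + y \<in> V\<^sub>0) \<and> (\<forall>c. \<forall>x\<in>V\<^sub>0. fps_const c \<odot> x \<in> V\<^sub>0) \<and>
       bij_betw \<phi> {f. \<forall>n. f n \<in> V\<^sub>0} W \<and>
       (\<forall>f g. (\<forall>n. f n \<in> V\<^sub>0) \<and> (\<forall>n. g n \<in> V\<^sub>0) \<longrightarrow> \<phi> (\<lambda>n. f n + g n) = \<phi> f + \<phi> g) \<and>
       (\<forall>c f. (\<forall>n. f n \<in> V\<^sub>0) \<longrightarrow>
          \<phi> (\<lambda>n. \<Sum>i\<le>n. fps_const (fps_nth c i) \<odot> f (n - i)) = c \<odot> \<phi> f))"

definition trunc_sum :: "nat \<Rightarrow> 'a::hmodule set \<Rightarrow> ('i \<Rightarrow> 'a) \<Rightarrow> 'a"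
  where "trunc_sum k W f = (\<Sum>i | f i \<notin> hpow k W. f i)"

definition hsums :: "'a::hmodule set \<Rightarrow> ('i \<Rightarrow> 'a) \<Rightarrow> 'a \<Rightarrow> bool"
  where "hsums W f x \<longleftrightarrow> x \<in> W \<and> (\<forall>i. f i \<in> W) \<and>
    (\<forall>k. finite {i. f i \<notin> hpow k W} \<and> x - trunc_sum k W f \<in> hpow k W)"

text \<open>The sum of an \<open>h\<close>-adically summable family in \<open>W\<close> (meaningful if \<open>W\<close> is separated).\<close>

definition hsum :: "'a::hmodule set \<Rightarrow> ('i \<Rightarrow> 'a) \<Rightarrow> 'a"
  where "hsum W f = (THE x. hsums W f x)"

text \<open>
  Formal distributions are given by their coefficient functions.  A distribution in \<open>W[[z\<^sup>\<plusminus>\<^sup>1]]\<close>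
  lies in the \<open>h\<close>-adic completion \<open>W((z))\<^sub>h\<close> iff modulo every power of \<open>h\<close> it lies in \<open>W((z))\<close>.
\<close>

definition laurent_h :: "'a::hmodule set \<Rightarrow> (int \<Rightarrow> 'a) \<Rightarrow> bool"
  where "laurent_h W f \<longleftrightarrow> (\<forall>s. f s \<in> W) \<and> (\<forall>k. \<exists>M. \<forall>s<M. f s \<in> hpow k W)"


section \<open>The trigonometric R-matrix\<close>

definition mscale :: "'r::comm_ring_1 \<Rightarrow> 'r^'m^'k \<Rightarrow> 'r^'m^'k"  (infixr \<open>*m\<close> 70)
  where "c *m A = map_matrix ((*) c) A"

text \<open>
  Elements of \<open>(End \<complex>\<^sup>N)\<otimes>(End \<complex>\<^sup>N)\<close> over a ring are matrices with index set
  \<open>'n \<times> 'n\<close>, where \<open>'n\<close> is a finite linear order with \<open>N\<close> elements.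
  \<open>e\<^sub>i\<^sub>j \<otimes> e\<^sub>k\<^sub>l\<close> has its only nonzero entry in row \<open>(i,k)\<close> and column \<open>(j,l)\<close>.
\<close>

definition mat_unit2 :: "'n \<Rightarrow> 'n \<Rightarrow> 'n \<Rightarrow> 'n \<Rightarrow> ('r::comm_ring_1)^('n::finite \<times> 'n)^('n \<times> 'n)"
  where "mat_unit2 i j k l = (\<chi> a b. if a = (i, k) \<and> b = (j, l) then 1 else 0)"

text \<open>
  The argument \<open>E\<close> stands for \<open>c \<mapsto> e\<^sup>c\<^sup>h\<close> in the coefficient ring; \<open>z\<^sub>1\<close>, \<open>z\<^sub>2\<close>, \<open>z\<close> are elements of that ring.
\<close>

definition Rbar2 :: "(complex \<Rightarrow> 'r::comm_ring_1) \<Rightarrow> 'r \<Rightarrow> 'r \<Rightarrow>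
    'r^('n::{finite,linorder} \<times> 'n)^('n \<times> 'n)"
  where "Rbar2 E z\<^sub>1 z\<^sub>2 =
      (z\<^sub>1 * E (- 1/2) - z\<^sub>2 * E (1/2)) *m (\<Sum>i\<in>UNIV. mat_unit2 i i i i)
    + (z\<^sub>1 - z\<^sub>2) *m (\<Sum>(i, j) | i \<noteq> j. mat_unit2 i i j j)
    + ((E (- 1/2) - E (1/2)) * z\<^sub>1) *m (\<Sum>(i, j) | i > j. mat_unit2 i j j i)
    + ((E (- 1/2) - E (1/2)) * z\<^sub>2) *m (\<Sum>(i, j) | i < j. mat_unit2 i j j i)"

definition gfactor :: "(complex \<Rightarrow> 'r) \<Rightarrow> 'r \<Rightarrow> 'r::{comm_ring_1,inverse}"
  where "gfactor E z = - E (1/2) * inverse (1 - z * E 1)"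

text \<open>
  \<open>R(e\<^sup>\<epsilon>\<^sup>x)\<close> over \<open>\<complex>((x))[[h]]\<close>; here \<open>1 - e\<^sup>\<epsilon>\<^sup>x\<^sup>+\<^sup>h\<close> is inverted in \<open>\<complex>((x))[[h]]\<close>.
\<close>

definition R_exp :: "complex \<Rightarrow> complex fls fps^('n::{finite,linorder} \<times> 'n)^('n \<times> 'n)"
  where "R_exp \<epsilon> =
    (let E = (\<lambda>c. Abs_fps (\<lambda>n. fls_const (fps_nth (fps_exp c) n)));
         z = fps_const (fps_to_fls (fps_exp \<epsilon>))
     in gfactor E z *m Rbar2 E z 1)"

text \<open>
  \<open>R(z e\<^sup>x)\<close> over \<open>\<complex>(z)[[x]][[h]]\<close>.  The constant term of \<open>1 - z e\<^sup>x\<^sup>+\<^sup>h\<close> is the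
  nonzero rational function \<open>1 - z\<close>, and the inverse in \<open>\<complex>(z)[[x]][[h]]\<close> is the sum of
  \<open>(e\<^sup>x\<^sup>+\<^sup>h - 1)\<^sup>k z\<^sup>k (1 - z)\<^sup>-\<^sup>k\<^sup>-\<^sup>1\<close> over \<open>k \<ge> 0\<close>, i.e. the Taylor expansion of
  \<open>1/(1 - z e\<^sup>x\<^sup>+\<^sup>h)\<close> around \<open>z\<close>.
\<close>

type_synonym ratfun = "complex poly fract"

definition R_zexp :: "ratfun fps fps^('n::{finite,linorder} \<times> 'n)^('n \<times> 'n)"
  where "R_zexp =
    (let E = (\<lambda>c. Abs_fps (\<lambda>n. fps_const (to_fract [:fps_nth (fps_exp c) n:])));
         z = fps_const (Abs_fps (\<lambda>n. to_fract [:0, fps_nth (fps_exp 1) n:]))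
     in gfactor E z *m Rbar2 E z 1)"

text \<open>\<open>e\<^sup>-\<^sup>h\<^sup>/\<^sup>2 R\<close>-bar\<open>(z,1)\<close> over \<open>\<complex>[[h]][z]\<close>.\<close>

definition Rbar_poly :: "complex fps poly^('n::{finite,linorder} \<times> 'n)^('n \<times> 'n)"
  where "Rbar_poly = [:fps_exp (- 1/2):] *m Rbar2 (\<lambda>c. [:fps_exp c:]) [:0, 1:] 1"

text \<open>
  For \<open>f \<in> \<complex>((x))[[h]]\<close>: the coefficient of \<open>u\<^sup>\<alpha> v\<^sup>\<beta>\<close> in \<open>f(u - v)\<close> expanded in
  \<open>\<complex>((u))((v))[[h]]\<close>.  Since \<open>-u + v = -(u - v)\<close>, the matrix \<open>R(e\<^sup>-\<^sup>u\<^sup>+\<^sup>v)\<close>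
  is obtained from \<^term>\<open>R_exp (- 1)\<close> in the same way.
\<close>

definition expand_diff :: "complex fls fps \<Rightarrow> int \<Rightarrow> nat \<Rightarrow> complex fps"
  where "expand_diff f \<alpha> \<beta> =
    Abs_fps (\<lambda>n. (- 1) ^ \<beta> * (of_int (\<alpha> + int \<beta>) gchoose \<beta>) * fls_nth (fps_nth f n) (\<alpha> + int \<beta>))"

text \<open>For \<open>f \<in> \<complex>(z)[[x]][[h]]\<close>: the coefficient of \<open>u\<^sup>\<alpha> v\<^sup>\<beta>\<close> in \<open>f(u - v)\<close>.\<close>

definition expand_diff_z :: "ratfun fps fps \<Rightarrow> nat \<Rightarrow> nat \<Rightarrow> ratfun fps"
  where "expand_diff_z f \<alpha> \<beta> =
    Abs_fps (\<lambda>n. (- 1) ^ \<beta> * of_nat ((\<alpha> + \<beta>) choose \<beta>) * fps_nth (fps_nth f n) (\<alpha> + \<beta>))"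

text \<open>The expansion of \<open>f(1/y)\<close> in \<open>\<complex>((y))\<close>; with \<open>y = z\<^sub>2/z\<^sub>1\<close> this is the expansion of
  \<open>f(z\<^sub>1/z\<^sub>2)\<close> in \<open>\<complex>((z\<^sub>1))((z\<^sub>2))\<close>.\<close>

definition expand_inv :: "ratfun \<Rightarrow> complex fls"
  where "expand_inv f = (THE L. \<exists>p q. q \<noteq> 0 \<and> f = Fract p q \<and>
    L = poly (map_poly fls_const p) fls_X_inv / poly (map_poly fls_const q) fls_X_inv)"


section \<open>Free algebras\<close>

datatype 'g fword = FWord (letters: "'g list")

instantiation fword :: (type) monoid_add
begin
definition zero_fword :: "'a fword" where "0 = FWord []"
definition plus_fword :: "'a fword \<Rightarrow> 'a fword \<Rightarrow> 'a fword"
  where "v + w = FWord (letters v @ letters w)"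
instance by standard (simp_all add: zero_fword_def plus_fword_def)
end

text \<open>
  With words as exponents, \<^typ>\<open>'g fword \<Rightarrow>\<^sub>0 'r\<close> is the free unital associative algebra
  over \<open>'r\<close> on the generators \<open>'g\<close>, and \<^typ>\<open>('g fword \<Rightarrow>\<^sub>0 complex) fps\<close> is the
  \<open>h\<close>-adically completed free algebra over \<open>\<complex>[[h]]\<close>.
\<close>

definition two_sided_ideal :: "'a::ring_1 set \<Rightarrow> bool"
  where "two_sided_ideal I \<longleftrightarrow> 0 \<in> I \<and> (\<forall>x\<in>I. \<forall>y\<in>I. x + y \<in> I) \<and> (\<forall>a. \<forall>x\<in>I. a * x \<in> I \<and> x * a \<in> I)"

lemma two_sided_ideal_Inter:
  "(\<And>I. I \<in> S \<Longrightarrow> two_sided_ideal I) \<Longrightarrow> two_sided_ideal (\<Inter>S)"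
  unfolding two_sided_ideal_def by blast

lemma two_sided_idealD:
  assumes "two_sided_ideal I"
  shows "0 \<in> I" "x \<in> I \<Longrightarrow> y \<in> I \<Longrightarrow> x + y \<in> I" "x \<in> I \<Longrightarrow> a * x \<in> I" "x \<in> I \<Longrightarrow> x * a \<in> I"
    "x \<in> I \<Longrightarrow> - x \<in> I" "x \<in> I \<Longrightarrow> y \<in> I \<Longrightarrow> x - y \<in> I"
proof -
  show *: "0 \<in> I" "\<And>x y. x \<in> I \<Longrightarrow> y \<in> I \<Longrightarrow> x + y \<in> I" "\<And>x a. x \<in> I \<Longrightarrow> a * x \<in> I"
    "\<And>x a. x \<in> I \<Longrightarrow> x * a \<in> I"
    using assms unfolding two_sided_ideal_def by blast+
  show **: "- x \<in> I" if "x \<in> I" for x using *(3)[OF that, of "- 1"] by simp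
  show "x - y \<in> I" if "x \<in> I" "y \<in> I" for x y using *(2)[OF that(1) **[OF that(2)]] by simp
qed

lemma ideal_equivp:
  assumes "two_sided_ideal I"
  shows "equivp (\<lambda>x y. x - y \<in> I)"
proof (rule equivpI)
  note D = two_sided_idealD[OF assms]
  show "reflp (\<lambda>x y. x - y \<in> I)" by (simp add: reflp_def D(1))
  show "symp (\<lambda>x y. x - y \<in> I)"
    by (rule sympI) (metis D(5) minus_diff_eq)
  show "transp (\<lambda>x y. x - y \<in> I)"
    by (rule transpI) (metis D(2) diff_add_cancel add_diff_eq)
qed

lemma ideal_congs:
  assumes "two_sided_ideal I" "x - x' \<in> I" "y - y' \<in> I"
  shows "(x + y) - (x' + y') \<in> I" "(x - y) - (x' - y') \<in> I" "- x - (- x') \<in> I"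
    "x * y - x' * y' \<in> I" "a * x - a * x' \<in> I"
proof -
  note D = two_sided_idealD[OF assms(1)]
  have "(x + y) - (x' + y') = (x - x') + (y - y')" by simp
  then show "(x + y) - (x' + y') \<in> I" using D(2) assms(2,3) by metis
  have "(x - y) - (x' - y') = (x - x') - (y - y')" by simp
  then show "(x - y) - (x' - y') \<in> I" using D(6) assms(2,3) by metis
  have "- x - (- x') = - (x - x')" by simp
  then show "- x - (- x') \<in> I" using D(5) assms(2) by metis
  have "x * y - x' * y' = (x - x') * y + x' * (y - y')" by (simp add: algebra_simps)
  then show "x * y - x' * y' \<in> I" using D(2)[OF D(4)[OF assms(2), of y] D(3)[OF assms(3), of x']] by simp
  show "a * x - a * x' \<in> I" using D(3)[OF assms(2), of a] by (simp add: algebra_simps)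
qed


text \<open>Words add up to the empty word only trivially, so the coefficient of the empty word is multiplicative.\<close>

lemma lookup_times_fword_0:
  fixes x y :: "'g fword \<Rightarrow>\<^sub>0 'r::semiring_0"
  shows "Poly_Mapping.lookup (x * y) 0 = Poly_Mapping.lookup x 0 * Poly_Mapping.lookup y 0"
proof -
  have *: "(0 = v + w) = (v = 0 \<and> w = 0)" for v w :: "'g fword"
    by (cases v; cases w) (simp add: zero_fword_def plus_fword_def)
  have "Poly_Mapping.lookup (x * y) 0 =
      Sum_any (\<lambda>v. Poly_Mapping.lookup x v * Sum_any (\<lambda>w. Poly_Mapping.lookup y w when 0 = v + w))"
    by (simp add: times_poly_mapping.rep_eq prod_fun_def)
  also have "\<dots> = Sum_any (\<lambda>v :: 'g fword. Poly_Mapping.lookup x 0 * Poly_Mapping.lookup y 0 when v = 0)"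
    by (rule arg_cong[where f = Sum_any], rule ext) (auto simp: * when_def)
  finally show ?thesis by simp
qed


section \<open>The algebra V(R)\<close>

text \<open>The generator \<open>(i, j, r)\<close> is \<open>l\<^sub>i\<^sub>j\<^sup>(\<^sup>-\<^sup>r\<^sup>-\<^sup>1\<^sup>)\<close>, the coefficient of \<open>u\<^sup>r\<close>
  in \<open>l\<^sup>+\<^sub>i\<^sub>j(u)\<close>.\<close>

type_synonym 'n vfree = "(('n \<times> 'n \<times> nat) fword \<Rightarrow>\<^sub>0 complex) fps"

definition vfree_gen :: "'n \<Rightarrow> 'n \<Rightarrow> nat \<Rightarrow> 'n vfree"
  where "vfree_gen i j r = fps_const (Poly_Mapping.single (FWord [(i, j, r)]) 1)"

definition vfree_scalar :: "complex fps \<Rightarrow> 'n vfree"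
  where "vfree_scalar c = Abs_fps (\<lambda>n. Poly_Mapping.single 0 (fps_nth c n))"

text \<open>The entry at row \<open>(i, j)\<close>, column \<open>(k, l)\<close> of the coefficient of \<open>u\<^sup>\<alpha> v\<^sup>\<beta>\<close> in
  \<open>R\<^sub>2\<^sub>1(e\<^sup>-\<^sup>u\<^sup>+\<^sup>v) L\<^sup>+\<^sub>1(u) L\<^sup>+\<^sub>2(v) - L\<^sup>+\<^sub>2(v) L\<^sup>+\<^sub>1(u) R\<^sub>1\<^sub>2(e\<^sup>u\<^sup>-\<^sup>v)\<close>.
  Modulo each power of \<open>h\<close> only finitely many \<open>r\<close> contribute.\<close>

definition v_relator :: "'n::{finite,linorder} \<Rightarrow> 'n \<Rightarrow> 'n \<Rightarrow> 'n \<Rightarrow> int \<Rightarrow> nat \<Rightarrow> 'n vfree"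
  where "v_relator i j k l \<alpha> \<beta> = Abs_fps (\<lambda>n. Sum_any (\<lambda>r. fps_nth
    (\<Sum>(e, f)\<in>UNIV. \<Sum>s\<le>\<beta>.
        vfree_scalar (expand_diff (R_exp (- 1) $ (j, i) $ (f, e)) (\<alpha> - int r) (\<beta> - s))
          * (vfree_gen e k r * vfree_gen f l s)
      - vfree_scalar (expand_diff (R_exp 1 $ (e, f) $ (k, l)) (\<alpha> - int r) (\<beta> - s))
          * (vfree_gen j f s * vfree_gen i e r)) n))"

text \<open>
  The topologically free algebra with these generators and relations is the quotient of the completed
  free algebra by the smallest ideal containing the relators that is closed in the
  \<open>h\<close>-adic topology and has an \<open>h\<close>-torsion-free quotient.
\<close>

definition v_ideals :: "'n::{finite,linorder} vfree set set"
  where "v_ideals = {I. two_sided_ideal I \<and> (\<forall>i j k l \<alpha> \<beta>. v_relator i j k l \<alpha> \<beta> \<in> I) \<and>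
    (\<forall>x. fps_X * x \<in> I \<longrightarrow> x \<in> I) \<and>
    (\<forall>x. (\<forall>k. \<exists>y\<in>I. \<exists>d. x - y = fps_X ^ k * d) \<longrightarrow> x \<in> I)}"

definition v_rel :: "'n::{finite,linorder} vfree \<Rightarrow> 'n vfree \<Rightarrow> bool"
  where "v_rel x y \<longleftrightarrow> x - y \<in> \<Inter>v_ideals"

lemma v_ideal: "two_sided_ideal (\<Inter>v_ideals)"
  by (rule two_sided_ideal_Inter) (simp add: v_ideals_def)

lemma v_relI: "x = y \<Longrightarrow> v_rel x y"
  unfolding v_rel_def using two_sided_idealD(1)[OF v_ideal] by simp

lemma vfree_scalar_simps:
  "vfree_scalar (c + d) = vfree_scalar c + vfree_scalar d"
  "vfree_scalar (c * d) = vfree_scalar c * vfree_scalar d"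
  "vfree_scalar 1 = 1"
proof -
  have sum: "Poly_Mapping.single 0 (\<Sum>i\<in>A. f i) = (\<Sum>i\<in>A. Poly_Mapping.single 0 (f i))"
    for A :: "nat set" and f :: "nat \<Rightarrow> complex"
    by (induction A rule: infinite_finite_induct) (simp_all add: single_add)
  show "vfree_scalar (c + d) = vfree_scalar c + vfree_scalar d"
    by (rule fps_ext) (simp add: vfree_scalar_def single_add)
  show "vfree_scalar (c * d) = vfree_scalar c * vfree_scalar d"
    by (rule fps_ext) (simp add: vfree_scalar_def fps_mult_nth sum mult_single)
  show "vfree_scalar 1 = 1"
    by (rule fps_ext) (simp add: vfree_scalar_def fps_one_nth)
qed

lemma one_notin_v_ideal: "1 \<notin> \<Inter>(v_ideals :: 'n::{finite,linorder} vfree set set)"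
proof -
  define I :: "'n vfree set" where "I = {x. \<forall>n. Poly_Mapping.lookup (fps_nth x n) 0 = 0}"
  have lookup_sum0: "Poly_Mapping.lookup (\<Sum>i\<in>A. f i) 0 = (\<Sum>i\<in>A. Poly_Mapping.lookup (f i) 0)"
    for A :: "'i set" and f :: "'i \<Rightarrow> ('n \<times> 'n \<times> nat) fword \<Rightarrow>\<^sub>0 complex"
    by (induction A rule: infinite_finite_induct) (simp_all add: lookup_add)
  have mult: "x * y \<in> I" if "x \<in> I \<or> y \<in> I" for x y
    using that by (auto simp: I_def fps_mult_nth lookup_sum0 lookup_times_fword_0)
  have sums: "(\<Sum>i\<in>A. f i) \<in> I" if "\<And>i. i \<in> A \<Longrightarrow> f i \<in> I"
    for A :: "'i set" and f :: "'i \<Rightarrow> 'n vfree"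
    using that by (auto simp: I_def fps_sum_nth lookup_sum0 intro!: sum.neutral)
  have diff: "x - y \<in> I" if "x \<in> I" "y \<in> I" for x y
    using that by (auto simp: I_def lookup_minus)
  have gen: "vfree_gen i j r \<in> I" for i j r
    by (auto simp: I_def vfree_gen_def lookup_single zero_fword_def when_def)
  have rel: "v_relator i j k l \<alpha> \<beta> \<in> I" for i j k l \<alpha> \<beta>
  proof -
    define F where "F = (\<lambda>r. \<Sum>(e, f)\<in>(UNIV :: ('n \<times> 'n) set). \<Sum>s\<le>\<beta>.
        vfree_scalar (expand_diff (R_exp (- 1) $ (j, i) $ (f, e)) (\<alpha> - int r) (\<beta> - s))
          * (vfree_gen e k r * vfree_gen f l s)
      - vfree_scalar (expand_diff (R_exp 1 $ (e, f) $ (k, l)) (\<alpha> - int r) (\<beta> - s))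
          * (vfree_gen j f s * vfree_gen i e r))"
    have "F r \<in> I" for r
      unfolding F_def by (auto intro!: sums diff mult gen)
    then have "Poly_Mapping.lookup (Sum_any (\<lambda>r. fps_nth (F r) n)) 0 = 0" for n
      by (auto simp: Sum_any.expand_set lookup_sum0 I_def intro!: sum.neutral)
    then show ?thesis
      by (simp add: I_def v_relator_def F_def)
  qed
  have "two_sided_ideal I"
    unfolding two_sided_ideal_def using mult by (auto simp: I_def lookup_add)
  moreover have "x \<in> I" if "fps_X * x \<in> I" for x
    unfolding I_def
  proof safe
    fix n
    have "Poly_Mapping.lookup (fps_nth (fps_X * x) (Suc n)) 0 = 0" using that by (simp only: I_def mem_Collect_eq)
    then show "Poly_Mapping.lookup (fps_nth x n) 0 = 0" by simp
  qed
  moreover have "x \<in> I" if *: "\<And>k. \<exists>y\<in>I. \<exists>d. x - y = fps_X ^ k * d" for x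
    unfolding I_def
  proof safe
    fix n
    obtain y d where "y \<in> I" "x - y = fps_X ^ Suc n * d" using * by blast
    then have "fps_nth (x - y) n = 0" by (simp only: fps_X_power_mult_nth) simp
    then show "Poly_Mapping.lookup (fps_nth x n) 0 = 0" using \<open>y \<in> I\<close> by (simp add: I_def)
  qed
  ultimately have "I \<in> v_ideals" using rel unfolding v_ideals_def by blast
  moreover have "1 \<notin> I" by (auto simp: I_def intro!: exI[of _ 0])
  ultimately show ?thesis by blast
qed

lemma not_v_rel_0_1: "\<not> v_rel 0 (1 :: 'n::{finite,linorder} vfree)"
proof
  assume "v_rel 0 (1 :: 'n vfree)"
  then have "- (1 :: 'n vfree) \<in> \<Inter>v_ideals" unfolding v_rel_def by (simp only: diff_0)
  from two_sided_idealD(5)[OF v_ideal this] show False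
    using one_notin_v_ideal by (simp only: minus_minus) blast
qed

quotient_type (overloaded) 'n VR = "('n::{finite,linorder}) vfree" / v_rel
  unfolding v_rel_def by (rule ideal_equivp[OF v_ideal])

instantiation VR :: ("{finite,linorder}") "{ring_1,hmodule}"
begin
lift_definition zero_VR :: "'a VR" is 0 .
lift_definition one_VR :: "'a VR" is 1 .
lift_definition plus_VR :: "'a VR \<Rightarrow> 'a VR \<Rightarrow> 'a VR" is "(+)"
  unfolding v_rel_def by (rule ideal_congs(1)[OF v_ideal])
lift_definition minus_VR :: "'a VR \<Rightarrow> 'a VR \<Rightarrow> 'a VR" is "(-)"
  unfolding v_rel_def by (rule ideal_congs(2)[OF v_ideal])
lift_definition uminus_VR :: "'a VR \<Rightarrow> 'a VR" is uminus
  unfolding v_rel_def by (rule ideal_congs(3)[OF v_ideal])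
lift_definition times_VR :: "'a VR \<Rightarrow> 'a VR \<Rightarrow> 'a VR" is "(*)"
  unfolding v_rel_def by (rule ideal_congs(4)[OF v_ideal])
lift_definition hscale_VR :: "complex fps \<Rightarrow> 'a VR \<Rightarrow> 'a VR" is "\<lambda>c x. vfree_scalar c * x"
  unfolding v_rel_def by (rule ideal_congs(5)[OF v_ideal])
instance
proof
  fix a b c :: "'a VR" and r s :: "complex fps"
  show "a + b + c = a + (b + c)"
    by transfer (rule v_relI, rule add.assoc)
  show "a + b = b + a"
    by transfer (rule v_relI, rule add.commute)
  show "0 + a = a"
    by transfer (rule v_relI, simp)
  show "- a + a = 0"
    by transfer (rule v_relI, simp)
  show "a - b = a + - b"
    by transfer (rule v_relI, simp)
  show "a * b * c = a * (b * c)"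
    by transfer (rule v_relI, rule mult.assoc)
  show "1 * a = a"
    by transfer (rule v_relI, simp)
  show "a * 1 = a"
    by transfer (rule v_relI, simp)
  show "(a + b) * c = a * c + b * c"
    by transfer (rule v_relI, rule distrib_right)
  show "a * (b + c) = a * b + a * c"
    by transfer (rule v_relI, rule distrib_left)
  show "r \<odot> (a + b) = r \<odot> a + r \<odot> b"
    by transfer (rule v_relI, rule distrib_left)
  show "(r + s) \<odot> a = r \<odot> a + s \<odot> a"
    by transfer (rule v_relI, simp only: vfree_scalar_simps distrib_right)
  show "r \<odot> s \<odot> a = (r * s) \<odot> a"
    by transfer (rule v_relI, simp only: vfree_scalar_simps mult.assoc)
  show "1 \<odot> a = a"
    by transfer (rule v_relI, simp only: vfree_scalar_simps mult_1_left)
  show "(0 :: 'a VR) \<noteq> 1"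
    by transfer (rule not_v_rel_0_1)
qed
end
lift_definition lplus :: "'n::{finite,linorder} \<Rightarrow> 'n \<Rightarrow> nat \<Rightarrow> 'n VR" is vfree_gen .

text \<open>
  Entries of \<open>L\<^sup>+\<^sub>[\<^sub>n\<^sub>](u) = L\<^sup>+\<^sub>1(u\<^sub>1) \<dots> L\<^sup>+\<^sub>n(u\<^sub>n)\<close>.
  Elements of \<open>(End \<complex>\<^sup>N)\<^sup>\<otimes>\<^sup>n\<close> with entries in a module are functions of a row index \<open>a\<close> and a
  column index \<open>b\<close>, both lists of length \<open>n\<close>; exponents of \<open>(u\<^sub>1, \<dots>, u\<^sub>n)\<close> are lists too.  Tensor copies and
  variables are numbered from \<open>0\<close>.
\<close>

definition lplus_prod :: "'n list \<Rightarrow> 'n list \<Rightarrow> nat list \<Rightarrow> 'n::{finite,linorder} VR"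
  where "lplus_prod a b r = prod_list (map (\<lambda>i. lplus (a ! i) (b ! i) (r ! i)) [0..<length r])"

definition lplus_dist :: "'n list \<Rightarrow> 'n list \<Rightarrow> int list \<Rightarrow> 'n::{finite,linorder} VR"
  where "lplus_dist a b e = (if \<forall>x\<in>set e. 0 \<le> x then lplus_prod a b (map nat e) else 0)"

text \<open>Left multiplication by \<open>M\<^sub>p\<^sub>q(u\<^sub>p - u\<^sub>q)\<close>, expanded in nonnegative powers of \<open>u\<^sub>q\<close>.\<close>

definition act_R :: "complex fls fps^('n::finite \<times> 'n)^('n \<times> 'n) \<Rightarrow> nat \<Rightarrow> nat \<Rightarrow>
    ('n list \<Rightarrow> 'b \<Rightarrow> int list \<Rightarrow> 'v::hmodule) \<Rightarrow> 'n list \<Rightarrow> 'b \<Rightarrow> int list \<Rightarrow> 'v"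
  where "act_R M p q A a b e = hsum UNIV (\<lambda>((x, y), \<alpha>, \<beta>).
    expand_diff (M $ (a ! p, a ! q) $ (x, y)) \<alpha> \<beta> \<odot>
      A (a[p := x, q := y]) b (e[p := e ! p - \<alpha>, q := e ! q - int \<beta>]))"

abbreviation hlinear :: "('a::hmodule \<Rightarrow> 'b::hmodule) \<Rightarrow> bool"
  where "hlinear \<equiv> module_hom hscale hscale"

text \<open>
  \<open>L i j s\<close> is the coefficient of \<open>u\<^sup>s\<close> in the \<open>(i, j)\<close> entry of \<open>L(u)\<close>.  The last conjunct is
  \<open>L\<^sub>0(u\<^sub>0) L\<^sup>+\<^sub>1(u\<^sub>1) \<dots> L\<^sup>+\<^sub>n(u\<^sub>n) 1 =
  R\<^sub>0\<^sub>n\<^sup>-\<^sup>1 \<dots> R\<^sub>0\<^sub>1\<^sup>-\<^sup>1 L\<^sup>+\<^sub>0(u\<^sub>0) \<dots> L\<^sup>+\<^sub>n(u\<^sub>n) 1\<close>.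
\<close>

definition L_operator ::
    "('n::{finite,linorder} \<Rightarrow> 'n \<Rightarrow> int \<Rightarrow> 'n VR \<Rightarrow> 'n VR) \<Rightarrow> bool"
  where "L_operator L \<longleftrightarrow>
    (\<forall>i j s. hlinear (L i j s)) \<and>
    (\<forall>i j v. laurent_h UNIV (\<lambda>s. L i j s v)) \<and>
    (\<forall>i j s a b r. length a = length r \<and> length b = length r \<longrightarrow>
       L i j s (lplus_prod a b r) =
       foldr (\<lambda>k. act_R (matrix_inv (R_exp 1)) 0 k) (rev [1..<Suc (length r)]) lplus_dist
         (i # a) (j # b) (s # map int r))"

text \<open>
  The coefficient of \<open>u\<^sub>1\<^sup>e\<^sup>1 \<dots> u\<^sub>n\<^sup>e\<^sup>n\<close> in \<open>L\<^sub>[\<^sub>n\<^sub>](u) v =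
  (R\<^sub>1\<^sub>2 \<dots> R\<^sub>1\<^sub>n R\<^sub>2\<^sub>3 \<dots> R\<^sub>n\<^sub>-\<^sub>1\<^sub>,\<^sub>n) L\<^sub>1(u\<^sub>1) \<dots> L\<^sub>n(u\<^sub>n) v\<close>.
\<close>

definition L_bracket :: "('n \<Rightarrow> 'n \<Rightarrow> int \<Rightarrow> 'n VR \<Rightarrow> 'n VR) \<Rightarrow> nat \<Rightarrow> 'n VR \<Rightarrow>
    'n list \<Rightarrow> 'n list \<Rightarrow> int list \<Rightarrow> 'n::{finite,linorder} VR"
  where "L_bracket L n v =
    foldr (\<lambda>(i, j). act_R (R_exp 1) i j) [(i, j). i \<leftarrow> [0..<n], j \<leftarrow> [Suc i..<n]]
      (\<lambda>a b e. foldr (\<lambda>i. L (a ! i) (b ! i) (e ! i)) [0..<n] v)"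

text \<open>
  \<open>Y u s v\<close> is the coefficient of \<open>z\<^sup>s\<close> in \<open>Y(u,z)v\<close>.  In \<open>L\<^sub>[\<^sub>n\<^sub>](z + u\<^sub>1, \<dots>, z + u\<^sub>n)\<close>
  the power \<open>(z + u\<^sub>i)\<^sup>e\<close> contributes \<open>binomial(e, r\<^sub>i) z\<^sup>e\<^sup>-\<^sup>r\<^sup>i\<close> to the coefficient of
  \<open>u\<^sub>i\<^sup>r\<^sup>i\<close>.  The case of \<open>Y(1,z) = 1\<close> is the one of empty lists.
\<close>

definition vertex_operator_map :: "('n::{finite,linorder} \<Rightarrow> 'n \<Rightarrow> int \<Rightarrow> 'n VR \<Rightarrow> 'n VR) \<Rightarrow>
    ('n VR \<Rightarrow> int \<Rightarrow> 'n VR \<Rightarrow> 'n VR) \<Rightarrow> bool"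
  where "vertex_operator_map L Y \<longleftrightarrow>
    (\<forall>s v. hlinear (\<lambda>u. Y u s v)) \<and>
    (\<forall>u s. hlinear (Y u s)) \<and>
    (\<forall>u v. laurent_h UNIV (\<lambda>s. Y u s v)) \<and>
    (\<forall>a b r s v. length a = length r \<and> length b = length r \<longrightarrow>
       Y (lplus_prod a b r) s v = hsum UNIV (\<lambda>e.
         if length e = length r \<and> sum_list e = s + int (sum_list r)
         then fps_const (\<Prod>i<length r. of_int (e ! i) gchoose (r ! i)) \<odot> L_bracket L (length r) v a b e
         else 0))"


section \<open>The map sigma\<close>

text \<open>
  The completed tensor product of two copies of \<open>V(R)\<close> with \<open>\<complex>(z)[[h]]\<close> is constructed as the quotient of the
  \<open>h\<close>-adically completed free \<open>\<complex>(z)[[h]]\<close>-module on pairs by the smallest \<open>h\<close>-adically closed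
  submodule with \<open>h\<close>-torsion-free quotient that makes the pairs bilinear over \<open>\<complex>[[h]]\<close>.
\<close>

type_synonym 'n vvfree = "('n VR \<times> 'n VR \<Rightarrow>\<^sub>0 ratfun) fps"

definition vv_scale :: "ratfun fps \<Rightarrow> 'n::{finite,linorder} vvfree \<Rightarrow> 'n vvfree"
  where "vv_scale c x = Abs_fps (\<lambda>n. \<Sum>i\<le>n. Poly_Mapping.map ((*) (fps_nth c i)) (fps_nth x (n - i)))"

definition vv_gen :: "'n::{finite,linorder} VR \<Rightarrow> 'n VR \<Rightarrow> 'n vvfree"
  where "vv_gen u v = fps_const (Poly_Mapping.single (u, v) 1)"

definition ratfun_scalar :: "complex fps \<Rightarrow> ratfun fps"
  where "ratfun_scalar c = Abs_fps (\<lambda>n. to_fract [:fps_nth c n:])"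

definition vv_submodules :: "'n::{finite,linorder} vvfree set set"
  where "vv_submodules = {M. 0 \<in> M \<and> (\<forall>x\<in>M. \<forall>y\<in>M. x - y \<in> M) \<and> (\<forall>c. \<forall>x\<in>M. vv_scale c x \<in> M) \<and>
    (\<forall>u u' v. vv_gen (u + u') v - (vv_gen u v + vv_gen u' v) \<in> M) \<and>
    (\<forall>u v v'. vv_gen u (v + v') - (vv_gen u v + vv_gen u v') \<in> M) \<and>
    (\<forall>c u v. vv_gen (c \<odot> u) v - vv_scale (ratfun_scalar c) (vv_gen u v) \<in> M) \<and>
    (\<forall>c u v. vv_gen u (c \<odot> v) - vv_scale (ratfun_scalar c) (vv_gen u v) \<in> M) \<and>
    (\<forall>x. vv_scale fps_X x \<in> M \<longrightarrow> x \<in> M) \<and>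
    (\<forall>x. (\<forall>k. \<exists>y\<in>M. \<exists>d. x - y = vv_scale (fps_X ^ k) d) \<longrightarrow> x \<in> M)}"

definition vv_rel :: "'n::{finite,linorder} vvfree \<Rightarrow> 'n vvfree \<Rightarrow> bool"
  where "vv_rel x y \<longleftrightarrow> x - y \<in> \<Inter>vv_submodules"

lemma vv_submodulesD:
  assumes "M \<in> vv_submodules"
  shows "0 \<in> M" "\<forall>x\<in>M. \<forall>y\<in>M. x - y \<in> M" "\<forall>c. \<forall>x\<in>M. vv_scale c x \<in> M"
proof -
  note * = assms[unfolded vv_submodules_def mem_Collect_eq]
  show "0 \<in> M" by (rule *[THEN conjunct1])
  show "\<forall>x\<in>M. \<forall>y\<in>M. x - y \<in> M" by (rule *[THEN conjunct2, THEN conjunct1])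
  show "\<forall>c. \<forall>x\<in>M. vv_scale c x \<in> M" by (rule *[THEN conjunct2, THEN conjunct2, THEN conjunct1])
qed

lemma vv_submoduleD:
  fixes x y :: "'n::{finite,linorder} vvfree"
  shows "(0 :: 'n vvfree) \<in> \<Inter>vv_submodules"
    "x \<in> \<Inter>vv_submodules \<Longrightarrow> y \<in> \<Inter>vv_submodules \<Longrightarrow> x - y \<in> \<Inter>vv_submodules"
    "x \<in> \<Inter>vv_submodules \<Longrightarrow> vv_scale c x \<in> \<Inter>vv_submodules"
proof -
  show "(0 :: 'n vvfree) \<in> \<Inter>vv_submodules"
    by (rule InterI, rule vv_submodulesD(1))
  show "x - y \<in> \<Inter>vv_submodules" if "x \<in> \<Inter>vv_submodules" "y \<in> \<Inter>vv_submodules"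
    by (rule InterI, rule vv_submodulesD(2)[rule_format]) (use that in blast)+
  show "vv_scale c x \<in> \<Inter>vv_submodules" if "x \<in> \<Inter>vv_submodules"
    by (rule InterI, rule vv_submodulesD(3)[rule_format]) (use that in blast)+
qed

lemma vv_submodule_uminus_add:
  fixes x :: "'n::{finite,linorder} vvfree"
  assumes "x \<in> \<Inter>vv_submodules"
  shows "- x \<in> \<Inter>vv_submodules" "y \<in> \<Inter>vv_submodules \<Longrightarrow> x + y \<in> \<Inter>vv_submodules"
proof -
  have *: "- z \<in> \<Inter>vv_submodules" if "z \<in> \<Inter>vv_submodules" for z :: "'n vvfree"
    using vv_submoduleD(2)[OF vv_submoduleD(1) that] by simp
  show "- x \<in> \<Inter>vv_submodules" by (rule *[OF assms])
  show "x + y \<in> \<Inter>vv_submodules" if "y \<in> \<Inter>vv_submodules"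
    using vv_submoduleD(2)[OF assms *[OF that]] by simp
qed

lemma vv_relI: "x = y \<Longrightarrow> vv_rel x y"
  unfolding vv_rel_def using vv_submoduleD(1) by simp

lemma vv_scale_diff:
  fixes x y :: "'n::{finite,linorder} vvfree"
  shows "vv_scale c (x - y) = vv_scale c x - vv_scale c y"
proof -
  have "Poly_Mapping.map ((*) d) (p - q) = Poly_Mapping.map ((*) d) p - Poly_Mapping.map ((*) d) q"
    for d :: ratfun and p q :: "'n VR \<times> 'n VR \<Rightarrow>\<^sub>0 ratfun"
    by (rule poly_mapping_eqI) (auto simp: lookup_minus map.rep_eq when_def algebra_simps)
  then show ?thesis
    by (intro fps_ext) (simp add: vv_scale_def sum_subtractf)
qed

lemma diff_diff_swap: "(a - b) - (c - d) = (a - c) - (b - d)" for a :: "'a::ab_group_add"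
  by (simp add: algebra_simps)

lemma vv_equivp: "equivp (vv_rel :: 'n::{finite,linorder} vvfree \<Rightarrow> 'n vvfree \<Rightarrow> bool)"
proof (rule equivpI)
  show "reflp (vv_rel :: 'n vvfree \<Rightarrow> _)" by (simp add: reflp_def vv_relI)
  show "symp (vv_rel :: 'n vvfree \<Rightarrow> _)"
  proof (rule sympI)
    fix x y :: "'n vvfree"
    assume "vv_rel x y"
    then have "x - y \<in> \<Inter>vv_submodules" by (simp only: vv_rel_def)
    from vv_submodule_uminus_add(1)[OF this] show "vv_rel y x" by (simp only: vv_rel_def minus_diff_eq)
  qed
  show "transp (vv_rel :: 'n vvfree \<Rightarrow> _)"
  proof (rule transpI)
    fix x y z :: "'n vvfree"
    assume "vv_rel x y" "vv_rel y z"
    then have "x - y \<in> \<Inter>vv_submodules" "y - z \<in> \<Inter>vv_submodules" by (simp_all only: vv_rel_def)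
    from vv_submodule_uminus_add(2)[OF this] show "vv_rel x z" by (simp only: vv_rel_def) simp
  qed
qed

quotient_type (overloaded) 'n VVz = "('n::{finite,linorder}) vvfree" / vv_rel
  by (rule vv_equivp)

instantiation VVz :: ("{finite,linorder}") ab_group_add
begin
lift_definition zero_VVz :: "'a VVz" is 0 .
lift_definition plus_VVz :: "'a VVz \<Rightarrow> 'a VVz \<Rightarrow> 'a VVz" is "(+)"
  unfolding vv_rel_def by (subst add_diff_add) (rule vv_submodule_uminus_add(2))
lift_definition uminus_VVz :: "'a VVz \<Rightarrow> 'a VVz" is uminus
  unfolding vv_rel_def by (subst minus_diff_minus) (rule vv_submodule_uminus_add(1))
lift_definition minus_VVz :: "'a VVz \<Rightarrow> 'a VVz \<Rightarrow> 'a VVz" is "(-)"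
  unfolding vv_rel_def by (subst diff_diff_swap) (rule vv_submoduleD(2))
instance
proof
  fix a b c :: "'a VVz"
  show "a + b + c = a + (b + c)"
    by transfer (rule vv_relI, rule add.assoc)
  show "a + b = b + a"
    by transfer (rule vv_relI, rule add.commute)
  show "0 + a = a"
    by transfer (rule vv_relI, simp)
  show "- a + a = 0"
    by transfer (rule vv_relI, simp)
  show "a - b = a + - b"
    by transfer (rule vv_relI, simp)
qed
end

lift_definition zscale :: "ratfun fps \<Rightarrow> 'n::{finite,linorder} VVz \<Rightarrow> 'n VVz" is vv_scale
  unfolding vv_rel_def by (subst vv_scale_diff [symmetric]) (rule vv_submoduleD(3))

lift_definition vtensor :: "'n::{finite,linorder} VR \<Rightarrow> 'n VR \<Rightarrow> 'n VVz" is vv_gen .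

text \<open>
  Left and right multiplication by \<open>M\<^sub>p\<^sub>q(u\<^sub>p - u\<^sub>q)\<close>, which involves nonnegative powers of
  \<open>u\<^sub>p\<close> and \<open>u\<^sub>q\<close> only.
\<close>

definition act_Rz :: "ratfun fps fps^('n \<times> 'n)^('n \<times> 'n) \<Rightarrow> nat \<Rightarrow> nat \<Rightarrow>
    ('n list \<Rightarrow> 'n list \<Rightarrow> nat list \<Rightarrow> 'n::{finite,linorder} VVz) \<Rightarrow> 'n list \<Rightarrow> 'n list \<Rightarrow> nat list \<Rightarrow> 'n VVz"
  where "act_Rz M p q A a b r = (\<Sum>(x, y)\<in>UNIV. \<Sum>\<alpha>\<le>r ! p. \<Sum>\<beta>\<le>r ! q.
    zscale (expand_diff_z (M $ (a ! p, a ! q) $ (x, y)) \<alpha> \<beta>)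
      (A (a[p := x, q := y]) b (r[p := r ! p - \<alpha>, q := r ! q - \<beta>])))"

definition ract_Rz :: "ratfun fps fps^('n \<times> 'n)^('n \<times> 'n) \<Rightarrow> nat \<Rightarrow> nat \<Rightarrow>
    ('n list \<Rightarrow> 'n list \<Rightarrow> nat list \<Rightarrow> 'n::{finite,linorder} VVz) \<Rightarrow> 'n list \<Rightarrow> 'n list \<Rightarrow> nat list \<Rightarrow> 'n VVz"
  where "ract_Rz M p q A a b r = (\<Sum>(x, y)\<in>UNIV. \<Sum>\<alpha>\<le>r ! p. \<Sum>\<beta>\<le>r ! q.
    zscale (expand_diff_z (M $ (x, y) $ (b ! p, b ! q)) \<alpha> \<beta>)
      (A a (b[p := x, q := y]) (r[p := r ! p - \<alpha>, q := r ! q - \<beta>])))"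

text \<open>
  A linear map on the completed tensor product \<open>V(R) \<otimes> V(R)\<close> is given as a bilinear map.
  Copies \<open>0..<n\<close> belong to \<open>u\<close>, copies \<open>n..<n+m\<close> to \<open>v\<close>.  Right multiplication by the inverse of the ordered
  product \<open>X\<^sub>1 X\<^sub>2 \<dots> X\<^sub>k\<close> is right multiplication first by \<open>X\<^sub>k\<^sup>-\<^sup>1\<close> and last by
  \<open>X\<^sub>1\<^sup>-\<^sup>1\<close>.
\<close>

definition sigma_map :: "('n::{finite,linorder} VR \<Rightarrow> 'n VR \<Rightarrow> 'n VVz) \<Rightarrow> bool"
  where "sigma_map S \<longleftrightarrow>
    (\<forall>u u' v. S (u + u') v = S u v + S u' v) \<and>
    (\<forall>u v v'. S u (v + v') = S u v + S u v') \<and>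
    (\<forall>c u v. S (c \<odot> u) v = zscale (ratfun_scalar c) (S u v)) \<and>
    (\<forall>c u v. S u (c \<odot> v) = zscale (ratfun_scalar c) (S u v)) \<and>
    (\<forall>n m a b r. length a = n + m \<and> length b = n + m \<and> length r = n + m \<longrightarrow>
       S (lplus_prod (take n a) (take n b) (take n r)) (lplus_prod (drop n a) (drop n b) (drop n r)) =
       foldr (\<lambda>(i, j). act_Rz R_zexp i j) [(i, j). i \<leftarrow> rev [0..<n], j \<leftarrow> [n..<n + m]]
         (foldr (\<lambda>(i, j). ract_Rz (matrix_inv R_zexp) i j) [(i, j). i \<leftarrow> [0..<n], j \<leftarrow> rev [n..<n + m]]
           (\<lambda>a b r. vtensor (lplus_prod (take n a) (take n b) (take n r))
              (lplus_prod (drop n a) (drop n b) (drop n r))))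
         a b r)"


section \<open>Phi-coordinated modules\<close>

text \<open>Multiplication of \<open>A(z\<^sub>1,z\<^sub>2)\<close> by \<open>(z\<^sub>1 - z\<^sub>2)\<^sup>r\<close>.\<close>

definition mult_diff :: "nat \<Rightarrow> (int \<Rightarrow> int \<Rightarrow> 'w::hmodule) \<Rightarrow> int \<Rightarrow> int \<Rightarrow> 'w"
  where "mult_diff r A p q =
    (\<Sum>i\<le>r. ((- 1) ^ i * of_nat (r choose i)) \<odot> A (p - int (r - i)) (q - int i))"

text \<open>
  The coefficient of \<open>z\<^sub>1\<^sup>p z\<^sub>2\<^sup>q\<close> in
  \<open>Y\<^sub>W(z\<^sub>1)(1 \<otimes> Y\<^sub>W(z\<^sub>2)) \<iota>\<^sub>z\<^sub>1\<^sub>,\<^sub>z\<^sub>2(x(z\<^sub>1/z\<^sub>2) \<otimes> w)\<close>.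
  It is computed from a representative
  of \<open>x\<close>, a formal sum of terms \<open>h\<^sup>k f(z) (u \<otimes> v)\<close>; by bilinearity and continuity of
  \<open>Y\<^sub>W(u,z\<^sub>1) Y\<^sub>W(v,z\<^sub>2) w\<close> in \<open>(u, v)\<close> the choice does not matter.
\<close>

definition eval_VVz :: "'w::hmodule set \<Rightarrow> ('n::{finite,linorder} VR \<Rightarrow> int \<Rightarrow> 'w \<Rightarrow> 'w) \<Rightarrow>
    'n VVz \<Rightarrow> 'w \<Rightarrow> int \<Rightarrow> int \<Rightarrow> 'w"
  where "eval_VVz W YW x w p q = hsum W (\<lambda>(k, (u, v), m).
    (fps_X ^ k * fps_const (fls_nth (expand_inv (Poly_Mapping.lookup (fps_nth (rep_VVz x) k) (u, v))) m)) \<odot>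
      YW u (p + m) (YW v (q - m) w))"

text \<open>
  \<open>YW v s w\<close> is the coefficient of \<open>z\<^sup>s\<close> in \<open>Y\<^sub>W(v,z)w\<close>; only its values for \<open>w \<in> W\<close> matter.
  In the weak associativity, \<open>Hom(W, W((z\<^sub>1,z\<^sub>2)))\<close> modulo \<open>h\<^sup>k\<close> is
  taken pointwise in \<open>w\<close>, and \<open>z\<^sub>1\<^sup>p z\<^sub>2\<^sup>s\<^sup>-\<^sup>p\<close> becomes
  \<open>z\<^sub>2\<^sup>s e\<^sup>p\<^sup>z\<^sup>0\<close> under \<open>z\<^sub>1 = z\<^sub>2 e\<^sup>z\<^sup>0\<close>.
\<close>

definition weak_associativity :: "('n::{finite,linorder} VR \<Rightarrow> int \<Rightarrow> 'n VR \<Rightarrow> 'n VR) \<Rightarrow>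
    'w::hmodule set \<Rightarrow> ('n VR \<Rightarrow> int \<Rightarrow> 'w \<Rightarrow> 'w) \<Rightarrow> bool"
  where "weak_associativity Y W YW \<longleftrightarrow> (\<forall>u v k. \<exists>r. \<forall>w\<in>W.
    let A = mult_diff r (\<lambda>p q. YW u p (YW v q w)) in
      (\<exists>M. \<forall>p q. p < M \<or> q < M \<longrightarrow> A p q \<in> hpow k W) \<and>
      (\<forall>t s. (if t < 0 then 0
               else trunc_sum k W (\<lambda>p. fps_const (of_int p ^ nat t / fact (nat t)) \<odot> A p (s - p)))
             - hsum W (\<lambda>i. fps_const (fps_nth ((fps_exp 1 - 1) ^ r) i) \<odot>
                 YW (Y u (t - int i) v) (s - int r) w)
           \<in> hpow k W))"

definition sigma_locality :: "('n::{finite,linorder} VR \<Rightarrow> 'n VR \<Rightarrow> 'n VVz) \<Rightarrow>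
    'w::hmodule set \<Rightarrow> ('n VR \<Rightarrow> int \<Rightarrow> 'w \<Rightarrow> 'w) \<Rightarrow> bool"
  where "sigma_locality S W YW \<longleftrightarrow> (\<forall>u v k. \<exists>r. \<forall>w\<in>W. \<forall>p q.
    mult_diff r (eval_VVz W YW (S u v) w) p q - mult_diff r (\<lambda>p q. YW v q (YW u p w)) p q \<in> hpow k W)"

definition phi_module :: "('n::{finite,linorder} VR \<Rightarrow> int \<Rightarrow> 'n VR \<Rightarrow> 'n VR) \<Rightarrow>
    ('n VR \<Rightarrow> 'n VR \<Rightarrow> 'n VVz) \<Rightarrow> 'w::hmodule set \<Rightarrow> ('n VR \<Rightarrow> int \<Rightarrow> 'w \<Rightarrow> 'w) \<Rightarrow> bool"
  where "phi_module Y S W YW \<longleftrightarrow>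
    hmod.subspace W \<and> topologically_free W \<and>
    (\<forall>v s. \<forall>w\<in>W. \<forall>w'\<in>W. YW v s (w + w') = YW v s w + YW v s w') \<and>
    (\<forall>v s c. \<forall>w\<in>W. YW v s (c \<odot> w) = c \<odot> YW v s w) \<and>
    (\<forall>s. \<forall>w\<in>W. hlinear (\<lambda>v. YW v s w)) \<and>
    (\<forall>v. \<forall>w\<in>W. laurent_h W (\<lambda>s. YW v s w)) \<and>
    (\<forall>s. \<forall>w\<in>W. YW 1 s w = (if s = 0 then w else 0)) \<and>
    weak_associativity Y W YW \<and> sigma_locality S W YW"

definition phi_submodule :: "('n::{finite,linorder} VR \<Rightarrow> int \<Rightarrow> 'n VR \<Rightarrow> 'n VR) \<Rightarrow>
    ('n VR \<Rightarrow> 'n VR \<Rightarrow> 'n VVz) \<Rightarrow> 'w::hmodule set \<Rightarrow> 'w set \<Rightarrow> ('n VR \<Rightarrow> int \<Rightarrow> 'w \<Rightarrow> 'w) \<Rightarrow> bool"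
  where "phi_submodule Y S U W YW \<longleftrightarrow> U \<subseteq> W \<and> hmod.subspace U \<and> topologically_free U \<and>
    (\<exists>YU. phi_module Y S U YU \<and> (\<forall>v s. \<forall>u\<in>U. YU v s u = YW v s u))"


section \<open>The generalized h-Yangian\<close>

text \<open>The generator \<open>(i, j, s)\<close> is \<open>\<tau>\<^sub>i\<^sub>j\<^sup>(\<^sup>-\<^sup>s\<^sup>)\<close>, the coefficient of \<open>z\<^sup>s\<close>
  in \<open>\<tau>\<^sub>i\<^sub>j(z)\<close>.\<close>

type_synonym 'n yfree = "('n \<times> 'n \<times> int) fword \<Rightarrow>\<^sub>0 complex fps"

definition yfree_gen :: "'n \<Rightarrow> 'n \<Rightarrow> int \<Rightarrow> 'n yfree"
  where "yfree_gen i j s = Poly_Mapping.single (FWord [(i, j, s)]) 1"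

definition yfree_scalar :: "complex fps \<Rightarrow> 'n yfree"
  where "yfree_scalar c = Poly_Mapping.single 0 c"

text \<open>The entry at row \<open>(i, j)\<close>, column \<open>(k, l)\<close> of the coefficient of
  \<open>z\<^sub>1\<^sup>p z\<^sub>2\<^sup>q\<close> in the difference of the two sides of the RTT relation.\<close>

definition y_relator :: "'n::{finite,linorder} \<Rightarrow> 'n \<Rightarrow> 'n \<Rightarrow> 'n \<Rightarrow> int \<Rightarrow> int \<Rightarrow> 'n yfree"
  where "y_relator i j k l p q =
    (\<Sum>(e, f)\<in>UNIV. \<Sum>m\<le>degree (Rbar_poly $ (i, j) $ (e, f)).
        yfree_scalar (coeff (Rbar_poly $ (i, j) $ (e, f)) m)
          * (yfree_gen e k (p - int m) * yfree_gen f l (q + int m)))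
  - (\<Sum>(e, f)\<in>UNIV. \<Sum>m\<le>degree (Rbar_poly $ (e, f) $ (k, l)).
        yfree_gen j f (q + int m) * yfree_gen i e (p - int m)
          * yfree_scalar (coeff (Rbar_poly $ (e, f) $ (k, l)) m))"

definition y_ideals :: "'n::{finite,linorder} yfree set set"
  where "y_ideals = {I. two_sided_ideal I \<and> (\<forall>i j k l p q. y_relator i j k l p q \<in> I)}"

definition y_rel :: "'n::{finite,linorder} yfree \<Rightarrow> 'n yfree \<Rightarrow> bool"
  where "y_rel x y \<longleftrightarrow> x - y \<in> \<Inter>y_ideals"

lemma y_ideal: "two_sided_ideal (\<Inter>y_ideals)"
  by (rule two_sided_ideal_Inter) (simp add: y_ideals_def)

lemma y_relI: "x = y \<Longrightarrow> y_rel x y"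
  unfolding y_rel_def using two_sided_idealD(1)[OF y_ideal] by simp

lemma yfree_scalar_simps:
  "yfree_scalar (c + d) = yfree_scalar c + yfree_scalar d"
  "yfree_scalar (c * d) = yfree_scalar c * yfree_scalar d"
  "yfree_scalar 1 = 1"
  by (simp_all add: yfree_scalar_def single_add mult_single)

lemma one_notin_y_ideal: "1 \<notin> \<Inter>(y_ideals :: 'n::{finite,linorder} yfree set set)"
proof -
  define I :: "'n yfree set" where "I = {x. Poly_Mapping.lookup x 0 = 0}"
  have ideal: "two_sided_ideal I"
    unfolding two_sided_ideal_def I_def by (simp add: lookup_add lookup_times_fword_0)
  note D = two_sided_idealD[OF ideal]
  have sums: "(\<Sum>i\<in>A. f i) \<in> I" if "\<And>i. i \<in> A \<Longrightarrow> f i \<in> I"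
    for A :: "'i set" and f :: "'i \<Rightarrow> 'n yfree"
    using that by (induction A rule: infinite_finite_induct) (simp_all add: D(1,2))
  have mult: "x * y \<in> I" if "x \<in> I \<or> y \<in> I" for x y
    using that D(3,4) by blast
  have gen: "yfree_gen i j s \<in> I" for i j s
    by (simp add: I_def yfree_gen_def lookup_single zero_fword_def when_def)
  have "y_relator i j k l p q \<in> I" for i j k l p q
    unfolding y_relator_def by (auto intro!: D(6) sums mult gen)
  then have "I \<in> y_ideals" using ideal by (simp add: y_ideals_def)
  moreover have "1 \<notin> I" by (simp add: I_def)
  ultimately show ?thesis by blast
qed

lemma not_y_rel_0_1: "\<not> y_rel 0 (1 :: 'n::{finite,linorder} yfree)"
proof
  assume "y_rel 0 (1 :: 'n yfree)"
  then have "- (1 :: 'n yfree) \<in> \<Inter>y_ideals" unfolding y_rel_def by (simp only: diff_0)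
  from two_sided_idealD(5)[OF y_ideal this] show False
    using one_notin_y_ideal by (simp only: minus_minus) blast
qed

quotient_type (overloaded) 'n yangian = "('n::{finite,linorder}) yfree" / y_rel
  unfolding y_rel_def by (rule ideal_equivp[OF y_ideal])

instantiation yangian :: ("{finite,linorder}") "{ring_1,hmodule}"
begin
lift_definition zero_yangian :: "'a yangian" is 0 .
lift_definition one_yangian :: "'a yangian" is 1 .
lift_definition plus_yangian :: "'a yangian \<Rightarrow> 'a yangian \<Rightarrow> 'a yangian" is "(+)"
  unfolding y_rel_def by (rule ideal_congs(1)[OF y_ideal])
lift_definition minus_yangian :: "'a yangian \<Rightarrow> 'a yangian \<Rightarrow> 'a yangian" is "(-)"
  unfolding y_rel_def by (rule ideal_congs(2)[OF y_ideal])
lift_definition uminus_yangian :: "'a yangian \<Rightarrow> 'a yangian" is uminus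
  unfolding y_rel_def by (rule ideal_congs(3)[OF y_ideal])
lift_definition times_yangian :: "'a yangian \<Rightarrow> 'a yangian \<Rightarrow> 'a yangian" is "(*)"
  unfolding y_rel_def by (rule ideal_congs(4)[OF y_ideal])
lift_definition hscale_yangian :: "complex fps \<Rightarrow> 'a yangian \<Rightarrow> 'a yangian" is "\<lambda>c x. yfree_scalar c * x"
  unfolding y_rel_def by (rule ideal_congs(5)[OF y_ideal])
instance
proof
  fix a b c :: "'a yangian" and r s :: "complex fps"
  show "a + b + c = a + (b + c)"
    by transfer (rule y_relI, rule add.assoc)
  show "a + b = b + a"
    by transfer (rule y_relI, rule add.commute)
  show "0 + a = a"
    by transfer (rule y_relI, simp)
  show "- a + a = 0"
    by transfer (rule y_relI, simp)
  show "a - b = a + - b"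
    by transfer (rule y_relI, simp)
  show "a * b * c = a * (b * c)"
    by transfer (rule y_relI, rule mult.assoc)
  show "1 * a = a"
    by transfer (rule y_relI, simp)
  show "a * 1 = a"
    by transfer (rule y_relI, simp)
  show "(a + b) * c = a * c + b * c"
    by transfer (rule y_relI, rule distrib_right)
  show "a * (b + c) = a * b + a * c"
    by transfer (rule y_relI, rule distrib_left)
  show "r \<odot> (a + b) = r \<odot> a + r \<odot> b"
    by transfer (rule y_relI, rule distrib_left)
  show "(r + s) \<odot> a = r \<odot> a + s \<odot> a"
    by transfer (rule y_relI, simp only: yfree_scalar_simps distrib_right)
  show "r \<odot> s \<odot> a = (r * s) \<odot> a"
    by transfer (rule y_relI, simp only: yfree_scalar_simps mult.assoc)
  show "1 \<odot> a = a"
    by transfer (rule y_relI, simp only: yfree_scalar_simps mult_1_left)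
  show "(0 :: 'a yangian) \<noteq> 1"
    by transfer (rule not_y_rel_0_1)
qed
end
text \<open>\<open>tau i j s\<close> is the coefficient of \<open>z\<^sup>s\<close> in \<open>\<tau>\<^sub>i\<^sub>j(z)\<close>.\<close>

lift_definition tau :: "'n::{finite,linorder} \<Rightarrow> 'n \<Rightarrow> int \<Rightarrow> 'n yangian" is yfree_gen .

text \<open>Actions are normalized to be \<^const>\<open>undefined\<close> outside the carrier \<open>W\<close>, so that uniqueness of a
  module structure on \<open>W\<close> can be expressed as uniqueness of the action.\<close>

definition yangian_module :: "'w::hmodule set \<Rightarrow> ('n::{finite,linorder} yangian \<Rightarrow> 'w \<Rightarrow> 'w) \<Rightarrow> bool"
  where "yangian_module W act \<longleftrightarrow>
    hmod.subspace W \<and>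
    (\<forall>x. act x \<in> extensional W \<and> act x ` W \<subseteq> W) \<and>
    (\<forall>x. \<forall>w\<in>W. \<forall>w'\<in>W. act x (w + w') = act x w + act x w') \<and>
    (\<forall>x c. \<forall>w\<in>W. act x (c \<odot> w) = c \<odot> act x w) \<and>
    (\<forall>x y. \<forall>w\<in>W. act (x + y) w = act x w + act y w) \<and>
    (\<forall>c x. \<forall>w\<in>W. act (c \<odot> x) w = c \<odot> act x w) \<and>
    (\<forall>w\<in>W. act 1 w = w) \<and>
    (\<forall>x y. \<forall>w\<in>W. act (x * y) w = act x (act y w))"

definition restricted_yangian_module ::
    "'w::hmodule set \<Rightarrow> ('n::{finite,linorder} yangian \<Rightarrow> 'w \<Rightarrow> 'w) \<Rightarrow> bool"
  where "restricted_yangian_module W act \<longleftrightarrow> yangian_module W act \<and> topologically_free W \<and>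
    (\<forall>i j. \<forall>w\<in>W. laurent_h W (\<lambda>s. act (tau i j s) w))"

definition yangian_submodule ::
    "'w::hmodule set \<Rightarrow> 'w set \<Rightarrow> ('n::{finite,linorder} yangian \<Rightarrow> 'w \<Rightarrow> 'w) \<Rightarrow> bool"
  where "yangian_submodule U W act \<longleftrightarrow> U \<subseteq> W \<and> hmod.subspace U \<and> (\<forall>x. act x ` U \<subseteq> U)"

end

theory Submission
  imports Defs
begin

text \<open>
  Put \<open>T(z) = Y\<^sub>W(L\<^sup>+(0)1, z)\<close>.  The algebra \<open>Y\<^sub>h\<close> is generated by the coefficients of \<open>\<tau>\<^sub>i\<^sub>j(z)\<close>, so a
  module structure with \<open>\<tau>\<^sub>i\<^sub>j(z)\<close> acting as \<open>T\<^sub>i\<^sub>j(z)\<close> is unique, it exists as soon as the operators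
  satisfy the defining relations, and a subspace that they preserve is a submodule
  (\<open>yangian_module_unique\<close>, \<open>yangian_module_exists\<close>, \<open>yangian_submodule_if_tau\<close>).  The theorem therefore
  comes down to the relation
  \<open>F := R(z\<^sub>1/z\<^sub>2) T\<^sub>1(z\<^sub>1) T\<^sub>2(z\<^sub>2) = T\<^sub>2(z\<^sub>2) T\<^sub>1(z\<^sub>1) R(z\<^sub>1/z\<^sub>2) =: G\<close>, where \<open>R\<close> is the polynomial matrix
  R-bar.

  The map \<open>\<sigma>(z)\<close> sends \<open>L\<^sup>+\<^sub>1(0) \<otimes> L\<^sup>+\<^sub>2(0)\<close> to its conjugate by the R-matrix, and the scalar factor \<open>g\<close>
  cancels in a conjugation (\<open>sigma_exchange\<close>).  Hence \<open>\<sigma>\<close>-locality says that \<open>F\<close> and \<open>G\<close> become equal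
  modulo \<open>h\<^sup>k\<close> after multiplication by some \<open>(z\<^sub>1 - z\<^sub>2)\<^sup>r\<close>.  The point is to cancel this power.
  Modulo \<open>h\<^sup>k\<close>, on a line \<open>p + q = s\<close> of exponents of \<open>z\<^sub>1\<^sup>p z\<^sub>2\<^sup>q\<close> the coefficients of \<open>F\<close> vanish for
  large \<open>p\<close> and those of \<open>G\<close> vanish for small \<open>p\<close>; a factor \<open>z\<^sub>1 - z\<^sub>2\<close> may be cancelled from a
  sequence that vanishes on one side (\<open>shift_diffs_cancel\<close>), so it suffices that \<open>F\<close> vanishes for small \<open>p\<close>
  as well.

  This is where weak associativity enters.  It says that \<open>(z\<^sub>1 - z\<^sub>2)\<^sup>r F\<close> is finite on each line, and that
  the substitution \<open>z\<^sub>1 = z\<^sub>2 e\<^sup>z\<close> turns it into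
  \<open>z\<^sub>2\<^sup>r (e\<^sup>z - 1)\<^sup>r R(e\<^sup>z) Y\<^sub>W(Y(L\<^sup>+(0)1, z) L\<^sup>+(0)1, z\<^sub>2)\<close>.  Here \<open>Y(L\<^sup>+(0)1, z) L\<^sup>+(0)1\<close> is the inverse of
  the R-matrix times \<open>L\<^sup>+\<^sub>1(z) L\<^sup>+\<^sub>2(0)1\<close>, a series without pole at \<open>z = 0\<close>, and R-bar times this inverse
  is the scalar \<open>g\<^sup>-\<^sup>1\<close>, up to a power of \<open>e\<^sup>h\<close>; since \<open>g\<^sup>-\<^sup>1\<close> has no pole either, the factor
  \<open>(e\<^sup>z - 1)\<^sup>r\<close> really divides the result (\<open>Rbar_L_regular\<close>).  A Laurent polynomial whose substitution
  \<open>x = e\<^sup>z\<close> is divisible by \<open>(e\<^sup>z - 1)\<^sup>r\<close> is divisible by \<open>(x - 1)\<^sup>r\<close>, hence \<open>F\<close> itself is finite on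
  each line (\<open>shift_diffs_finite\<close>, \<open>left_side_finite\<close>).

  To carry this out with scalars instead of elements of \<open>W\<close>, all identities are tested against the
  \<open>\<complex>[[h]]\<close>-linear functionals \<open>\<Lambda> : W \<rightarrow> \<complex>[[h]]\<close>.  They separate the points of a topologically free module
  (\<open>dual_separates\<close>), they turn \<open>h\<close>-adic sums into coefficientwise finite sums (\<open>hsums_dual\<close>), and they
  replace distributions by elements of \<open>\<complex>((x))[[h]]\<close>, in which R-matrices act by multiplication.
\<close>

section \<open>Functionals and h-adic sums on topologically free modules\<close>

text \<open>
  Linear functionals with values in \<open>\<complex>[[h]]\<close> on the module \<open>W\<close>; values outside the carrier are arbitrary.
\<close>

definition dual_on :: "'w::hmodule set \<Rightarrow> ('w \<Rightarrow> complex fps) \<Rightarrow> bool"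
  where "dual_on W \<Lambda> \<longleftrightarrow> (\<forall>x\<in>W. \<forall>y\<in>W. \<Lambda> (x + y) = \<Lambda> x + \<Lambda> y) \<and> (\<forall>c. \<forall>x\<in>W. \<Lambda> (c \<odot> x) = c * \<Lambda> x)"

lemma exists_complex_functional:
  fixes v :: "'w::hmodule"
  assumes "v \<noteq> 0"
  obtains l :: "'w \<Rightarrow> complex" where "\<And>x y. l (x + y) = l x + l y"
    "\<And>c x. l (fps_const c \<odot> x) = c * l x" "l v \<noteq> 0"
proof -
  interpret vs: vector_space "\<lambda>(c::complex) (x::'w). fps_const c \<odot> x"
    by standard (simp_all add: hscale_right_distrib hscale_left_distrib[symmetric] hscale_hscale
        hscale_one flip: fps_const_add fps_const_mult)
  interpret vector_space_pair "\<lambda>(c::complex) (x::'w). fps_const c \<odot> x" "(*) :: complex \<Rightarrow> _"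
    by standard (simp_all add: algebra_simps)
  have "vs.independent {v}"
    using assms by simp
  from linear_independent_extend[OF this, of "\<lambda>_. 1"] obtain l
    where l: "Vector_Spaces.linear (\<lambda>(c::complex) (x::'w). fps_const c \<odot> x) (*) l" "l v = 1" by auto
  show ?thesis
    by (rule that[of l]) (use l in \<open>simp_all add: linear_add linear_scale\<close>)
qed

lemma dual_on_add: "dual_on W \<Lambda> \<Longrightarrow> x \<in> W \<Longrightarrow> y \<in> W \<Longrightarrow> \<Lambda> (x + y) = \<Lambda> x + \<Lambda> y"
  and dual_on_scale: "dual_on W \<Lambda> \<Longrightarrow> x \<in> W \<Longrightarrow> \<Lambda> (c \<odot> x) = c * \<Lambda> x"
  by (auto simp: dual_on_def)

lemma dual_on_0:
  assumes "dual_on W \<Lambda>" "hmod.subspace W"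
  shows "\<Lambda> 0 = 0"
  using dual_on_scale[OF assms(1) hmod.subspace_0[OF assms(2)], of 0] by simp

lemma dual_on_diff:
  assumes "dual_on W \<Lambda>" "hmod.subspace W" "x \<in> W" "y \<in> W"
  shows "\<Lambda> (x - y) = \<Lambda> x - \<Lambda> y"
  using dual_on_add[OF assms(1) hmod.subspace_diff[OF assms(2-4)] assms(4)] by simp

lemma dual_on_sum:
  assumes "dual_on W \<Lambda>" "hmod.subspace W" "\<And>i. i \<in> A \<Longrightarrow> f i \<in> W"
  shows "\<Lambda> (sum f A) = (\<Sum>i\<in>A. \<Lambda> (f i))"
  using assms(3)
proof (induction A rule: infinite_finite_induct)
  case (insert x F)
  then show ?case
    by (simp add: dual_on_add[OF assms(1)] hmod.subspace_sum[OF assms(2)])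
qed (simp_all add: dual_on_0[OF assms(1,2)])

lemma subspace_hpow:
  assumes "hmod.subspace W"
  shows "hmod.subspace (hpow k W)"
proof (rule hmod.subspaceI)
  show "0 \<in> hpow k W"
    unfolding hpow_def using hmod.subspace_0[OF assms] by (intro image_eqI[of _ _ 0]) auto
next
  fix x y assume "x \<in> hpow k W" "y \<in> hpow k W"
  then obtain a b where "a \<in> W" "b \<in> W" "x = fps_X ^ k \<odot> a" "y = fps_X ^ k \<odot> b"
    by (auto simp: hpow_def)
  then show "x + y \<in> hpow k W"
    unfolding hpow_def using hmod.subspace_add[OF assms]
    by (intro image_eqI[of _ _ "a + b"]) (auto simp: hscale_right_distrib)
next
  fix c x assume "x \<in> hpow k W"
  then obtain a where "a \<in> W" "x = fps_X ^ k \<odot> a"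
    by (auto simp: hpow_def)
  then show "c \<odot> x \<in> hpow k W"
    unfolding hpow_def using hmod.subspace_scale[OF assms]
    by (intro image_eqI[of _ _ "c \<odot> a"]) (auto simp: hscale_hscale mult.commute)
qed

lemma dual_on_hpow:
  assumes "dual_on W \<Lambda>" "x \<in> hpow k W" "n < k"
  shows "fps_nth (\<Lambda> x) n = 0"
proof -
  obtain y where "y \<in> W" "x = fps_X ^ k \<odot> y"
    using assms(2) by (auto simp: hpow_def)
  then show ?thesis
    using assms(1,3) by (simp add: dual_on_scale fps_X_power_mult_nth)
qed

text \<open>
  A functional maps \<open>h\<^sup>k W\<close> into the multiples of \<open>h\<^sup>k\<close>, so only finitely many terms of an \<open>h\<close>-adically convergent
  sum contribute to a fixed power of \<open>h\<close>.  The set \<open>S\<close> may be any finite set that contains the contributing indices.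
\<close>

lemma hsums_dual:
  assumes W: "hmod.subspace W" and \<Lambda>: "dual_on W \<Lambda>" and f: "hsums W f x"
    and S: "finite S" "\<And>i. i \<notin> S \<Longrightarrow> fps_nth (\<Lambda> (f i)) n = 0"
  shows "fps_nth (\<Lambda> x) n = (\<Sum>i\<in>S. fps_nth (\<Lambda> (f i)) n)"
proof -
  let ?T = "{i. f i \<notin> hpow (Suc n) W}"
  have x: "x \<in> W" "\<And>i. f i \<in> W" "finite ?T" "x - trunc_sum (Suc n) W f \<in> hpow (Suc n) W"
    using f by (auto simp: hsums_def)
  have t: "trunc_sum (Suc n) W f \<in> W"
    unfolding trunc_sum_def by (rule hmod.subspace_sum[OF W x(2)])
  have "fps_nth (\<Lambda> x) n = fps_nth (\<Lambda> (trunc_sum (Suc n) W f)) n"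
    using dual_on_hpow[OF \<Lambda> x(4), of n] by (simp add: dual_on_diff[OF \<Lambda> W x(1) t])
  also have "\<dots> = (\<Sum>i\<in>?T. fps_nth (\<Lambda> (f i)) n)"
    unfolding trunc_sum_def by (simp add: dual_on_sum[OF \<Lambda> W x(2)] fps_sum_nth)
  also have "\<dots> = (\<Sum>i\<in>?T \<union> S. fps_nth (\<Lambda> (f i)) n)"
    using x(3) S(1) dual_on_hpow[OF \<Lambda>] by (intro sum.mono_neutral_left) auto
  also have "\<dots> = (\<Sum>i\<in>S. fps_nth (\<Lambda> (f i)) n)"
    using x(3) S by (intro sum.mono_neutral_right) auto
  finally show ?thesis .
qed

locale top_free =
  fixes W :: "'w::hmodule set"
  assumes subspace: "hmod.subspace W" and free: "topologically_free W"
begin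

text \<open>
  The inverse of an isomorphism \<open>V[[h]] \<cong> W\<close>: \<open>\<psi> x n\<close> is the coefficient of \<open>h\<^sup>n\<close> in \<open>x\<close>.
\<close>

lemma coordinates:
  obtains \<psi> :: "'w \<Rightarrow> nat \<Rightarrow> 'w" and V where
    "0 \<in> V" "\<And>x y. x \<in> V \<Longrightarrow> y \<in> V \<Longrightarrow> x + y \<in> V"
    "\<And>x n. x \<in> W \<Longrightarrow> \<psi> x n \<in> V"
    "\<And>x y. x \<in> W \<Longrightarrow> y \<in> W \<Longrightarrow> \<psi> x = \<psi> y \<Longrightarrow> x = y"
    "\<And>x y n. x \<in> W \<Longrightarrow> y \<in> W \<Longrightarrow> \<psi> (x + y) n = \<psi> x n + \<psi> y n"
    "\<And>x c n. x \<in> W \<Longrightarrow> \<psi> (c \<odot> x) n = (\<Sum>i\<le>n. fps_const (fps_nth c i) \<odot> \<psi> x (n - i))"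
    "\<And>f. (\<And>n. f n \<in> V) \<Longrightarrow> \<exists>x\<in>W. \<psi> x = f"
proof -
  obtain V and \<phi> :: "(nat \<Rightarrow> 'w) \<Rightarrow> 'w" where
    V: "0 \<in> V" "\<forall>x\<in>V. \<forall>y\<in>V. x + y \<in> V" "\<forall>c. \<forall>x\<in>V. fps_const c \<odot> x \<in> V" and
    bij: "bij_betw \<phi> {f. \<forall>n. f n \<in> V} W" and
    "\<forall>f g. (\<forall>n. f n \<in> V) \<and> (\<forall>n. g n \<in> V) \<longrightarrow> \<phi> (\<lambda>n. f n + g n) = \<phi> f + \<phi> g" and
    "\<forall>c f. (\<forall>n. f n \<in> V) \<longrightarrow>
          \<phi> (\<lambda>n. \<Sum>i\<le>n. fps_const (fps_nth c i) \<odot> f (n - i)) = c \<odot> \<phi> f"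
    using free unfolding topologically_free_def by (elim exE conjE) (rule that)
  then have add: "\<And>f g. (\<forall>n. f n \<in> V) \<Longrightarrow> (\<forall>n. g n \<in> V) \<Longrightarrow> \<phi> (\<lambda>n. f n + g n) = \<phi> f + \<phi> g" and
    scale: "\<And>c f. (\<forall>n. f n \<in> V) \<Longrightarrow>
          \<phi> (\<lambda>n. \<Sum>i\<le>n. fps_const (fps_nth c i) \<odot> f (n - i)) = c \<odot> \<phi> f"
    by simp_all
  define \<psi> where "\<psi> = inv_into {f. \<forall>n. f n \<in> V} \<phi>"
  have \<psi>V: "\<forall>n. \<psi> x n \<in> V" and \<phi>\<psi>: "\<phi> (\<psi> x) = x" if "x \<in> W" for x
  proof -
    have "x \<in> \<phi> ` {f. \<forall>n. f n \<in> V}" using bij that by (simp add: bij_betw_def)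
    from inv_into_into[OF this] f_inv_into_f[OF this]
    show "\<forall>n. \<psi> x n \<in> V" "\<phi> (\<psi> x) = x" by (auto simp: \<psi>_def)
  qed
  have \<psi>\<phi>: "\<psi> (\<phi> f) = f" if "\<forall>n. f n \<in> V" for f
    using bij that by (auto simp: \<psi>_def bij_betw_def intro!: inv_into_f_f)
  have \<phi>W: "\<phi> f \<in> W" if "\<forall>n. f n \<in> V" for f
    using bij that by (auto simp: bij_betw_def)
  have sumV: "sum g A \<in> V" if "\<And>i. i \<in> A \<Longrightarrow> g i \<in> V" for g :: "nat \<Rightarrow> 'w" and A
    using that
  proof (induction A rule: infinite_finite_induct)
    case (insert i A)
    then show ?case by (metis V(2) insertI1 insertI2 sum.insert)
  qed (simp_all add: V(1))
  have inj: "x = y" if "x \<in> W" "y \<in> W" "\<psi> x = \<psi> y" for x y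
    using \<phi>\<psi>[OF that(1)] \<phi>\<psi>[OF that(2)] that(3) by metis
  have \<psi>add: "\<psi> (x + y) n = \<psi> x n + \<psi> y n" if "x \<in> W" "y \<in> W" for x y n
  proof -
    have "\<phi> (\<lambda>n. \<psi> x n + \<psi> y n) = x + y"
      using add[OF \<psi>V[OF that(1)] \<psi>V[OF that(2)]] that by (simp add: \<phi>\<psi>)
    moreover have "\<psi> (\<phi> (\<lambda>n. \<psi> x n + \<psi> y n)) = (\<lambda>n. \<psi> x n + \<psi> y n)"
      using \<psi>V[OF that(1)] \<psi>V[OF that(2)] V(2) by (intro \<psi>\<phi>) auto
    ultimately show ?thesis by simp
  qed
  have \<psi>scale: "\<psi> (c \<odot> x) n = (\<Sum>i\<le>n. fps_const (fps_nth c i) \<odot> \<psi> x (n - i))" if "x \<in> W" for x c n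
  proof -
    let ?g = "\<lambda>n. \<Sum>i\<le>n. fps_const (fps_nth c i) \<odot> \<psi> x (n - i)"
    have "\<phi> ?g = c \<odot> x"
      using scale[OF \<psi>V[OF that]] that by (simp add: \<phi>\<psi>)
    moreover have "\<psi> (\<phi> ?g) = ?g"
      using \<psi>V[OF that] V(3) by (intro \<psi>\<phi> allI sumV) auto
    ultimately have "\<psi> (c \<odot> x) = ?g" by simp
    then show ?thesis by simp
  qed
  have surj: "\<exists>x\<in>W. \<psi> x = f" if "\<And>n. f n \<in> V" for f
    using \<phi>W[of f] \<psi>\<phi>[of f] that by blast
  show ?thesis
    using that[OF V(1) V(2)[rule_format] \<psi>V[rule_format] inj \<psi>add \<psi>scale surj] .
qed

text \<open>
  Apply a complex functional that does not vanish on some coefficient of \<open>x\<close> to all coefficients of the elements of \<open>W\<close>.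
\<close>

lemma dual_separates:
  assumes "x \<in> W" "\<And>\<Lambda>. dual_on W \<Lambda> \<Longrightarrow> \<Lambda> x = 0"
  shows "x = 0"
proof (rule ccontr)
  assume "x \<noteq> 0"
  obtain \<psi> :: "'w \<Rightarrow> nat \<Rightarrow> 'w" where \<psi>: "\<And>x y. x \<in> W \<Longrightarrow> y \<in> W \<Longrightarrow> \<psi> x = \<psi> y \<Longrightarrow> x = y"
    "\<And>x y n. x \<in> W \<Longrightarrow> y \<in> W \<Longrightarrow> \<psi> (x + y) n = \<psi> x n + \<psi> y n"
    "\<And>x c n. x \<in> W \<Longrightarrow> \<psi> (c \<odot> x) n = (\<Sum>i\<le>n. fps_const (fps_nth c i) \<odot> \<psi> x (n - i))"
    by (rule coordinates) blast
  have z: "0 \<in> W" by (rule hmod.subspace_0[OF subspace])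
  have "\<psi> 0 = (\<lambda>_. 0)"
    using \<psi>(2)[OF z z] by auto
  then obtain n where n: "\<psi> x n \<noteq> 0"
    using \<psi>(1)[OF assms(1) z] \<open>x \<noteq> 0\<close> by auto
  obtain l :: "'w \<Rightarrow> complex" where l: "\<And>x y. l (x + y) = l x + l y"
    "\<And>c x. l (fps_const c \<odot> x) = c * l x" "l (\<psi> x n) \<noteq> 0"
    using exists_complex_functional[OF n] by metis
  have l0: "l 0 = 0" using l(1)[of 0 0] by simp
  have lsum: "l (sum g A) = (\<Sum>i\<in>A. l (g i))" for g :: "nat \<Rightarrow> 'w" and A
    by (induction A rule: infinite_finite_induct) (auto simp: l l0)
  define \<Lambda> where "\<Lambda> x = Abs_fps (\<lambda>n. l (\<psi> x n))" for x
  have "dual_on W \<Lambda>"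
    unfolding dual_on_def
    by (auto intro!: fps_ext simp: \<Lambda>_def \<psi>(2,3) l(1,2) lsum fps_mult_nth atLeast0AtMost)
  then have "\<Lambda> x = 0" by (rule assms(2))
  then have "fps_nth (\<Lambda> x) n = 0" by simp
  then show False using l(3) by (simp add: \<Lambda>_def)
qed

lemma hsums_unique:
  assumes "hsums W f x" "hsums W f y"
  shows "x = y"
proof -
  have xy: "x \<in> W" "y \<in> W" using assms by (auto simp: hsums_def)
  have "x - y = 0"
  proof (rule dual_separates)
    show "x - y \<in> W" by (rule hmod.subspace_diff[OF subspace xy])
    fix \<Lambda> assume \<Lambda>: "dual_on W \<Lambda>"
    have "fps_nth (\<Lambda> (x - y)) n = 0" for n
    proof -
      have "x - y = (x - trunc_sum (Suc n) W f) - (y - trunc_sum (Suc n) W f)" by simp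
      also have "\<dots> \<in> hpow (Suc n) W"
        by (rule hmod.subspace_diff[OF subspace_hpow[OF subspace]]) (use assms in \<open>simp_all add: hsums_def\<close>)
      finally show ?thesis using dual_on_hpow[OF \<Lambda>] by blast
    qed
    then show "\<Lambda> (x - y) = 0" by (intro fps_ext) simp
  qed
  then show ?thesis by simp
qed

lemma hsum_eqI: "hsums W f x \<Longrightarrow> hsum W f = x"
  unfolding hsum_def using hsums_unique by blast

text \<open>
  Completeness: the coefficient of \<open>h\<^sup>n\<close> of the sum is the sum of the finitely many nonzero coefficients of \<open>h\<^sup>n\<close>.
\<close>

lemma hsums_hsum:
  assumes f: "\<And>i. f i \<in> W" and fin: "\<And>k. finite {i. f i \<notin> hpow k W}"
  shows "hsums W f (hsum W f)"
proof -
  obtain \<psi> :: "'w \<Rightarrow> nat \<Rightarrow> 'w" and V where V: "0 \<in> V" "\<And>x y. x \<in> V \<Longrightarrow> y \<in> V \<Longrightarrow> x + y \<in> V"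
    and \<psi>: "\<And>x n. x \<in> W \<Longrightarrow> \<psi> x n \<in> V" "\<And>x y. x \<in> W \<Longrightarrow> y \<in> W \<Longrightarrow> \<psi> x = \<psi> y \<Longrightarrow> x = y"
    "\<And>x y n. x \<in> W \<Longrightarrow> y \<in> W \<Longrightarrow> \<psi> (x + y) n = \<psi> x n + \<psi> y n"
    "\<And>x c n. x \<in> W \<Longrightarrow> \<psi> (c \<odot> x) n = (\<Sum>i\<le>n. fps_const (fps_nth c i) \<odot> \<psi> x (n - i))"
    "\<And>f. (\<And>n. f n \<in> V) \<Longrightarrow> \<exists>x\<in>W. \<psi> x = f"
    by (rule coordinates) blast
  note S = subspace
  have z: "0 \<in> W" by (rule hmod.subspace_0[OF subspace])
  have \<psi>0: "\<psi> 0 n = 0" for n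
    using \<psi>(3)[OF z z] by auto
  have \<psi>sum: "\<psi> (sum g A) n = (\<Sum>i\<in>A. \<psi> (g i) n)" if "\<And>i. g i \<in> W" for g :: "'a \<Rightarrow> 'w" and A n
    by (induction A rule: infinite_finite_induct) (auto simp: \<psi>0 \<psi>(3) that hmod.subspace_sum[OF S])
  have \<psi>diff: "\<psi> (x - y) n = \<psi> x n - \<psi> y n" if "x \<in> W" "y \<in> W" for x y n
    using \<psi>(3)[OF hmod.subspace_diff[OF S that] that(2), of n] by simp
  have \<psi>pow: "\<psi> (fps_X ^ k \<odot> x) n = (if n < k then 0 else \<psi> x (n - k))" if "x \<in> W" for x k n
  proof -
    have "\<psi> (fps_X ^ k \<odot> x) n = (\<Sum>i\<le>n. if i = k then \<psi> x (n - i) else 0)"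
      unfolding \<psi>(4)[OF that] by (rule sum.cong) (auto simp: fps_X_power_nth hscale_one)
    then show ?thesis by (simp add: sum.delta)
  qed
  have hpow_iff: "x \<in> hpow k W \<longleftrightarrow> (\<forall>n<k. \<psi> x n = 0)" if x: "x \<in> W" for x k
  proof
    assume *: "\<forall>n<k. \<psi> x n = 0"
    obtain y where y: "y \<in> W" "\<psi> y = (\<lambda>n. \<psi> x (n + k))"
      using \<psi>(5)[of "\<lambda>n. \<psi> x (n + k)"] \<psi>(1)[OF x] by auto
    have "\<psi> (fps_X ^ k \<odot> y) = \<psi> x"
      using * by (auto simp: \<psi>pow[OF y(1)] y(2))
    then have "fps_X ^ k \<odot> y = x"
      using \<psi>(2)[OF hmod.subspace_scale[OF S y(1)] x] by simp
    then show "x \<in> hpow k W" using y(1) by (auto simp: hpow_def)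
  qed (auto simp: hpow_def \<psi>pow)
  define T where "T n = {i. f i \<notin> hpow (Suc n) W}" for n
  have "sum (\<lambda>i. \<psi> (f i) n) A \<in> V" for A n
    by (induction A rule: infinite_finite_induct) (auto simp: V \<psi>(1) f)
  then obtain x where x: "x \<in> W" "\<psi> x = (\<lambda>n. \<Sum>i\<in>T n. \<psi> (f i) n)"
    using \<psi>(5)[of "\<lambda>n. \<Sum>i\<in>T n. \<psi> (f i) n"] by auto
  have "hsums W f x"
    unfolding hsums_def
  proof (intro conjI allI)
    fix k
    let ?t = "trunc_sum k W f"
    have t: "?t \<in> W" unfolding trunc_sum_def by (rule hmod.subspace_sum[OF S f])
    show "x - ?t \<in> hpow k W"
      unfolding hpow_iff[OF hmod.subspace_diff[OF S x(1) t]]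
    proof (intro allI impI)
      fix n assume "n < k"
      have "\<psi> ?t n = (\<Sum>i | f i \<notin> hpow k W. \<psi> (f i) n)"
        unfolding trunc_sum_def by (rule \<psi>sum[OF f])
      also have "\<dots> = (\<Sum>i\<in>T n. \<psi> (f i) n)"
        using fin less_le_trans[OF _ Suc_leI[OF \<open>n < k\<close>]]
        by (intro sum.mono_neutral_right) (auto simp: T_def hpow_iff[OF f])
      finally show "\<psi> (x - ?t) n = 0"
        by (simp add: \<psi>diff[OF x(1) t] x(2))
    qed
  qed (use x f fin in auto)
  then show ?thesis using hsum_eqI by metis
qed

end

section \<open>Expansion of rational functions and evaluation of tensors\<close>

definition poly_inv :: "complex poly \<Rightarrow> complex fls"
  where "poly_inv p = poly (map_poly fls_const p) fls_X_inv"

lemma poly_inv_0 [simp]: "poly_inv 0 = 0"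
  by (simp add: poly_inv_def)

lemma poly_inv_pCons [simp]: "poly_inv (pCons a p) = fls_const a + fls_X_inv * poly_inv p"
  by (simp add: poly_inv_def map_poly_pCons)

lemma poly_inv_add [simp]: "poly_inv (p + q) = poly_inv p + poly_inv q"
  by (induction p q rule: poly_induct2) (simp_all add: algebra_simps flip: fls_plus_const)

lemma poly_inv_smult [simp]: "poly_inv (smult a p) = fls_const a * poly_inv p"
  by (induction p) (simp_all add: algebra_simps flip: fls_const_mult_const)

lemma poly_inv_mult [simp]: "poly_inv (p * q) = poly_inv p * poly_inv q"
  by (induction p) (simp_all add: algebra_simps)

text \<open>
  The substitution of \<open>1/y\<close> loses no information, so it extends from polynomials to a homomorphism on their fraction field.
\<close>

lemma poly_inv_nth: "fls_nth (poly_inv p) (- int n) = coeff p n"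
proof (induction p arbitrary: n)
  case (pCons a p)
  have "\<forall>m>0. fls_nth (poly_inv p) m = 0"
    by (induction p) (auto simp: fls_X_inv_times_conv_shift)
  then have "fls_nth (poly_inv p) 1 = 0" by simp
  with pCons.IH[of "n - 1"] show ?case
    by (cases n) (simp_all add: fls_X_inv_times_conv_shift)
qed simp

lemma poly_inv_eq_0_iff [simp]: "poly_inv p = 0 \<longleftrightarrow> p = 0"
  using poly_inv_nth[of p] by (metis coeff_0 fls_zero_nth poly_eqI poly_inv_0)

text \<open>
  The description of \<^const>\<open>expand_inv\<close> by some representation as a fraction does not depend on the representation.
\<close>

lemma expand_inv_Fract:
  assumes "q \<noteq> 0"
  shows "expand_inv (Fract p q) = poly_inv p / poly_inv q"
  unfolding expand_inv_def poly_inv_def[symmetric]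
proof (rule the_equality)
  fix L
  assume "\<exists>p' q'. q' \<noteq> 0 \<and> Fract p q = Fract p' q' \<and> L = poly_inv p' / poly_inv q'"
  then obtain p' q' where *: "q' \<noteq> 0" "Fract p q = Fract p' q'" "L = poly_inv p' / poly_inv q'"
    by blast
  have "p * q' = p' * q" using * assms by (simp add: eq_fract)
  then have "poly_inv p * poly_inv q' = poly_inv p' * poly_inv q"
    by (metis poly_inv_mult)
  then show "L = poly_inv p / poly_inv q"
    using *(1,3) assms by (simp add: frac_eq_eq)
qed (use assms in blast)

lemma expand_inv_add: "expand_inv (f + g) = expand_inv f + expand_inv g"
proof -
  obtain p q where f: "f = Fract p q" "q \<noteq> 0" by (cases f) auto
  obtain p' q' where g: "g = Fract p' q'" "q' \<noteq> 0" by (cases g) auto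
  show ?thesis using f g by (simp add: add_fract expand_inv_Fract field_simps)
qed

lemma expand_inv_mult: "expand_inv (f * g) = expand_inv f * expand_inv g"
proof -
  obtain p q where f: "f = Fract p q" "q \<noteq> 0" by (cases f) auto
  obtain p' q' where g: "g = Fract p' q'" "q' \<noteq> 0" by (cases g) auto
  show ?thesis using f g by (simp add: mult_fract expand_inv_Fract field_simps)
qed

lemma expand_inv_to_fract: "expand_inv (to_fract p) = poly_inv p"
  by (simp add: to_fract_def expand_inv_Fract one_pCons del: pCons_one)

lemma expand_inv_0 [simp]: "expand_inv 0 = 0"
  using expand_inv_to_fract[of 0] by simp

lemma expand_inv_1 [simp]: "expand_inv 1 = 1"
proof -
  have "poly_inv 1 = 1" by (simp add: one_pCons del: pCons_one)
  then show ?thesis using expand_inv_to_fract[of 1] by simp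
qed

lemma expand_inv_sum: "expand_inv (sum f A) = (\<Sum>i\<in>A. expand_inv (f i))"
  by (induction A rule: infinite_finite_induct) (simp_all add: expand_inv_add)

definition fps_expand :: "ratfun fps \<Rightarrow> complex fls fps"
  where "fps_expand c = Abs_fps (\<lambda>n. expand_inv (fps_nth c n))"

lemma fps_expand_nth [simp]: "fps_nth (fps_expand c) n = expand_inv (fps_nth c n)"
  by (simp add: fps_expand_def)

lemma fps_expand_mult: "fps_expand (c * d) = fps_expand c * fps_expand d"
  by (rule fps_ext) (simp add: fps_mult_nth expand_inv_sum expand_inv_mult)

lemma fps_expand_add: "fps_expand (c + d) = fps_expand c + fps_expand d"
  by (rule fps_ext) (simp add: expand_inv_add)

definition fls_scalar :: "complex fps \<Rightarrow> complex fls fps"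
  where "fls_scalar c = Abs_fps (\<lambda>n. fls_const (fps_nth c n))"

lemma fls_scalar_nth [simp]: "fps_nth (fls_scalar c) n = fls_const (fps_nth c n)"
  by (simp add: fls_scalar_def)

lemma fps_expand_scalar: "fps_expand (ratfun_scalar c) = fls_scalar c"
  by (rule fps_ext) (simp add: ratfun_scalar_def expand_inv_to_fract)

definition lin_expand :: "('p \<Rightarrow> complex fls) \<Rightarrow> ('p \<Rightarrow>\<^sub>0 ratfun) \<Rightarrow> complex fls"
  where "lin_expand g x = (\<Sum>u\<in>Poly_Mapping.keys x. expand_inv (Poly_Mapping.lookup x u) * g u)"

lemma lin_expand_superset:
  assumes "finite A" "Poly_Mapping.keys x \<subseteq> A"
  shows "lin_expand g x = (\<Sum>u\<in>A. expand_inv (Poly_Mapping.lookup x u) * g u)"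
  unfolding lin_expand_def
  by (rule sum.mono_neutral_left) (use assms in \<open>auto simp: in_keys_iff\<close>)

lemma lin_expand_add: "lin_expand g (x + y) = lin_expand g x + lin_expand g y"
proof -
  let ?A = "Poly_Mapping.keys x \<union> Poly_Mapping.keys y"
  have "lin_expand g z = (\<Sum>u\<in>?A. expand_inv (Poly_Mapping.lookup z u) * g u)"
    if "z = x \<or> z = y \<or> z = x + y" for z
    using that by (intro lin_expand_superset) (auto simp: in_keys_iff lookup_add)
  then show ?thesis
    by (simp add: lookup_add expand_inv_add sum.distrib distrib_right)
qed

lemma lin_expand_0 [simp]: "lin_expand g 0 = 0"
  by (simp add: lin_expand_def)

lemma lin_expand_sum: "lin_expand g (sum x A) = (\<Sum>i\<in>A. lin_expand g (x i))"
  by (induction A rule: infinite_finite_induct) (simp_all add: lin_expand_add)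

lemma lin_expand_scale: "lin_expand g (Poly_Mapping.map ((*) c) x) = expand_inv c * lin_expand g x"
proof -
  have "lin_expand g (Poly_Mapping.map ((*) c) x) =
      (\<Sum>u\<in>Poly_Mapping.keys x. expand_inv (Poly_Mapping.lookup (Poly_Mapping.map ((*) c) x) u) * g u)"
    by (rule lin_expand_superset) (auto simp: in_keys_iff map.rep_eq)
  also have "\<dots> = (\<Sum>u\<in>Poly_Mapping.keys x. expand_inv c * (expand_inv (Poly_Mapping.lookup x u) * g u))"
    by (rule sum.cong) (auto simp: map.rep_eq in_keys_iff expand_inv_mult mult.assoc)
  finally show ?thesis by (simp add: lin_expand_def sum_distrib_left)
qed

lemma lin_expand_single [simp]: "lin_expand g (Poly_Mapping.single u c) = expand_inv c * g u"
  by (subst lin_expand_superset[of "{u}"]) (auto simp: lookup_single)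

text \<open>
  A tensor \<open>\<Sum> h\<^sup>k f(z) (u \<otimes> v)\<close> is sent to \<open>\<Sum> h\<^sup>k f(1/y) b(u, v)\<close>.  For \<open>b\<close> the series of matrix coefficients of
  \<open>Y\<^sub>W(u,z\<^sub>1) Y\<^sub>W(v,z\<^sub>2)\<close> in \<open>y = z\<^sub>2/z\<^sub>1\<close>, this is what \<^const>\<open>eval_VVz\<close> computes from a representative.
\<close>

definition vv_eval :: "('n VR \<times> 'n VR \<Rightarrow> complex fls fps) \<Rightarrow> 'n::{finite,linorder} vvfree \<Rightarrow> complex fls fps"
  where "vv_eval b x = Abs_fps (\<lambda>N. \<Sum>k=0..N. lin_expand (\<lambda>u. fps_nth (b u) (N - k)) (fps_nth x k))"

lemma vv_eval_add: "vv_eval b (x + y) = vv_eval b x + vv_eval b y"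
  by (rule fps_ext) (simp add: vv_eval_def lin_expand_add sum.distrib)

lemma vv_eval_diff: "vv_eval b (x - y) = vv_eval b x - vv_eval b y"
  using vv_eval_add[of b "x - y" y] by simp

text \<open>
  Linearity over all of \<open>\<complex>(z)[[h]]\<close> holds because the expansion is multiplicative and the values lie in the ring \<open>\<complex>((y))[[h]]\<close>.
\<close>

lemma vv_eval_scale: "vv_eval b (vv_scale c x) = fps_expand c * vv_eval b x"
proof (rule fps_ext)
  fix N
  have "fps_nth (vv_eval b (vv_scale c x)) N =
      (\<Sum>k=0..N. \<Sum>i=0..k. expand_inv (fps_nth c i) * lin_expand (\<lambda>u. fps_nth (b u) (N - k)) (fps_nth x (k - i)))"
    by (simp add: vv_eval_def vv_scale_def lin_expand_sum lin_expand_scale atLeast0AtMost)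
  also have "\<dots> = (\<Sum>k=0..N. \<Sum>i=0..N - k.
      expand_inv (fps_nth c k) * lin_expand (\<lambda>u. fps_nth (b u) (N - k - i)) (fps_nth x i))"
    by (rule fps_mult_assoc_lemma)
  also have "\<dots> = fps_nth (fps_expand c * vv_eval b x) N"
    by (simp add: fps_mult_nth vv_eval_def sum_distrib_left)
  finally show "fps_nth (vv_eval b (vv_scale c x)) N = fps_nth (fps_expand c * vv_eval b x) N" .
qed

lemma vv_eval_gen: "vv_eval b (vv_gen u v) = b (u, v)"
proof (rule fps_ext)
  fix N
  have "fps_nth (vv_eval b (vv_gen u v)) N = (\<Sum>k=0..N. if k = 0 then fps_nth (b (u, v)) (N - k) else 0)"
    unfolding vv_eval_def vv_gen_def fps_nth_Abs_fps by (rule sum.cong) simp_all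
  then show "fps_nth (vv_eval b (vv_gen u v)) N = fps_nth (b (u, v)) N"
    by simp
qed

text \<open>
  Bilinearity over \<open>\<complex>[[h]]\<close> of the values on pairs; it is what makes the evaluation independent of representatives.
\<close>

definition bilinear_family :: "('n::{finite,linorder} VR \<times> 'n VR \<Rightarrow> complex fls fps) \<Rightarrow> bool"
  where "bilinear_family b \<longleftrightarrow>
    (\<forall>u u' v. b (u + u', v) = b (u, v) + b (u', v)) \<and> (\<forall>u v v'. b (u, v + v') = b (u, v) + b (u, v')) \<and>
    (\<forall>c u v. b (c \<odot> u, v) = fls_scalar c * b (u, v)) \<and> (\<forall>c u v. b (u, c \<odot> v) = fls_scalar c * b (u, v))"

text \<open>
  The kernel is closed and has a torsion-free quotient because \<open>\<complex>((y))[[h]]\<close> is \<open>h\<close>-adically separated and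
  torsion-free.  Hence it contains all relations between tensors.
\<close>

lemma vv_eval_kernel:
  assumes "bilinear_family b"
  shows "{x. vv_eval b x = 0} \<in> vv_submodules"
proof -
  have X: "fps_expand (fps_X ^ k) = fps_X ^ k" for k
    by (rule fps_ext) (simp add: fps_X_power_nth)
  have lim: "vv_eval b x = 0"
    if lim: "\<And>k. \<exists>y. vv_eval b y = 0 \<and> (\<exists>d. x - y = vv_scale (fps_X ^ k) d)" for x
  proof (rule fps_ext)
    fix N
    obtain y d where "vv_eval b y = 0" "x - y = vv_scale (fps_X ^ Suc N) d"
      using lim[of "Suc N"] by auto
    then have "vv_eval b x = fps_X ^ Suc N * vv_eval b d"
      by (metis X diff_zero vv_eval_diff vv_eval_scale)
    then show "fps_nth (vv_eval b x) N = fps_nth 0 N"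
      by (simp only: fps_X_power_mult_nth) simp
  qed
  have tf: "vv_eval b x = 0" if "vv_eval b (vv_scale fps_X x) = 0" for x
    using that X[of 1] by (simp add: vv_eval_scale)
  have zero: "vv_eval b 0 = 0"
    using vv_eval_diff[of b 0 0] by simp
  note b = assms[unfolded bilinear_family_def]
  show ?thesis
    unfolding vv_submodules_def mem_Collect_eq
  proof (intro conjI allI ballI impI)
    fix x assume "\<forall>k. \<exists>y\<in>{x. vv_eval b x = 0}. \<exists>d. x - y = vv_scale (fps_X ^ k) d"
    then show "vv_eval b x = 0" by (intro lim) blast
  qed (use b in \<open>simp_all only: mem_Collect_eq zero tf vv_eval_diff vv_eval_add vv_eval_scale
      vv_eval_gen fps_expand_scalar mult_zero_right diff_self\<close>)
qed

definition vvz_eval :: "('n VR \<times> 'n VR \<Rightarrow> complex fls fps) \<Rightarrow> 'n::{finite,linorder} VVz \<Rightarrow> complex fls fps"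
  where "vvz_eval b x = vv_eval b (rep_VVz x)"

lemma vv_eval_rel:
  assumes "bilinear_family b" "vv_rel x y"
  shows "vv_eval b x = vv_eval b y"
proof -
  have "x - y \<in> {x. vv_eval b x = 0}"
    using assms(2) vv_eval_kernel[OF assms(1)] unfolding vv_rel_def by blast
  then show ?thesis by (simp add: vv_eval_diff)
qed

lemma vvz_eval_abs: "bilinear_family b \<Longrightarrow> vvz_eval b (abs_VVz x) = vv_eval b x"
  unfolding vvz_eval_def
  by (rule vv_eval_rel) (auto intro: Quotient3_rep_abs[OF Quotient3_VVz] simp: vv_relI)

lemma vvz_eval_add: "bilinear_family b \<Longrightarrow> vvz_eval b (x + y) = vvz_eval b x + vvz_eval b y"
  by (induction x; induction y) (simp add: plus_VVz.abs_eq vvz_eval_abs vv_eval_add)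

lemma vvz_eval_scale: "bilinear_family b \<Longrightarrow> vvz_eval b (zscale c x) = fps_expand c * vvz_eval b x"
  by (induction x) (simp add: zscale.abs_eq vvz_eval_abs vv_eval_scale)

lemma vvz_eval_tensor: "bilinear_family b \<Longrightarrow> vvz_eval b (vtensor u v) = b (u, v)"
  by (simp add: vtensor.abs_eq vvz_eval_abs vv_eval_gen)

lemma vvz_eval_sum: "bilinear_family b \<Longrightarrow> vvz_eval b (sum x A) = (\<Sum>i\<in>A. vvz_eval b (x i))"
proof (induction A rule: infinite_finite_induct)
  case empty
  then show ?case using vvz_eval_add[of b 0 0] by simp
next
  case (infinite A)
  then show ?case using vvz_eval_add[of b 0 0] by simp
qed (simp add: vvz_eval_add)

section \<open>Difference operators on sequences\<close>

text \<open>
  A sequence \<open>f\<close> stands for the formal series \<open>\<Sum> f(p) x\<^sup>p\<close>, and \<^term>\<open>shift_diff f\<close> for its product with \<open>x - 1\<close>.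
  On a line \<open>p + q = s\<close> of exponents, this is multiplication by \<open>z\<^sub>1 - z\<^sub>2\<close>.
\<close>

definition shift_diff :: "(int \<Rightarrow> complex) \<Rightarrow> int \<Rightarrow> complex"
  where "shift_diff f p = f (p - 1) - f p"

abbreviation shift_diffs :: "nat \<Rightarrow> (int \<Rightarrow> complex) \<Rightarrow> int \<Rightarrow> complex"
  where "shift_diffs r \<equiv> shift_diff ^^ r"

lemma shift_diffs_eq:
  "shift_diffs r f p = (\<Sum>i\<le>r. (- 1) ^ i * of_nat (r choose i) * f (p - int (r - i)))"
proof (induction r arbitrary: p)
  case (Suc r)
  let ?g = "\<lambda>i. (- 1) ^ i * of_nat (r choose i) * f (p - int (Suc r - i))"
  have "shift_diffs (Suc r) f p = (\<Sum>i\<le>r. (- 1) ^ i * of_nat (r choose i) * f (p - 1 - int (r - i)))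
      - (\<Sum>i\<le>r. (- 1) ^ i * of_nat (r choose i) * f (p - int (r - i)))"
    by (simp add: shift_diff_def Suc)
  also have "(\<Sum>i\<le>r. (- 1) ^ i * of_nat (r choose i) * f (p - 1 - int (r - i))) = (\<Sum>i\<le>r. ?g i)"
    by (intro sum.cong arg_cong2[of _ _ _ _ "(*)"] arg_cong[of _ _ f]) (auto simp: of_nat_diff)
  also have "(\<Sum>i\<le>r. ?g i) = (\<Sum>i\<le>Suc r. ?g i)" by simp
  also have "\<dots> = f (p - int (Suc r)) + (\<Sum>i\<le>r. ?g (Suc i))"
    by (subst sum.atMost_Suc_shift) simp
  also have "f (p - int (Suc r)) + (\<Sum>i\<le>r. ?g (Suc i)) -
      (\<Sum>i\<le>r. (- 1) ^ i * of_nat (r choose i) * f (p - int (r - i))) =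
      f (p - int (Suc r)) +
      (\<Sum>i\<le>r. (- 1) ^ Suc i * of_nat (Suc r choose Suc i) * f (p - int (Suc r - Suc i)))"
    by (simp add: sum_subtractf[symmetric] algebra_simps sum.distrib[symmetric])
  also have "\<dots> = (\<Sum>i\<le>Suc r. (- 1) ^ i * of_nat (Suc r choose i) * f (p - int (Suc r - i)))"
    by (subst sum.atMost_Suc_shift) simp
  finally show ?case .
qed simp

lemma shift_diffs_sum:
  "shift_diffs r (\<lambda>p. \<Sum>i\<in>A. c i * f i p) p = (\<Sum>i\<in>A. c i * shift_diffs r (f i) p)"
  by (induction r arbitrary: p) (simp_all add: shift_diff_def sum_subtractf right_diff_distrib)

lemma shift_diffs_vanish_above:
  assumes "\<And>p. p > P \<Longrightarrow> f p = 0" "p > P + int r"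
  shows "shift_diffs r f p = 0"
  using assms(2) by (induction r arbitrary: p) (simp_all add: shift_diff_def assms(1))

lemma shift_diffs_mono_0:
  assumes "\<And>p. shift_diffs r f p = 0" "r \<le> r'"
  shows "shift_diffs r' f p = 0"
proof -
  obtain d where "r' = d + r" using assms(2) le_Suc_ex by (metis add.commute)
  moreover have "shift_diffs (d + r) f p = 0" for p
    by (induction d arbitrary: p) (simp_all add: assms(1) shift_diff_def)
  ultimately show ?thesis by simp
qed

text \<open>
  In the domain of series that are bounded below, \<open>x - 1\<close> is not a zero divisor.  Without the bound it
  annihilates \<open>\<Sum> x\<^sup>p\<close>.
\<close>

lemma shift_diffs_cancel:
  assumes "\<And>p. p < P \<Longrightarrow> f p = 0" "\<And>p. shift_diffs r f p = 0"
  shows "f p = 0"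
  using assms(2)
proof (induction r arbitrary: p)
  case (Suc r)
  let ?c = "shift_diffs r f"
  have low: "?c p = 0" if "p < P" for p
    using that by (induction r arbitrary: p) (simp_all add: shift_diff_def assms(1))
  have step: "?c (p - 1) = ?c p" for p
  proof -
    have "shift_diff ?c p = 0" using Suc.prems[of p] by simp
    then show ?thesis unfolding shift_diff_def by simp
  qed
  have "?c (P - 1 + int k) = 0" for k
  proof (induction k)
    case (Suc k)
    then show ?case using step[of "P - 1 + int (Suc k)"] by (simp add: algebra_simps)
  qed (simp add: low)
  note up = this
  have "?c p = 0" for p
    using low[of p] up[of "nat (p - (P - 1))"] by (cases "p < P") simp_all
  then show ?case by (rule Suc.IH)
qed simp

text \<open>
  The substitution \<open>x = e\<^sup>z\<close> in a Laurent polynomial; for sequences of infinite support the value is the default of sums.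
\<close>

definition exp_sum :: "(int \<Rightarrow> complex) \<Rightarrow> complex fps"
  where "exp_sum b = (\<Sum>p | b p \<noteq> 0. fps_const (b p) * fps_exp (of_int p))"

lemma exp_sum_superset:
  assumes "finite S" "\<And>p. p \<notin> S \<Longrightarrow> b p = 0"
  shows "exp_sum b = (\<Sum>p\<in>S. fps_const (b p) * fps_exp (of_int p))"
  unfolding exp_sum_def by (rule sum.mono_neutral_left) (use assms in auto)

lemma finite_shift_support:
  assumes "finite {p. b p \<noteq> (0::complex)}"
  shows "finite {p. b (p - m :: int) \<noteq> 0}"
proof -
  have "{p. b (p - m) \<noteq> 0} = (\<lambda>p. p + m) ` {p. b p \<noteq> 0}"
    by (auto intro: image_eqI[of _ _ "_ - m"])
  then show ?thesis using assms by simp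
qed

lemma exp_sum_shift:
  assumes "finite {p. b p \<noteq> 0}"
  shows "exp_sum (\<lambda>p. b (p - m)) = fps_exp (of_int m) * exp_sum b"
proof -
  have "exp_sum (\<lambda>p. b (p - m)) = (\<Sum>p\<in>(\<lambda>p. p + m) ` {p. b p \<noteq> 0}. fps_const (b (p - m)) * fps_exp (of_int p))"
    by (rule exp_sum_superset) (use assms in \<open>force simp: image_iff\<close>)+
  also have "\<dots> = (\<Sum>p | b p \<noteq> 0. fps_const (b p) * fps_exp (of_int (p + m)))"
    by (subst sum.reindex) (auto simp: inj_on_def)
  finally show ?thesis
    by (simp add: exp_sum_def fps_exp_add_mult sum_distrib_left algebra_simps)
qed

lemma exp_sum_diff:
  assumes "finite {p. b p \<noteq> 0}" "finite {p. c p \<noteq> 0}"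
  shows "exp_sum (\<lambda>p. b p - c p) = exp_sum b - exp_sum c"
proof -
  let ?S = "{p. b p \<noteq> 0} \<union> {p. c p \<noteq> 0}"
  have "exp_sum a = (\<Sum>p\<in>?S. fps_const (a p) * fps_exp (of_int p))"
    if "a = b \<or> a = c \<or> a = (\<lambda>p. b p - c p)" for a
    using that assms by (intro exp_sum_superset) auto
  then show ?thesis
    by (simp add: sum_subtractf[symmetric] algebra_simps flip: fps_const_sub)
qed

lemma exp_sum_lincomb:
  assumes "finite A" "\<And>i. i \<in> A \<Longrightarrow> finite {p. b i p \<noteq> 0}"
  shows "exp_sum (\<lambda>p. \<Sum>i\<in>A. c i * b i p) = (\<Sum>i\<in>A. fps_const (c i) * exp_sum (b i))"
proof -
  have const_sum: "fps_const (sum g A) = (\<Sum>i\<in>A. fps_const (g i))" for g :: "'a \<Rightarrow> complex"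
    by (rule fps_ext) (simp add: fps_sum_nth)
  let ?S = "\<Union>i\<in>A. {p. b i p \<noteq> 0}"
  have S: "finite ?S" using assms by blast
  have "exp_sum (\<lambda>p. \<Sum>i\<in>A. c i * b i p) = (\<Sum>p\<in>?S. fps_const (\<Sum>i\<in>A. c i * b i p) * fps_exp (of_int p))"
    using S by (intro exp_sum_superset) (auto intro!: sum.neutral)
  also have "\<dots> = (\<Sum>i\<in>A. \<Sum>p\<in>?S. fps_const (c i) * (fps_const (b i p) * fps_exp (of_int p)))"
    by (subst sum.swap) (simp add: const_sum sum_distrib_right mult.assoc flip: fps_const_mult)
  also have "\<dots> = (\<Sum>i\<in>A. fps_const (c i) * exp_sum (b i))"
    by (rule sum.cong) (use S exp_sum_superset[OF S] in \<open>auto simp: sum_distrib_left[symmetric]\<close>)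
  finally show ?thesis .
qed

lemma exp_sum_shift_diff:
  assumes "finite {p. b p \<noteq> 0}"
  shows "finite {p. shift_diff b p \<noteq> 0}" "exp_sum (shift_diff b) = (fps_exp 1 - 1) * exp_sum b"
proof -
  have fin: "finite {p. b (p - 1) \<noteq> 0}" by (rule finite_shift_support[OF assms])
  have "{p. shift_diff b p \<noteq> 0} \<subseteq> {p. b (p - 1) \<noteq> 0} \<union> {p. b p \<noteq> 0}"
    by (auto simp: shift_diff_def)
  then show "finite {p. shift_diff b p \<noteq> 0}"
    by (rule finite_subset) (use fin assms in blast)
  have "exp_sum (shift_diff b) = exp_sum (\<lambda>p. b (p - 1)) - exp_sum b"
    unfolding shift_diff_def by (rule exp_sum_diff[OF fin assms])
  then show "exp_sum (shift_diff b) = (fps_exp 1 - 1) * exp_sum b"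
    by (simp add: exp_sum_shift[OF assms, of 1] algebra_simps)
qed

text \<open>
  If \<open>(x - 1)\<^sup>r f\<close> is a Laurent polynomial whose value at \<open>x = e\<^sup>z\<close> is divisible by \<open>(e\<^sup>z - 1)\<^sup>r\<close>, then, for
  \<open>r > 0\<close>, its value at \<open>x = 1\<close> vanishes.  Since \<open>f\<close> vanishes for large arguments, \<open>c = (x - 1)\<^sup>r\<^sup>-\<^sup>1 f\<close> is obtained
  from \<open>(x - 1) c\<close> by summation from above, so below its support \<open>c\<close> is constant, with the total sum \<open>0\<close> as its value.
  Cancelling one factor \<open>e\<^sup>z - 1\<close> gives the same situation for \<open>r - 1\<close>.
\<close>

lemma shift_diffs_finite:
  assumes "\<And>p. p > P \<Longrightarrow> f p = 0" "finite {p. shift_diffs r f p \<noteq> 0}"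
    "exp_sum (shift_diffs r f) = (fps_exp 1 - 1) ^ r * R"
  shows "finite {p. f p \<noteq> 0}"
  using assms(2,3)
proof (induction r)
  case (Suc r)
  let ?c = "shift_diffs r f" and ?b = "shift_diffs (Suc r) f"
  define S where "S = {p. ?b p \<noteq> 0}"
  have fin: "finite S" using Suc.prems(1) by (simp add: S_def)
  have b: "?b p = ?c (p - 1) - ?c p" for p by (simp add: shift_diff_def)
  obtain N where N: "\<And>p. p \<in> S \<Longrightarrow> \<bar>p\<bar> < N"
    using Max_ge[of "abs ` S"] fin by (metis finite_imageI image_eqI zle_add1_eq_le)
  \<comment> \<open>Above \<open>Q\<close> the sequence \<open>?c\<close> vanishes, and the support of \<open>?b\<close> lies between \<open>- N\<close> and \<open>Q\<close>.\<close>
  define Q where "Q = max (P + int r) N"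
  have high: "?c p = 0" if "p > Q" for p
    using that assms(1) by (intro shift_diffs_vanish_above[of P]) (auto simp: Q_def)
  have telescope: "(\<Sum>p\<in>{Q + 1 - int k..Q + 1}. ?b p) = ?c (Q - int k)" for k
  proof (induction k)
    case (Suc k)
    have "{Q + 1 - int (Suc k)..Q + 1} = insert (Q - int k) {Q + 1 - int k..Q + 1}" by auto
    then show ?case using Suc by (simp add: b algebra_simps del: funpow.simps)
  qed (simp add: b high del: funpow.simps)
  then have sum: "?c p = (\<Sum>p\<in>{p + 1..Q + 1}. ?b p)" if "p \<le> Q" for p
    using telescope[of "nat (Q - p)"] that by (simp del: funpow.simps add: add.commute)
  have "fps_nth (exp_sum ?b) 0 = 0"
    unfolding Suc.prems(2) by simp
  then have "(\<Sum>p\<in>S. ?b p) = 0"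
    by (simp add: exp_sum_def fps_sum_nth S_def)
  then have Sum0: "(\<Sum>p\<in>S. ?b p) = 0" .
  have low: "?c p = 0" if "p < - N" "p \<le> Q" for p
  proof -
    have "S \<subseteq> {p + 1..Q + 1}" using that N by (force simp: Q_def)
    then have "(\<Sum>p\<in>{p + 1..Q + 1}. ?b p) = (\<Sum>p\<in>S. ?b p)"
      by (intro sum.mono_neutral_right) (auto simp: S_def)
    then show ?thesis using sum[OF that(2)] Sum0 by simp
  qed
  have "?c p = 0" if "p \<notin> {- N..Q}" for p
    using low[of p] high[of p] that by (cases "p > Q") auto
  then have "{p. ?c p \<noteq> 0} \<subseteq> {- N..Q}" by (metis (mono_tags) mem_Collect_eq subsetI)
  then have finc: "finite {p. ?c p \<noteq> 0}" by (rule finite_subset) simp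
  have "(fps_exp 1 - 1) * exp_sum ?c = (fps_exp 1 - 1) * ((fps_exp 1 - 1) ^ r * R)"
    using exp_sum_shift_diff(2)[OF finc] Suc.prems(2) by (simp add: mult.assoc)
  moreover have "fps_nth (fps_exp 1 - 1 :: complex fps) 1 \<noteq> fps_nth 0 1" by simp
  then have "fps_exp 1 - 1 \<noteq> (0 :: complex fps)" by metis
  ultimately show ?case using Suc.IH finc by simp
qed simp

section \<open>Unitarity and the inverse of the R-matrix\<close>

lemma mat_unit2_nth: "mat_unit2 i j k l $ a $ b = (if a = (i, k) \<and> b = (j, l) then 1 else 0)"
  by (simp add: mat_unit2_def)

lemma mscale_nth [simp]: "(c *m A) $ i $ j = c * A $ i $ j"
  by (simp add: mscale_def)

definition Rbar_entry ::
    "(complex \<Rightarrow> 'r::comm_ring_1) \<Rightarrow> 'r \<Rightarrow> 'r \<Rightarrow> 'n::linorder \<times> 'n \<Rightarrow> 'n \<times> 'n \<Rightarrow> 'r"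
  where "Rbar_entry E z\<^sub>1 z\<^sub>2 a b =
    (if b = a then (if fst a = snd a then z\<^sub>1 * E (- 1/2) - z\<^sub>2 * E (1/2) else z\<^sub>1 - z\<^sub>2)
     else if b = prod.swap a then (E (- 1/2) - E (1/2)) * (if snd a < fst a then z\<^sub>1 else z\<^sub>2) else 0)"

lemma Rbar2_nth: "Rbar2 E z\<^sub>1 z\<^sub>2 $ a $ b = Rbar_entry E z\<^sub>1 z\<^sub>2 a b"
proof -
  have 1: "(\<Sum>i\<in>UNIV. mat_unit2 i i i i) $ a $ b = (if b = a \<and> fst a = snd a then 1 else 0 :: 'a)"
  proof -
    have "(\<Sum>i\<in>UNIV. mat_unit2 i i i i) $ a $ b = (\<Sum>i\<in>UNIV. if i = fst a then (if b = a \<and> fst a = snd a then 1 else 0) else 0 :: 'a)"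
      unfolding sum_component by (rule sum.cong) (auto simp: mat_unit2_nth prod_eq_iff)
    then show ?thesis by simp
  qed
  have 2: "(\<Sum>(i, j)\<in>A. mat_unit2 i i j j) $ a $ b = (if b = a \<and> a \<in> A then 1 else 0 :: 'a)"
    for A :: "('b \<times> 'b) set"
  proof -
    have "(\<Sum>(i, j)\<in>A. mat_unit2 i i j j) $ a $ b = (\<Sum>p\<in>A. if p = a then (if b = a then 1 else 0) else 0 :: 'a)"
      unfolding sum_component by (rule sum.cong) (auto simp: mat_unit2_nth prod_eq_iff)
    then show ?thesis by (simp add: sum.delta)
  qed
  have 3: "(\<Sum>(i, j)\<in>A. mat_unit2 i j j i) $ a $ b = (if b = prod.swap a \<and> a \<in> A then 1 else 0 :: 'a)"
    for A :: "('b \<times> 'b) set"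
  proof -
    have "(\<Sum>(i, j)\<in>A. mat_unit2 i j j i) $ a $ b = (\<Sum>p\<in>A. if p = a then (if b = prod.swap a then 1 else 0) else 0 :: 'a)"
      unfolding sum_component by (rule sum.cong) (auto simp: mat_unit2_nth prod_eq_iff)
    then show ?thesis by (simp add: sum.delta)
  qed
  have "Rbar2 E z\<^sub>1 z\<^sub>2 $ a $ b =
      (z\<^sub>1 * E (- 1/2) - z\<^sub>2 * E (1/2)) * (if b = a \<and> fst a = snd a then 1 else 0)
    + (z\<^sub>1 - z\<^sub>2) * (if b = a \<and> fst a \<noteq> snd a then 1 else 0)
    + (E (- 1/2) - E (1/2)) * z\<^sub>1 * (if b = prod.swap a \<and> snd a < fst a then 1 else 0)
    + (E (- 1/2) - E (1/2)) * z\<^sub>2 * (if b = prod.swap a \<and> fst a < snd a then 1 else 0)"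
    unfolding Rbar2_def vector_add_component mscale_nth 1 2 3 by (simp add: split_def)
  moreover consider "b = a" | "b \<noteq> a" "b = prod.swap a" | "b \<noteq> a" "b \<noteq> prod.swap a" by blast
  moreover have "b = a \<longleftrightarrow> fst a = snd a" if "b = prod.swap a"
    using that by (auto simp: prod_eq_iff)
  ultimately show ?thesis
    by cases (auto simp: Rbar_entry_def dest: order.asym)
qed

text \<open>
  The entries of \<open>R\<^sub>2\<^sub>1(z\<^sub>2, z\<^sub>1)\<close> for the matrix R-bar.
\<close>

definition Rbar_inv_entry ::
    "(complex \<Rightarrow> 'r::comm_ring_1) \<Rightarrow> 'r \<Rightarrow> 'r \<Rightarrow> 'n::linorder \<times> 'n \<Rightarrow> 'n \<times> 'n \<Rightarrow> 'r"
  where "Rbar_inv_entry E z\<^sub>1 z\<^sub>2 a b =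
    (if b = a then (if fst a = snd a then z\<^sub>2 * E (- 1/2) - z\<^sub>1 * E (1/2) else z\<^sub>2 - z\<^sub>1)
     else if b = prod.swap a then (E (- 1/2) - E (1/2)) * (if snd a < fst a then z\<^sub>1 else z\<^sub>2) else 0)"

definition unitarity_factor :: "(complex \<Rightarrow> 'r::comm_ring_1) \<Rightarrow> 'r \<Rightarrow> 'r \<Rightarrow> 'r"
  where "unitarity_factor E z\<^sub>1 z\<^sub>2 =
    (z\<^sub>1 * E (- 1/2) - z\<^sub>2 * E (1/2)) * (z\<^sub>2 * E (- 1/2) - z\<^sub>1 * E (1/2))"

lemma sum_two_columns:
  fixes f :: "'n::finite \<times> 'n \<Rightarrow> 'r::comm_monoid_add"
  assumes "\<And>b. b \<noteq> a \<Longrightarrow> b \<noteq> prod.swap a \<Longrightarrow> f b = 0"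
  shows "(\<Sum>b\<in>UNIV. f b) = (if fst a = snd a then f a else f a + f (prod.swap a))"
proof -
  have "(\<Sum>b\<in>UNIV. f b) = (\<Sum>b\<in>{a, prod.swap a}. f b)"
    by (rule sum.mono_neutral_right) (use assms in auto)
  then show ?thesis by (cases a) auto
qed

text \<open>
  Both matrices preserve each span of \<open>e\<^sub>i \<otimes> e\<^sub>j\<close> and \<open>e\<^sub>j \<otimes> e\<^sub>i\<close>, so the claim is an identity for two by two blocks.  With
  \<open>q = e\<^sup>h\<^sup>/\<^sup>2\<close> the diagonal entry is \<open>- (z\<^sub>1 - z\<^sub>2)\<^sup>2 + (q\<^sup>-\<^sup>1 - q)\<^sup>2 z\<^sub>1 z\<^sub>2 = (z\<^sub>1 q\<^sup>-\<^sup>1 - z\<^sub>2 q) (z\<^sub>2 q\<^sup>-\<^sup>1 - z\<^sub>1 q)\<close>.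
\<close>

lemma unitarity:
  fixes E :: "complex \<Rightarrow> 'r::comm_ring_1" and a c :: "'n::{finite,linorder} \<times> 'n"
  assumes E: "E (1/2) * E (- 1/2) = 1"
  shows "(\<Sum>b\<in>UNIV. Rbar_entry E z\<^sub>1 z\<^sub>2 a b * Rbar_inv_entry E z\<^sub>1 z\<^sub>2 b c) =
      (if a = c then unitarity_factor E z\<^sub>1 z\<^sub>2 else 0)"
    and "(\<Sum>b\<in>UNIV. Rbar_inv_entry E z\<^sub>1 z\<^sub>2 a b * Rbar_entry E z\<^sub>1 z\<^sub>2 b c) =
      (if a = c then unitarity_factor E z\<^sub>1 z\<^sub>2 else 0)"
proof -
  define q q' where "q = E (1/2)" and "q' = E (- 1/2)"
  have qq: "q * q' = 1" using E by (simp add: q_def q'_def)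
  have key: "(z\<^sub>1 - z\<^sub>2) * (z\<^sub>2 - z\<^sub>1) + (q' - q) * z\<^sub>1 * ((q' - q) * z\<^sub>2) = (z\<^sub>1 * q' - z\<^sub>2 * q) * (z\<^sub>2 * q' - z\<^sub>1 * q)"
  proof -
    have "(z\<^sub>1 * q' - z\<^sub>2 * q) * (z\<^sub>2 * q' - z\<^sub>1 * q) =
        (z\<^sub>1 - z\<^sub>2) * (z\<^sub>2 - z\<^sub>1) + (q' - q) * z\<^sub>1 * ((q' - q) * z\<^sub>2)
        + (1 - q * q') * ((z\<^sub>1 - z\<^sub>2) * (z\<^sub>1 - z\<^sub>2))"
      by (simp add: algebra_simps)
    then show ?thesis by (simp add: qq)
  qed
  note key' = key[unfolded mult.commute[of "z\<^sub>1 - z\<^sub>2" "z\<^sub>2 - z\<^sub>1"]]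
  have comm: "(q' - q) * z\<^sub>2 * ((q' - q) * z\<^sub>1) = (q' - q) * z\<^sub>1 * ((q' - q) * z\<^sub>2)"
    by (simp add: mult_ac)
  have anti: "(z\<^sub>1 - z\<^sub>2) * ((q' - q) * x) + (q' - q) * x * (z\<^sub>2 - z\<^sub>1) = 0"
    "(z\<^sub>2 - z\<^sub>1) * ((q' - q) * x) + (q' - q) * x * (z\<^sub>1 - z\<^sub>2) = 0" for x
    by (simp_all add: algebra_simps)
  have sums: "(\<Sum>b\<in>UNIV. Rbar_entry E z\<^sub>1 z\<^sub>2 a b * f b) = (if fst a = snd a then Rbar_entry E z\<^sub>1 z\<^sub>2 a a * f a
      else Rbar_entry E z\<^sub>1 z\<^sub>2 a a * f a + Rbar_entry E z\<^sub>1 z\<^sub>2 a (prod.swap a) * f (prod.swap a))"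
    "(\<Sum>b\<in>UNIV. Rbar_inv_entry E z\<^sub>1 z\<^sub>2 a b * f b) = (if fst a = snd a then Rbar_inv_entry E z\<^sub>1 z\<^sub>2 a a * f a
      else Rbar_inv_entry E z\<^sub>1 z\<^sub>2 a a * f a + Rbar_inv_entry E z\<^sub>1 z\<^sub>2 a (prod.swap a) * f (prod.swap a))"
    for f :: "'n \<times> 'n \<Rightarrow> 'r"
    by (rule sum_two_columns, simp add: Rbar_entry_def Rbar_inv_entry_def)+
  obtain i j where a: "a = (i, j)" by (cases a)
  consider "i = j" "c = a" | "i = j" "c \<noteq> a" | "i \<noteq> j" "c = (i, j)" | "i \<noteq> j" "c = (j, i)"
    | "i \<noteq> j" "c \<noteq> (i, j)" "c \<noteq> (j, i)" by (auto simp: a)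
  note cases = this
  note defs = a Rbar_entry_def Rbar_inv_entry_def unitarity_factor_def q_def[symmetric] q'_def[symmetric]
  note simps = comm key key' anti mult.commute[of "z\<^sub>2 * q' - z\<^sub>1 * q" "z\<^sub>1 * q' - z\<^sub>2 * q"]
  show "(\<Sum>b\<in>UNIV. Rbar_entry E z\<^sub>1 z\<^sub>2 a b * Rbar_inv_entry E z\<^sub>1 z\<^sub>2 b c) =
      (if a = c then unitarity_factor E z\<^sub>1 z\<^sub>2 else 0)"
    unfolding sums unfolding defs by (cases rule: cases; cases i j rule: linorder_cases) (auto simp: simps a dest: order.asym)
  show "(\<Sum>b\<in>UNIV. Rbar_inv_entry E z\<^sub>1 z\<^sub>2 a b * Rbar_entry E z\<^sub>1 z\<^sub>2 b c) =
      (if a = c then unitarity_factor E z\<^sub>1 z\<^sub>2 else 0)"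
    unfolding sums unfolding defs by (cases rule: cases; cases i j rule: linorder_cases) (auto simp: simps a dest: order.asym)
qed

text \<open>
  Over a ring, \<^const>\<open>matrix_inv\<close> is an inverse as soon as there is one, and unitarity provides it when the unitarity factor is a unit.
\<close>

lemma matrix_inv_Rbar2:
  fixes E :: "complex \<Rightarrow> 'r::comm_ring_1" and a c :: "'n::{finite,linorder} \<times> 'n"
  assumes "E (1/2) * E (- 1/2) = 1" "g * g' = 1" "unitarity_factor E z\<^sub>1 z\<^sub>2 * d = 1"
  defines "R \<equiv> g *m Rbar2 E z\<^sub>1 z\<^sub>2"
  shows "(\<Sum>b\<in>UNIV. R $ a $ b * matrix_inv R $ b $ c) = (if a = c then 1 else 0)"
    "(\<Sum>b\<in>UNIV. matrix_inv R $ a $ b * R $ b $ c) = (if a = c then 1 else 0)"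
proof -
  \<comment> \<open>The normalized matrix of \<open>Rbar_inv_entry\<close> is a two-sided inverse.\<close>
  define B :: "'r^('n \<times> 'n)^('n \<times> 'n)" where "B = (\<chi> a b. g' * d * Rbar_inv_entry E z\<^sub>1 z\<^sub>2 a b)"
  have unit: "g * g' * (d * unitarity_factor E z\<^sub>1 z\<^sub>2) = 1"
    using assms(2,3) by (simp add: mult.commute)
  have "(R ** B) $ a $ c = mat 1 $ a $ c" for a c
  proof -
    have "(R ** B) $ a $ c =
        g * g' * d * (\<Sum>b\<in>UNIV. Rbar_entry E z\<^sub>1 z\<^sub>2 a b * Rbar_inv_entry E z\<^sub>1 z\<^sub>2 b c)"
      by (simp add: R_def B_def matrix_matrix_mult_def Rbar2_nth sum_distrib_left mult_ac)
    then show ?thesis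
      using unit by (simp add: unitarity(1)[OF assms(1)] mat_def mult.assoc)
  qed
  then have RB: "R ** B = mat 1" by (simp add: vec_eq_iff)
  have "(B ** R) $ a $ c = mat 1 $ a $ c" for a c
  proof -
    have "(B ** R) $ a $ c =
        g * g' * d * (\<Sum>b\<in>UNIV. Rbar_inv_entry E z\<^sub>1 z\<^sub>2 a b * Rbar_entry E z\<^sub>1 z\<^sub>2 b c)"
      by (simp add: R_def B_def matrix_matrix_mult_def Rbar2_nth sum_distrib_left mult_ac)
    then show ?thesis
      using unit by (simp add: unitarity(2)[OF assms(1)] mat_def mult.assoc)
  qed
  then have BR: "B ** R = mat 1" by (simp add: vec_eq_iff)
  have *: "R ** matrix_inv R = mat 1 \<and> matrix_inv R ** R = mat 1"
    unfolding matrix_inv_def by (rule someI[of _ B]) (simp add: RB BR)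
  show "(\<Sum>b\<in>UNIV. R $ a $ b * matrix_inv R $ b $ c) = (if a = c then 1 else 0)"
    using arg_cong[OF conjunct1[OF *], of "\<lambda>M. M $ a $ c"] by (simp add: matrix_matrix_mult_def mat_def)
  show "(\<Sum>b\<in>UNIV. matrix_inv R $ a $ b * R $ b $ c) = (if a = c then 1 else 0)"
    using arg_cong[OF conjunct2[OF *], of "\<lambda>M. M $ a $ c"] by (simp add: matrix_matrix_mult_def mat_def)
qed

lemma fls_scalar_simps:
  "fls_scalar (c + d) = fls_scalar c + fls_scalar d"
  "fls_scalar (c - d) = fls_scalar c - fls_scalar d"
  "fls_scalar (c * d) = fls_scalar c * fls_scalar d"
  "fls_scalar (- c) = - fls_scalar c"
  "fls_scalar 1 = 1" "fls_scalar 0 = 0"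
proof -
  have sum: "fls_const (sum g A) = (\<Sum>i\<in>A. fls_const (g i))" for g :: "nat \<Rightarrow> complex" and A
    by (induction A rule: infinite_finite_induct) (simp_all flip: fls_plus_const)
  show "fls_scalar (c * d) = fls_scalar c * fls_scalar d"
    by (rule fps_ext) (simp add: fps_mult_nth sum)
qed (rule fps_ext; simp add: fls_plus_const fls_minus_const fps_one_nth)+

definition gfactor_inv :: "(complex \<Rightarrow> 'r) \<Rightarrow> 'r \<Rightarrow> 'r::comm_ring_1"
  where "gfactor_inv E z = - E (- 1/2) * (1 - z * E 1)"

lemma gfactor_inverse:
  assumes "E (1/2) * E (- 1/2) = 1" "(1 - z * E 1) * inverse (1 - z * E 1) = 1"
  shows "gfactor E z * gfactor_inv E z = 1"
proof -
  have "gfactor E z * gfactor_inv E z = (E (1/2) * E (- 1/2)) * ((1 - z * E 1) * inverse (1 - z * E 1))"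
    by (simp add: gfactor_def gfactor_inv_def algebra_simps)
  then show ?thesis using assms by simp
qed

text \<open>
  The element \<open>e\<^sup>x\<close> of \<open>\<complex>((x))[[h]]\<close>.
\<close>

definition exp_fls :: "complex fls fps"
  where "exp_fls = fps_const (fps_to_fls (fps_exp 1))"

definition E_fls :: "complex \<Rightarrow> complex fls fps"
  where "E_fls c = fls_scalar (fps_exp c)"

lemma R_exp_eq: "R_exp 1 = gfactor E_fls exp_fls *m Rbar2 E_fls exp_fls 1"
  by (simp add: R_exp_def E_fls_def[abs_def] fls_scalar_def exp_fls_def Let_def)

lemma E_fls_half: "E_fls (1/2) * E_fls (- 1/2) = 1"
  unfolding E_fls_def fls_scalar_simps(3)[symmetric]
  by (simp add: fls_scalar_simps flip: fps_exp_add_mult)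

lemma exp_fls_0_neq: "fps_to_fls (fps_exp (1::complex)) \<noteq> 1"
proof -
  have "fls_nth (fps_to_fls (fps_exp (1::complex))) 1 \<noteq> fls_nth 1 1" by simp
  then show ?thesis by metis
qed

text \<open>
  The product of R-bar with the inverse of \<open>R = g\<close> R-bar is the scalar \<open>g\<^sup>-\<^sup>1\<close>.  At \<open>h = 0\<close> the elements to be inverted are
  \<open>1 - e\<^sup>x\<close> and \<open>- (1 - e\<^sup>x)\<^sup>2\<close>, which are nonzero in the field \<open>\<complex>((x))\<close>.
\<close>

lemma R_exp_inverse:
  fixes a c :: "'n::{finite,linorder} \<times> 'n"
  shows "(\<Sum>b\<in>UNIV. Rbar_entry E_fls exp_fls 1 a b * matrix_inv (R_exp 1) $ b $ c) =
    (if a = c then gfactor_inv E_fls exp_fls else 0)"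
proof -
  let ?f = "1 - exp_fls * E_fls 1" and ?u = "unitarity_factor E_fls exp_fls 1"
  have "fps_nth ?f 0 \<noteq> 0" using exp_fls_0_neq by (simp add: exp_fls_def E_fls_def)
  from inverse_mult_eq_1'[OF this]
  have g: "gfactor E_fls exp_fls * gfactor_inv E_fls exp_fls = 1"
    by (rule gfactor_inverse[OF E_fls_half])
  have "fps_nth ?u 0 \<noteq> 0"
    using exp_fls_0_neq by (simp add: exp_fls_def E_fls_def unitarity_factor_def)
  from inverse_mult_eq_1'[OF this]
  have inv: "(\<Sum>b\<in>UNIV. R_exp 1 $ a $ b * matrix_inv (R_exp 1) $ b $ c) = (if a = c then 1 else 0)"
    unfolding R_exp_eq by (rule matrix_inv_Rbar2(1)[OF E_fls_half g])
  have "Rbar_entry E_fls exp_fls 1 a b = gfactor_inv E_fls exp_fls * R_exp 1 $ a $ b" for a b :: "'n \<times> 'n"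
    using g by (simp add: R_exp_eq Rbar2_nth mult.assoc[symmetric] mult.commute[of "gfactor_inv _ _"])
  then have "(\<Sum>b\<in>UNIV. Rbar_entry E_fls exp_fls 1 a b * matrix_inv (R_exp 1) $ b $ c) =
      gfactor_inv E_fls exp_fls * (\<Sum>b\<in>UNIV. R_exp 1 $ a $ b * matrix_inv (R_exp 1) $ b $ c)"
    by (simp add: sum_distrib_left mult.assoc)
  then show ?thesis by (simp add: inv)
qed

text \<open>
  The substitution \<open>x = 0\<close> in \<open>\<complex>(z)[[x]][[h]]\<close>.  Only this value of \<open>R(z e\<^sup>x)\<close> enters the action of \<open>\<sigma>\<close> on the constant
  terms \<open>L\<^sup>+(0) \<otimes> L\<^sup>+(0)\<close>.
\<close>

definition at_0 :: "ratfun fps fps \<Rightarrow> ratfun fps"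
  where "at_0 f = Abs_fps (\<lambda>n. fps_nth (fps_nth f n) 0)"

lemma at_0_nth [simp]: "fps_nth (at_0 f) n = fps_nth (fps_nth f n) 0"
  by (simp add: at_0_def)

lemma expand_diff_z_0: "expand_diff_z f 0 0 = at_0 f"
  by (rule fps_ext) (simp add: expand_diff_z_def)

lemma at_0_simps:
  "at_0 (f + g) = at_0 f + at_0 g" "at_0 (f - g) = at_0 f - at_0 g"
  "at_0 (f * g) = at_0 f * at_0 g" "at_0 1 = 1" "at_0 0 = 0" "at_0 (- f) = - at_0 f"
  by (rule fps_ext; simp add: fps_mult_nth fps_sum_nth fps_one_nth)+

lemma at_0_sum: "at_0 (sum f A) = (\<Sum>i\<in>A. at_0 (f i))"
  by (induction A rule: infinite_finite_induct) (simp_all add: at_0_simps)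

text \<open>
  The element \<open>z e\<^sup>x\<close> of \<open>\<complex>(z)[[x]][[h]]\<close>.
\<close>

definition exp_z :: "ratfun fps fps"
  where "exp_z = fps_const (Abs_fps (\<lambda>n. to_fract [:0, fps_nth (fps_exp 1) n:]))"

definition E_z :: "complex \<Rightarrow> ratfun fps fps"
  where "E_z c = Abs_fps (\<lambda>n. fps_const (to_fract [:fps_nth (fps_exp c) n:]))"

lemma R_zexp_eq: "R_zexp = gfactor E_z exp_z *m Rbar2 E_z exp_z 1"
  by (simp add: R_zexp_def E_z_def[abs_def] exp_z_def Let_def)

lemma to_fract_const_sum: "to_fract [:sum g A:] = (\<Sum>i\<in>A. to_fract [:g i:])"
  for g :: "nat \<Rightarrow> complex"
proof (induction A rule: infinite_finite_induct)
  case (insert x F)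
  have "[:sum g (insert x F):] = [:g x:] + [:sum g F:]" using insert by simp
  then show ?case using insert by (simp only: to_fract_add sum.insert simp_thms)
qed simp_all

definition z_scalar :: "complex fps \<Rightarrow> ratfun fps fps"
  where "z_scalar c = Abs_fps (\<lambda>n. fps_const (to_fract [:fps_nth c n:]))"

lemma z_scalar_mult: "z_scalar c * z_scalar d = z_scalar (c * d)"
proof (rule fps_ext)
  fix n
  have "fps_nth (z_scalar c * z_scalar d) n =
      (\<Sum>i=0..n. fps_const (to_fract [:fps_nth c i * fps_nth d (n - i):]))"
    unfolding fps_mult_nth by (simp add: z_scalar_def mult.commute flip: to_fract_mult)
  also have "\<dots> = fps_nth (z_scalar (c * d)) n"
    by (rule fps_ext) (simp add: z_scalar_def fps_mult_nth fps_sum_nth to_fract_const_sum)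
  finally show "fps_nth (z_scalar c * z_scalar d) n = fps_nth (z_scalar (c * d)) n" .
qed

lemma E_z_half: "E_z (1/2) * E_z (- 1/2) = 1"
proof -
  have "E_z c = z_scalar (fps_exp c)" for c by (simp add: E_z_def z_scalar_def)
  then have "E_z (1/2) * E_z (- 1/2) = z_scalar 1"
    by (simp add: z_scalar_mult flip: fps_exp_add_mult)
  also have "z_scalar 1 = 1"
    by (rule fps_ext) (simp add: z_scalar_def fps_one_nth one_pCons[symmetric])
  finally show ?thesis .
qed

text \<open>
  The coefficient ring \<open>\<complex>(z)[[x]]\<close> is not a field, but units are recognized by their constant terms.
\<close>

lemma fps_fps_inverse:
  fixes f :: "'a::field fps fps"
  assumes "fps_nth (fps_nth f 0) 0 \<noteq> 0"
  shows "f * inverse f = 1"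
  by (subst fps_inverse_def) (rule fps_right_inverse[OF inverse_mult_eq_1'[OF assms]])

lemma R_zexp_inverse:
  fixes a c :: "'n::{finite,linorder} \<times> 'n"
  shows "gfactor E_z exp_z * gfactor_inv E_z exp_z = 1"
    "(\<Sum>b\<in>UNIV. matrix_inv R_zexp $ a $ b * R_zexp $ b $ c) = (if a = c then 1 else 0)"
proof -
  let ?f = "1 - exp_z * E_z 1" and ?u = "unitarity_factor E_z exp_z 1"
  have neq: "to_fract [:0, 1:] \<noteq> (1 :: ratfun)"
    by (simp flip: to_fract_1) (simp add: one_pCons)
  have "fps_nth (fps_nth ?f 0) 0 \<noteq> 0"
    using neq by (simp add: exp_z_def E_z_def flip: one_pCons)
  from fps_fps_inverse[OF this]
  show g: "gfactor E_z exp_z * gfactor_inv E_z exp_z = 1"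
    by (rule gfactor_inverse[OF E_z_half])
  have "fps_nth (fps_nth ?u 0) 0 \<noteq> 0"
    using neq by (simp add: exp_z_def E_z_def unitarity_factor_def flip: one_pCons)
  from fps_fps_inverse[OF this]
  show "(\<Sum>b\<in>UNIV. matrix_inv R_zexp $ a $ b * R_zexp $ b $ c) = (if a = c then 1 else 0)"
    unfolding R_zexp_eq by (rule matrix_inv_Rbar2(2)[OF E_z_half g])
qed

text \<open>
  The entries of the polynomial matrix have degree at most one, so they are given by their coefficients for \<open>m = 0, 1\<close>.
\<close>

definition Rbar_coeff :: "nat \<Rightarrow> 'n::{finite,linorder} \<times> 'n \<Rightarrow> 'n \<times> 'n \<Rightarrow> complex fps"
  where "Rbar_coeff m a b = coeff (Rbar_poly $ a $ b) m"

lemma Rbar_poly_entry: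
  fixes a b :: "'n::{finite,linorder} \<times> 'n"
  defines "e \<equiv> fps_exp (- 1/2)" and "p \<equiv> fps_exp (1/2)"
  shows "Rbar_poly $ a $ b =
    (if b = a then (if fst a = snd a then [:- (e * p), e * e:] else [:- e, e:])
     else if b = prod.swap a then (if snd a < fst a then [:0, e * (e - p):] else [:e * (e - p):]) else 0)"
proof -
  have "Rbar_poly $ a $ b = [:e:] * Rbar_entry (\<lambda>c. [:fps_exp c:]) [:0, 1:] 1 a b"
    by (simp only: Rbar_poly_def Rbar2_nth mscale_nth e_def)
  also have "\<dots> = (if b = a then (if fst a = snd a then [:- (e * p), e * e:] else [:- e, e:])
     else if b = prod.swap a then (if snd a < fst a then [:0, e * (e - p):] else [:e * (e - p):]) else 0)"
    unfolding Rbar_entry_def e_def[symmetric] p_def[symmetric] one_pCons by simp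
  finally show ?thesis .
qed

lemma degree_Rbar_poly: "degree (Rbar_poly $ a $ b) \<le> 1"
  unfolding Rbar_poly_entry by (simp add: degree_pCons_le)

lemma Rbar_coeff_fls:
  fixes a b :: "'n::{finite,linorder} \<times> 'n"
  shows "fls_scalar (Rbar_coeff 0 a b) + fls_scalar (Rbar_coeff 1 a b) * z = E_fls (- 1/2) * Rbar_entry E_fls z 1 a b"
proof -
  define e p where "e = fps_exp (- 1/2 :: complex)" and "p = fps_exp (1/2 :: complex)"
  have E: "E_fls (- 1/2) = fls_scalar e" "E_fls (1/2) = fls_scalar p"
    by (simp_all only: E_fls_def e_def p_def)
  show ?thesis
    unfolding Rbar_coeff_def Rbar_poly_entry Rbar_entry_def E e_def[symmetric] p_def[symmetric]
    by (simp add: fls_scalar_simps algebra_simps)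
qed

definition rat_z :: "ratfun fps"
  where "rat_z = fps_const (to_fract [:0, 1:])"

lemma ratfun_scalar_simps:
  "ratfun_scalar (c + d) = ratfun_scalar c + ratfun_scalar d"
  "ratfun_scalar (c - d) = ratfun_scalar c - ratfun_scalar d"
  "ratfun_scalar (- c) = - ratfun_scalar c"
  "ratfun_scalar (c * d) = ratfun_scalar c * ratfun_scalar d"
  "ratfun_scalar 0 = 0"
proof -
  show "ratfun_scalar (c * d) = ratfun_scalar c * ratfun_scalar d"
    by (rule fps_ext) (simp add: ratfun_scalar_def fps_mult_nth to_fract_const_sum mult.commute flip: to_fract_mult)
qed (rule fps_ext; simp add: ratfun_scalar_def flip: to_fract_add to_fract_diff to_fract_uminus)+

lemma Rbar_coeff_ratfun:
  fixes a b :: "'n::{finite,linorder} \<times> 'n"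
  shows "ratfun_scalar (Rbar_coeff 0 a b) + ratfun_scalar (Rbar_coeff 1 a b) * rat_z =
    at_0 (E_z (- 1/2) * Rbar_entry E_z exp_z 1 a b)"
proof -
  define e p where "e = fps_exp (- 1/2 :: complex)" and "p = fps_exp (1/2 :: complex)"
  have E: "at_0 (E_z (- 1/2)) = ratfun_scalar e" "at_0 (E_z (1/2)) = ratfun_scalar p"
    by (rule fps_ext, simp only: E_z_def e_def p_def at_0_nth ratfun_scalar_def fps_nth_Abs_fps fps_nth_fps_const simp_thms if_True)+
  have z: "at_0 exp_z = rat_z"
    by (rule fps_ext) (simp add: exp_z_def rat_z_def)
  show ?thesis
    unfolding Rbar_coeff_def Rbar_poly_entry Rbar_entry_def e_def[symmetric] p_def[symmetric]
    by (simp add: E[simplified] z at_0_simps ratfun_scalar_simps algebra_simps)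
qed

text \<open>
  At \<open>x = 0\<close> the R-matrix is a unit times the polynomial matrix, and its inverse is still the inverse.
\<close>

lemma at_0_R_zexp:
  defines "\<rho> \<equiv> \<lambda>a b :: 'n::{finite,linorder} \<times> 'n. ratfun_scalar (Rbar_coeff 0 a b) + ratfun_scalar (Rbar_coeff 1 a b) * rat_z"
  obtains g g' where "g * g' = 1" "\<And>a b :: 'n \<times> 'n. at_0 (R_zexp $ a $ b) = g * \<rho> a b"
    "\<And>a c :: 'n \<times> 'n. (\<Sum>b\<in>UNIV. at_0 (matrix_inv R_zexp $ a $ b) * at_0 (R_zexp $ b $ c)) = (if a = c then 1 else 0)"
proof (rule that)
  let ?g = "at_0 (gfactor E_z exp_z)" and ?g' = "at_0 (gfactor_inv E_z exp_z)"
  let ?e = "at_0 (E_z (- 1/2))" and ?e' = "at_0 (E_z (1/2))"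
  have g: "?g * ?g' = 1" "?e' * ?e = 1"
    by (simp_all only: at_0_simps(3)[symmetric] R_zexp_inverse(1) E_z_half at_0_simps(4))
  have "(?g * ?e') * (?g' * ?e) = (?g * ?g') * (?e' * ?e)" by (simp only: mult_ac)
  then show "(?g * ?e') * (?g' * ?e) = 1" by (simp only: g mult_1)
  show "at_0 (R_zexp $ a $ b) = ?g * ?e' * \<rho> a b" for a b :: "'n \<times> 'n"
  proof -
    have "?g * ?e' * \<rho> a b = ?g * (?e' * ?e) * at_0 (Rbar_entry E_z exp_z 1 a b)"
      unfolding \<rho>_def Rbar_coeff_ratfun at_0_simps(3) by (simp only: mult_ac)
    then show ?thesis by (simp only: g R_zexp_eq mscale_nth Rbar2_nth at_0_simps(3) mult_1_right)
  qed
  show "(\<Sum>b\<in>UNIV. at_0 (matrix_inv R_zexp $ a $ b) * at_0 (R_zexp $ b $ c)) = (if a = c then 1 else 0)"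
    for a c :: "'n \<times> 'n"
    using arg_cong[OF R_zexp_inverse(2)[of a c], of at_0] by (simp add: at_0_sum at_0_simps)
qed

section \<open>Products of two fields\<close>

lemma fls_times_nth_superset:
  fixes f g :: "complex fls"
  assumes "finite S" "\<And>m. m \<notin> S \<Longrightarrow> fls_nth f m * fls_nth g (q - m) = 0"
  shows "fls_nth (f * g) q = (\<Sum>m\<in>S. fls_nth f m * fls_nth g (q - m))"
proof -
  let ?T = "{fls_subdegree f..q - fls_subdegree g}"
  have "fls_nth (f * g) q = (\<Sum>m\<in>?T. fls_nth f m * fls_nth g (q - m))"
    by (rule fls_times_nth(2))
  also have "\<dots> = (\<Sum>m\<in>?T \<union> S. fls_nth f m * fls_nth g (q - m))"
    by (rule sum.mono_neutral_left) (use assms(1) in auto)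
  also have "\<dots> = (\<Sum>m\<in>S. fls_nth f m * fls_nth g (q - m))"
    by (rule sum.mono_neutral_right) (use assms in auto)
  finally show ?thesis .
qed

lemma fls_nth_sum: "fls_nth (sum f A) q = (\<Sum>i\<in>A. fls_nth (f i) q)"
  by (induction A rule: infinite_finite_induct) simp_all

lemma hpow_scaleI:
  assumes "hmod.subspace W" "y \<in> W" "K \<le> k"
  shows "(fps_X ^ k * c) \<odot> y \<in> hpow K W"
proof -
  have "(fps_X ^ k * c) \<odot> y = fps_X ^ K \<odot> ((fps_X ^ (k - K) * c) \<odot> y)"
    using assms(3) by (simp add: hscale_hscale mult.assoc[symmetric] flip: power_add)
  then show ?thesis
    unfolding hpow_def using assms(1,2) by (metis image_eqI hmod.subspace_scale)
qed

text \<open>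
  The properties of a module map \<open>Y\<^sub>W\<close> that do not involve associativity or locality.
\<close>

locale field_action = top_free W for W :: "'w::hmodule set" +
  fixes YW :: "'n::{finite,linorder} VR \<Rightarrow> int \<Rightarrow> 'w \<Rightarrow> 'w"
  assumes YW_add: "w \<in> W \<Longrightarrow> w' \<in> W \<Longrightarrow> YW v s (w + w') = YW v s w + YW v s w'"
    and YW_scale: "w \<in> W \<Longrightarrow> YW v s (c \<odot> w) = c \<odot> YW v s w"
    and YW_hom: "w \<in> W \<Longrightarrow> hlinear (\<lambda>v. YW v s w)"
    and YW_laurent: "w \<in> W \<Longrightarrow> laurent_h W (\<lambda>s. YW v s w)"
begin

lemma YW_in: "w \<in> W \<Longrightarrow> YW v s w \<in> W"
  using YW_laurent by (auto simp: laurent_h_def)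

lemma YW_hpow: "w \<in> hpow k W \<Longrightarrow> YW v s w \<in> hpow k W"
  by (auto simp: hpow_def YW_scale YW_in)

lemma YW_hpow_left:
  assumes "v \<in> hpow k UNIV" "w \<in> W"
  shows "YW v s w \<in> hpow k W"
proof -
  obtain v' where "v = fps_X ^ k \<odot> v'" using assms(1) by (auto simp: hpow_def)
  then show ?thesis
    using module_hom.scale[OF YW_hom[OF assms(2)]] YW_in[OF assms(2)] by (simp add: hpow_def)
qed

lemma dual_on_YW: "dual_on W \<Lambda> \<Longrightarrow> w \<in> W \<Longrightarrow> dual_on UNIV (\<lambda>v. \<Lambda> (YW v s w))"
  unfolding dual_on_def
  by (simp add: module_hom.add[OF YW_hom] module_hom.scale[OF YW_hom] YW_in)

lemma YW_bounded_below:
  assumes "w \<in> W"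
  obtains M where "\<And>q. q < M \<Longrightarrow> YW v q w \<in> hpow k W"
  using YW_laurent[OF assms, of v] unfolding laurent_h_def by blast

lemma product_bounded_below:
  assumes "w \<in> W" "dual_on W \<Lambda>"
  obtains M where "\<And>p q. q < M \<Longrightarrow> fps_nth (\<Lambda> (YW u p (YW v q w))) n = 0"
proof -
  obtain M where "\<And>q. q < M \<Longrightarrow> YW v q w \<in> hpow (Suc n) W" using YW_bounded_below[OF assms(1)] by blast
  then show ?thesis using that[of M] dual_on_hpow[OF assms(2) YW_hpow] by blast
qed

text \<open>
  The coefficient of \<open>y\<^sup>q\<close> is the matrix coefficient of \<open>z\<^sub>1\<^sup>s\<^sup>-\<^sup>q z\<^sub>2\<^sup>q\<close> in \<open>Y\<^sub>W(u,z\<^sub>1) Y\<^sub>W(v,z\<^sub>2) w\<close>, so that multiplication by a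
  function of \<open>z\<^sub>1/z\<^sub>2\<close>, expanded for small \<open>z\<^sub>2\<close>, becomes multiplication in \<open>\<complex>((y))[[h]]\<close>.
\<close>

definition diagonal_series :: "('w \<Rightarrow> complex fps) \<Rightarrow> 'w \<Rightarrow> int \<Rightarrow> 'n VR \<times> 'n VR \<Rightarrow> complex fls fps"
  where "diagonal_series \<Lambda> w s = (\<lambda>(u, v). Abs_fps (\<lambda>n. Abs_fls (\<lambda>q. fps_nth (\<Lambda> (YW u (s - q) (YW v q w))) n)))"

lemma diagonal_series_nth:
  assumes "w \<in> W" "dual_on W \<Lambda>"
  shows "fls_nth (fps_nth (diagonal_series \<Lambda> w s (u, v)) n) q = fps_nth (\<Lambda> (YW u (s - q) (YW v q w))) n"
proof -
  obtain M where "\<And>p q. q < M \<Longrightarrow> fps_nth (\<Lambda> (YW u p (YW v q w))) n = 0"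
    using product_bounded_below[OF assms] by blast
  then show ?thesis
    unfolding diagonal_series_def split_conv fps_nth_Abs_fps by (intro nth_Abs_fls_ex_lower_bound) blast
qed

lemma bilinear_diagonal_series:
  assumes w: "w \<in> W" and \<Lambda>: "dual_on W \<Lambda>"
  shows "bilinear_family (diagonal_series \<Lambda> w s)"
proof -
  note lin = module_hom.add[OF YW_hom] module_hom.scale[OF YW_hom] YW_in YW_add YW_scale
    dual_on_add[OF \<Lambda>] dual_on_scale[OF \<Lambda>] w
  show ?thesis
    unfolding bilinear_family_def
    by (intro conjI allI fps_ext fls_eqI)
      (simp_all only: diagonal_series_nth[OF w \<Lambda>] fps_add_nth fls_plus_nth lin fps_mult_nth fls_nth_sum
        fls_scalar_nth fls_mult_const_nth)
qed

text \<open>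
  The defining sum of \<^const>\<open>eval_VVz\<close> converges: modulo \<open>h\<^sup>K\<close> only \<open>k < K\<close> and finitely many pairs \<open>(u, v)\<close> matter, and \<open>m\<close> is
  bounded below by the order of the rational function and above because \<open>Y\<^sub>W(v,z\<^sub>2) w\<close> is bounded below.  Functionals
  turn it into a Cauchy product.
\<close>

lemma dual_eval_VVz:
  assumes w: "w \<in> W" and \<Lambda>: "dual_on W \<Lambda>"
  shows "eval_VVz W YW x w p q \<in> W"
    "fps_nth (\<Lambda> (eval_VVz W YW x w p q)) N = fls_nth (fps_nth (vvz_eval (diagonal_series \<Lambda> w (p + q)) x) N) q"
proof -
  define X where "X = rep_VVz x"
  define a where "a k u v m = fls_nth (expand_inv (Poly_Mapping.lookup (fps_nth X k) (u, v))) m" for k u v m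
  define f where "f = (\<lambda>(k, (u, v), m). (fps_X ^ k * fps_const (a k u v m)) \<odot> YW u (p + m) (YW v (q - m) w))"
  have fW: "f i \<in> W" for i
    unfolding f_def by (auto simp: hmod.subspace_scale[OF subspace] YW_in w split: prod.splits)
  have fin: "finite {i. f i \<notin> hpow K W}" for K
  proof -
    obtain M where M: "\<And>v s. s < M v \<Longrightarrow> YW v s w \<in> hpow K W"
    proof -
      have "\<forall>v. \<exists>M. \<forall>s<M. YW v s w \<in> hpow K W" using YW_bounded_below[OF w] by metis
      then show ?thesis using that by metis
    qed
    define S where "S = (SIGMA k : {..<K}. SIGMA uv : Poly_Mapping.keys (fps_nth X k).
      {fls_subdegree (expand_inv (Poly_Mapping.lookup (fps_nth X k) uv))..q - M (snd uv)})"
    have z: "0 \<in> hpow K W" by (rule hmod.subspace_0[OF subspace_hpow[OF subspace]])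
    have "f (k, (u, v), m) \<in> hpow K W" if not_S: "(k, (u, v), m) \<notin> S" for k u v m
    proof -
      consider "K \<le> k" | "(u, v) \<notin> Poly_Mapping.keys (fps_nth X k)"
        | "m < fls_subdegree (expand_inv (Poly_Mapping.lookup (fps_nth X k) (u, v)))" | "q - M v < m"
        using not_S by (fastforce simp: S_def)
      then show ?thesis
      proof cases
        case 1
        then show ?thesis by (simp add: f_def hpow_scaleI[OF subspace] YW_in w)
      next
        case 2
        then show ?thesis by (simp add: f_def a_def in_keys_iff z)
      next
        case 3
        then show ?thesis by (simp add: f_def a_def z)
      next
        case 4
        then have "YW u (p + m) (YW v (q - m) w) \<in> hpow K W"
          by (intro YW_hpow M) simp
        then show ?thesis
          by (simp add: f_def hmod.subspace_scale[OF subspace_hpow[OF subspace]])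
      qed
    qed
    then have "{i. f i \<notin> hpow K W} \<subseteq> S" by auto
    moreover have "finite S" unfolding S_def by (intro finite_SigmaI) auto
    ultimately show ?thesis by (rule finite_subset)
  qed
  have eval: "eval_VVz W YW x w p q = hsum W f"
    unfolding eval_VVz_def f_def a_def X_def ..
  have sums: "hsums W f (hsum W f)" by (rule hsums_hsum[OF fW fin])
  then show "eval_VVz W YW x w p q \<in> W" unfolding eval by (simp add: hsums_def)
  let ?B = "\<lambda>uv n. fps_nth (diagonal_series \<Lambda> w (p + q) uv) n"
  let ?e = "\<lambda>k uv. expand_inv (Poly_Mapping.lookup (fps_nth X k) uv)"
  define T where "T k uv = {fls_subdegree (?e k uv)..q - fls_subdegree (?B uv (N - k))}" for k uv
  have finT: "finite (T k uv)" for k uv by (simp add: T_def)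
  define S where "S = (SIGMA k : {0..N}. SIGMA uv : Poly_Mapping.keys (fps_nth X k). T k uv)"
  have fn: "fps_nth (\<Lambda> (f (k, uv, m))) N =
      (if k \<le> N then fls_nth (?e k uv) m * fls_nth (?B uv (N - k)) (q - m) else 0)" for k uv m
  proof -
    obtain u v where uv: "uv = (u, v)" by (cases uv)
    show ?thesis
      by (auto simp: uv f_def a_def dual_on_scale[OF \<Lambda>] YW_in w diagonal_series_nth[OF w \<Lambda>] mult.assoc
          fps_X_power_mult_nth add.commute)
  qed
  have zero: "fls_nth (?e k uv) m * fls_nth (?B uv (N - k)) (q - m) = 0" if "m \<notin> T k uv" for k uv m
  proof -
    have "m < fls_subdegree (?e k uv) \<or> q - m < fls_subdegree (?B uv (N - k))"
      using that by (auto simp: T_def)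
    then show ?thesis by auto
  qed
  have "fps_nth (\<Lambda> (hsum W f)) N = (\<Sum>i\<in>S. fps_nth (\<Lambda> (f i)) N)"
  proof (rule hsums_dual[OF subspace \<Lambda> sums])
    show "finite S" unfolding S_def T_def by (intro finite_SigmaI) auto
    fix i assume "i \<notin> S"
    moreover obtain k uv m where "i = (k, uv, m)" by (cases i)
    ultimately show "fps_nth (\<Lambda> (f i)) N = 0"
      using zero[of m k uv] by (auto simp: S_def fn in_keys_iff)
  qed
  also have "\<dots> = (\<Sum>k=0..N. \<Sum>uv\<in>Poly_Mapping.keys (fps_nth X k). \<Sum>m\<in>T k uv. fps_nth (\<Lambda> (f (k, uv, m))) N)"
    unfolding S_def by (simp add: sum.Sigma finT split_def)
  also have "\<dots> = (\<Sum>k=0..N. \<Sum>uv\<in>Poly_Mapping.keys (fps_nth X k). fls_nth (?e k uv * ?B uv (N - k)) q)"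
  proof (intro sum.cong refl)
    fix k uv assume "k \<in> {0..N}"
    then show "(\<Sum>m\<in>T k uv. fps_nth (\<Lambda> (f (k, uv, m))) N) = fls_nth (?e k uv * ?B uv (N - k)) q"
      by (subst fls_times_nth_superset[of "T k uv"]) (use zero in \<open>auto simp: T_def fn\<close>)
  qed
  also have "\<dots> = fls_nth (fps_nth (vvz_eval (diagonal_series \<Lambda> w (p + q)) x) N) q"
    unfolding vvz_eval_def vv_eval_def lin_expand_def X_def by (simp add: fls_nth_sum)
  finally show "fps_nth (\<Lambda> (eval_VVz W YW x w p q)) N = fls_nth (fps_nth (vvz_eval (diagonal_series \<Lambda> w (p + q)) x) N) q"
    unfolding eval .
qed

end

section \<open>The action of sigma on generators\<close>

text \<open>
  The case \<open>n = m = 1\<close>, \<open>u = v = 0\<close> of the definition of \<open>\<sigma>\<close>.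
\<close>

lemma sigma_lplus:
  assumes "sigma_map \<sigma>"
  shows "\<sigma> (lplus i k 0) (lplus j l 0) =
    (\<Sum>b\<in>UNIV. zscale (at_0 (R_zexp $ (i, j) $ b)) (\<Sum>d\<in>UNIV. zscale (at_0 (matrix_inv R_zexp $ d $ (k, l)))
      (vtensor (lplus (fst b) (fst d) 0) (lplus (snd b) (snd d) 0))))"
proof -
  have "\<sigma> (lplus_prod (take 1 [i, j]) (take 1 [k, l]) (take 1 [0, 0]))
          (lplus_prod (drop 1 [i, j]) (drop 1 [k, l]) (drop 1 [0, 0])) =
       foldr (\<lambda>(i, j). act_Rz R_zexp i j) [(i, j). i \<leftarrow> rev [0..<1], j \<leftarrow> [1..<1 + 1]]
         (foldr (\<lambda>(i, j). ract_Rz (matrix_inv R_zexp) i j) [(i, j). i \<leftarrow> [0..<1], j \<leftarrow> rev [1..<1 + 1]]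
           (\<lambda>a b r. vtensor (lplus_prod (take 1 a) (take 1 b) (take 1 r))
              (lplus_prod (drop 1 a) (drop 1 b) (drop 1 r))))
         [i, j] [k, l] [0, 0]"
    by (rule assms[unfolded sigma_map_def, THEN conjunct2, THEN conjunct2, THEN conjunct2, THEN conjunct2,
          rule_format]) simp
  then show ?thesis
    by (simp add: lplus_prod_def act_Rz_def ract_Rz_def expand_diff_z_0 split_def)
qed

text \<open>
  The matrix R-bar, normalized by \<open>e\<^sup>-\<^sup>h\<^sup>/\<^sup>2\<close>, at an element \<open>z\<close> of \<open>\<complex>((x))[[h]]\<close>.
\<close>

definition Rbar_at :: "complex fls fps \<Rightarrow> 'n::{finite,linorder} \<times> 'n \<Rightarrow> 'n \<times> 'n \<Rightarrow> complex fls fps"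
  where "Rbar_at z a b = fls_scalar (Rbar_coeff 0 a b) + fls_scalar (Rbar_coeff 1 a b) * z"

text \<open>
  In matrix form \<open>\<sigma> = R X R\<^sup>-\<^sup>1\<close>, where \<open>X\<close> is the matrix of tensors of generators; so \<open>\<sigma> R = R X\<close>, and the
  scalar unit that relates \<open>R\<close> to R-bar can be removed from both sides.
\<close>

lemma sigma_exchange:
  fixes a e :: "'n::{finite,linorder} \<times> 'n"
  assumes \<sigma>: "sigma_map \<sigma>" and \<beta>: "bilinear_family \<beta>"
  shows "(\<Sum>c\<in>UNIV. vvz_eval \<beta> (\<sigma> (lplus (fst a) (fst c) 0) (lplus (snd a) (snd c) 0)) * Rbar_at (fps_const fls_X_inv) c e)
    = (\<Sum>b\<in>UNIV. Rbar_at (fps_const fls_X_inv) a b * \<beta> (lplus (fst b) (fst e) 0, lplus (snd b) (snd e) 0))"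
proof -
  obtain g g' where g: "g * g' = 1" and
    P: "\<And>a b :: 'n \<times> 'n. at_0 (R_zexp $ a $ b) = g * (ratfun_scalar (Rbar_coeff 0 a b) + ratfun_scalar (Rbar_coeff 1 a b) * rat_z)"
    and Q: "\<And>a c :: 'n \<times> 'n. (\<Sum>b\<in>UNIV. at_0 (matrix_inv R_zexp $ a $ b) * at_0 (R_zexp $ b $ c)) = (if a = c then 1 else 0)"
    by (rule at_0_R_zexp) blast
  let ?P = "\<lambda>a b. fps_expand (at_0 (R_zexp $ a $ b))" and ?Q = "\<lambda>a b. fps_expand (at_0 (matrix_inv R_zexp $ a $ b))"
  let ?t = "\<lambda>b d. \<beta> (lplus (fst b) (fst d) 0, lplus (snd b) (snd d) 0)"
  let ?z = "fps_const fls_X_inv :: complex fls fps"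
  have expand_1: "fps_expand 1 = 1" and expand_0: "fps_expand 0 = 0"
    by (rule fps_ext; simp add: fps_one_nth)+
  have expand_z: "fps_expand rat_z = ?z"
    by (rule fps_ext) (simp add: rat_z_def expand_inv_to_fract)
  have expand_sum: "fps_expand (sum f A) = (\<Sum>i\<in>A. fps_expand (f i))" for f and A :: "('n \<times> 'n) set"
    by (induction A rule: infinite_finite_induct) (simp_all add: expand_0 fps_expand_add)
  have P': "?P a b = fps_expand g * Rbar_at ?z a b" for a b :: "'n \<times> 'n"
    by (simp add: P Rbar_at_def fps_expand_mult fps_expand_add fps_expand_scalar expand_z)
  have g': "fps_expand g' * fps_expand g = 1"
    using g by (simp add: fps_expand_mult[symmetric] expand_1 mult.commute)
  have Q': "(\<Sum>b\<in>UNIV. ?Q a b * ?P b c) = (if a = c then 1 else 0)" for a c :: "'n \<times> 'n"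
    using arg_cong[OF Q[of a c], of fps_expand] by (simp add: expand_sum fps_expand_mult expand_1 expand_0)
  have Rbar_P: "Rbar_at ?z a b = fps_expand g' * ?P a b" for a b :: "'n \<times> 'n"
    unfolding P' by (simp add: g' mult.assoc[symmetric])
  have S: "vvz_eval \<beta> (\<sigma> (lplus (fst a) (fst c) 0) (lplus (snd a) (snd c) 0)) =
      (\<Sum>b\<in>UNIV. \<Sum>d\<in>UNIV. ?P a b * (?Q d c * ?t b d))" for c
    by (simp add: sigma_lplus[OF \<sigma>] vvz_eval_sum[OF \<beta>] vvz_eval_scale[OF \<beta>] vvz_eval_tensor[OF \<beta>]
        sum_distrib_left)
  have "(\<Sum>c\<in>UNIV. vvz_eval \<beta> (\<sigma> (lplus (fst a) (fst c) 0) (lplus (snd a) (snd c) 0)) * ?P c e) =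
      (\<Sum>c\<in>UNIV. \<Sum>b\<in>UNIV. \<Sum>d\<in>UNIV. ?P a b * ?t b d * (?Q d c * ?P c e))"
    by (simp add: S sum_distrib_left sum_distrib_right mult_ac)
  also have "\<dots> = (\<Sum>b\<in>UNIV. \<Sum>c\<in>UNIV. \<Sum>d\<in>UNIV. ?P a b * ?t b d * (?Q d c * ?P c e))"
    by (rule sum.swap)
  also have "\<dots> = (\<Sum>b\<in>UNIV. \<Sum>d\<in>UNIV. \<Sum>c\<in>UNIV. ?P a b * ?t b d * (?Q d c * ?P c e))"
    by (rule sum.cong[OF refl], rule sum.swap)
  also have "\<dots> = (\<Sum>b\<in>UNIV. \<Sum>d\<in>UNIV. ?P a b * ?t b d * (if d = e then 1 else 0))"
    by (simp only: sum_distrib_left[symmetric] Q')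
  also have "\<dots> = (\<Sum>b\<in>UNIV. ?P a b * ?t b e)"
    by (simp add: if_distrib[of "(*) _"] cong: if_cong)
  finally have "fps_expand g' * (\<Sum>c\<in>UNIV. vvz_eval \<beta> (\<sigma> (lplus (fst a) (fst c) 0) (lplus (snd a) (snd c) 0)) * ?P c e) =
      fps_expand g' * (\<Sum>b\<in>UNIV. ?P a b * ?t b e)" by simp
  then show ?thesis
    by (simp add: Rbar_P sum_distrib_left mult_ac)
qed

section \<open>h-adic sums in V(R)\<close>

lemma abs_VR_eq_iff: "abs_VR x = abs_VR y \<longleftrightarrow> x - y \<in> \<Inter>v_ideals"
  using VR.abs_eq_iff by (simp add: v_rel_def)

lemma vfree_scalar_X_power: "vfree_scalar (fps_X ^ k) = (fps_X ^ k :: 'n vfree)"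
  by (rule fps_ext) (simp add: vfree_scalar_def fps_X_power_nth)

text \<open>
  The defining ideal of \<open>V(R)\<close> is the intersection of closed ideals.
\<close>

lemma VR_separated:
  fixes x :: "'n::{finite,linorder} VR"
  assumes "\<And>k. x \<in> hpow k UNIV"
  shows "x = 0"
proof -
  obtain X where X: "x = abs_VR X" using VR.abs_induct[of "\<lambda>x. \<exists>X. x = abs_VR X"] by blast
  have "\<exists>y\<in>\<Inter>v_ideals. \<exists>d. X - y = fps_X ^ k * d" for k
  proof -
    obtain y where "x = fps_X ^ k \<odot> y" using assms[of k] by (auto simp: hpow_def)
    moreover obtain Y where "y = abs_VR Y" using VR.abs_induct[of "\<lambda>x. \<exists>X. x = abs_VR X"] by blast
    ultimately have "abs_VR X = abs_VR (fps_X ^ k * Y)"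
      by (simp add: X hscale_VR.abs_eq vfree_scalar_X_power)
    then show ?thesis
      by (intro bexI[of _ "X - fps_X ^ k * Y"] exI[of _ Y]) (simp_all only: abs_VR_eq_iff, simp)
  qed
  then have "X \<in> \<Inter>v_ideals"
    unfolding v_ideals_def by blast
  then show ?thesis by (simp add: X zero_VR_def abs_VR_eq_iff)
qed

lemma VR_hsum_eqI:
  assumes "hsums UNIV f (x :: 'n::{finite,linorder} VR)"
  shows "hsum UNIV f = x"
  unfolding hsum_def
proof (rule the_equality)
  fix y assume y: "hsums UNIV f y"
  have "y - x = 0"
  proof (rule VR_separated)
    fix k
    have "y - x = (y - trunc_sum k UNIV f) - (x - trunc_sum k UNIV f)" by simp
    also have "\<dots> \<in> hpow k UNIV"
      by (rule hmod.subspace_diff[OF subspace_hpow[OF hmod.subspace_UNIV]])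
        (use y assms in \<open>simp_all add: hsums_def\<close>)
    finally show "y - x \<in> hpow k UNIV" .
  qed
  then show "y = x" by simp
qed fact

lemma zero_in_hpow: "hmod.subspace W \<Longrightarrow> 0 \<in> hpow k W"
  using hmod.subspace_0 subspace_hpow by blast

lemma VR_hsum_single:
  "hsum UNIV (\<lambda>i. if i = i\<^sub>0 then x else 0) = (x :: 'n::{finite,linorder} VR)"
proof (rule VR_hsum_eqI, unfold hsums_def, intro conjI allI)
  fix k
  let ?f = "\<lambda>i. if i = i\<^sub>0 then x else 0"
  have eq: "{i. ?f i \<notin> hpow k UNIV} = (if x \<in> hpow k UNIV then {} else {i\<^sub>0})"
    using zero_in_hpow[OF hmod.subspace_UNIV] by auto
  show "finite {i. ?f i \<notin> hpow k UNIV}" unfolding eq by simp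
  show "x - trunc_sum k UNIV ?f \<in> hpow k UNIV"
    unfolding trunc_sum_def eq using zero_in_hpow[OF hmod.subspace_UNIV, of k, where ?'a = "'n VR"] by simp
qed auto

lemma abs_VR_sum: "abs_VR (sum f A) = (\<Sum>i\<in>A. abs_VR (f i))"
  by (induction A rule: infinite_finite_induct)
    (simp_all add: zero_VR_def[symmetric] plus_VR.abs_eq[symmetric])

text \<open>
  Sums with coefficients tending to zero can be formed in the completed free algebra and projected to the quotient.
\<close>

lemma VR_hsums_scaled:
  fixes v :: "'i \<Rightarrow> 'n::{finite,linorder} VR"
  assumes c: "\<And>n. finite {i. fps_nth (c i) n \<noteq> 0}"
  shows "hsums UNIV (\<lambda>i. c i \<odot> v i) (hsum UNIV (\<lambda>i. c i \<odot> v i))"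
proof -
  define V where "V i = rep_VR (v i)" for i
  have cv: "c i \<odot> v i = abs_VR (vfree_scalar (c i) * V i)" for i
    using Quotient3_abs_rep[OF Quotient3_VR] by (metis V_def hscale_VR.abs_eq)
  \<comment> \<open>Terms outside \<open>S n\<close> are multiples of \<open>h\<^sup>n\<close>.\<close>
  define S where "S n = (\<Union>j\<in>{..<n}. {i. fps_nth (c i) j \<noteq> 0})" for n
  have fin: "finite (S n)" for n using c by (simp add: S_def)
  have nth_0: "fps_nth (vfree_scalar (c i) * V i) n = 0" if "i \<notin> S k" "n < k" for i n k
    using that by (auto simp: fps_mult_nth vfree_scalar_def S_def intro!: sum.neutral)
  define X where "X = Abs_fps (\<lambda>n. fps_nth (\<Sum>i\<in>S (Suc n). vfree_scalar (c i) * V i) n)"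
  have hpowI: "abs_VR x \<in> hpow k UNIV" if "\<And>n. n < k \<Longrightarrow> fps_nth x n = 0" for x :: "'n vfree" and k
  proof -
    have "x = fps_X ^ k * fps_shift k x"
      using that by (intro fps_ext) (simp add: fps_X_power_mult_nth)
    then have "abs_VR x = fps_X ^ k \<odot> abs_VR (fps_shift k x)"
      by (simp add: hscale_VR.abs_eq vfree_scalar_X_power)
    then show ?thesis by (simp add: hpow_def)
  qed
  have "hsums UNIV (\<lambda>i. c i \<odot> v i) (abs_VR X)"
    unfolding hsums_def
  proof (intro conjI allI)
    fix k
    let ?T = "{i. c i \<odot> v i \<notin> hpow k UNIV}"
    have T: "c i \<odot> v i \<in> hpow k UNIV" if "i \<notin> S k" for i
      unfolding cv using nth_0[OF that] by (intro hpowI)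
    then have "?T \<subseteq> S k" by blast
    then show "finite ?T" using fin finite_subset by blast
    have "fps_nth (X - (\<Sum>i\<in>S k. vfree_scalar (c i) * V i)) n = 0" if "n < k" for n
    proof -
      have "S (Suc n) \<subseteq> S k" using that unfolding S_def by (intro UN_mono) auto
      then have "(\<Sum>i\<in>S k. fps_nth (vfree_scalar (c i) * V i) n) = (\<Sum>i\<in>S (Suc n). fps_nth (vfree_scalar (c i) * V i) n)"
        using fin nth_0[of _ "Suc n" n] by (intro sum.mono_neutral_right) auto
      then show ?thesis by (simp add: X_def fps_sum_nth)
    qed
    then have "abs_VR (X - (\<Sum>i\<in>S k. vfree_scalar (c i) * V i)) \<in> hpow k UNIV" by (rule hpowI)
    then have 1: "abs_VR X - (\<Sum>i\<in>S k. c i \<odot> v i) \<in> hpow k UNIV"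
      by (simp add: cv abs_VR_sum[symmetric] minus_VR.abs_eq)
    have 2: "(\<Sum>i\<in>S k - ?T. c i \<odot> v i) \<in> hpow k UNIV"
      by (rule hmod.subspace_sum[OF subspace_hpow[OF hmod.subspace_UNIV]]) blast
    have "(\<Sum>i\<in>S k. c i \<odot> v i) = (\<Sum>i\<in>S k - ?T. c i \<odot> v i) + (\<Sum>i\<in>?T. c i \<odot> v i)"
      by (rule sum.subset_diff[OF \<open>?T \<subseteq> S k\<close> fin])
    then have "abs_VR X - trunc_sum k UNIV (\<lambda>i. c i \<odot> v i) =
        (abs_VR X - (\<Sum>i\<in>S k. c i \<odot> v i)) + (\<Sum>i\<in>S k - ?T. c i \<odot> v i)"
      by (simp add: trunc_sum_def)
    also have "\<dots> \<in> hpow k UNIV"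
      by (rule hmod.subspace_add[OF subspace_hpow[OF hmod.subspace_UNIV] 1 2])
    finally show "abs_VR X - trunc_sum k UNIV (\<lambda>i. c i \<odot> v i) \<in> hpow k UNIV" .
  qed auto
  then show ?thesis using VR_hsum_eqI by metis
qed

section \<open>Vertex operators of the generators\<close>

text \<open>
  For \<open>n = 1\<close> the product of R-matrices is empty and \<open>L(z + u)\<close> at \<open>u = 0\<close> is \<open>L(z)\<close>; in the defining sum only \<open>e = [s]\<close> remains.
\<close>

lemma Y_lplus:
  assumes "vertex_operator_map L Y"
  shows "Y (lplus i j 0) s v = L i j s v"
proof -
  have "Y (lplus_prod [i] [j] [0]) s v = hsum UNIV (\<lambda>e.
         if length e = length [0::nat] \<and> sum_list e = s + int (sum_list [0])
         then fps_const (\<Prod>i<length [0::nat]. of_int (e ! i) gchoose ([0] ! i)) \<odot> L_bracket L (length [0::nat]) v [i] [j] e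
         else 0)"
    by (rule assms[unfolded vertex_operator_map_def, THEN conjunct2, THEN conjunct2, THEN conjunct2,
          rule_format]) simp
  also have "\<dots> = hsum UNIV (\<lambda>e. if e = [s] then L i j s v else 0)"
  proof (intro arg_cong[of _ _ "hsum UNIV"] ext)
    fix e :: "int list"
    show "(if length e = length [0::nat] \<and> sum_list e = s + int (sum_list [0])
         then fps_const (\<Prod>i<length [0::nat]. of_int (e ! i) gchoose ([0] ! i)) \<odot> L_bracket L (length [0::nat]) v [i] [j] e
         else 0) = (if e = [s] then L i j s v else 0)"
      by (auto simp: L_bracket_def length_Suc_conv hscale_one)
  qed
  also have "\<dots> = L i j s v" by (rule VR_hsum_single)
  finally show ?thesis by (simp add: lplus_prod_def)
qed

text \<open>
  The functional \<open>\<psi>\<close> applied to an entry of \<open>L\<^sup>+\<^sub>1(t) L\<^sup>+\<^sub>2(0)\<close>, a power series in \<open>t\<close>.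
\<close>

definition product_series :: "('n VR \<Rightarrow> complex fps) \<Rightarrow> 'n \<Rightarrow> 'n \<Rightarrow> 'n::{finite,linorder} \<times> 'n \<Rightarrow> complex fls fps"
  where "product_series \<psi> k l b = Abs_fps (\<lambda>n. fps_to_fls (Abs_fps (\<lambda>t.
    fps_nth (\<psi> (lplus (fst b) k t * lplus (snd b) l 0)) n)))"

text \<open>
  This is \<open>L\<^sub>1(t) L\<^sup>+\<^sub>2(0) 1 = R(e\<^sup>t)\<^sup>-\<^sup>1 L\<^sup>+\<^sub>1(t) L\<^sup>+\<^sub>2(0) 1\<close>, tested against a functional.  The expansion of
  \<open>R(e\<^sup>u\<^sup>-\<^sup>v)\<close> in powers of \<open>v\<close> reduces to its constant term.
\<close>

lemma L_lplus:
  assumes L: "L_operator L" and \<psi>: "dual_on UNIV \<psi>"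
  shows "fps_nth (\<psi> (L i k t (lplus j l 0))) n =
    fls_nth (fps_nth (\<Sum>b\<in>UNIV. matrix_inv (R_exp 1) $ (i, j) $ b * product_series \<psi> k l b) n) t"
proof -
  let ?M = "\<lambda>b. matrix_inv (R_exp 1) $ (i, j) $ b"
  define v where "v = (\<lambda>(b, \<alpha>, \<beta>::nat). lplus_dist [fst b, snd b] [k, l] [t - \<alpha>, - int \<beta>])"
  define c where "c = (\<lambda>(b, \<alpha>, \<beta>::nat). if \<beta> = 0 \<and> \<alpha> \<le> t then expand_diff (?M b) \<alpha> 0 else 0)"
  have ed: "fps_nth (expand_diff f \<alpha> 0) n = fls_nth (fps_nth f n) \<alpha>" for f \<alpha> n
    by (simp add: expand_diff_def)
  have "L i k t (lplus_prod [j] [l] [0]) =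
       foldr (\<lambda>k. act_R (matrix_inv (R_exp 1)) 0 k) (rev [1..<Suc (length [0::nat])]) lplus_dist
         (i # [j]) (k # [l]) (t # map int [0])"
    by (rule L[unfolded L_operator_def, THEN conjunct2, THEN conjunct2, rule_format]) simp
  then have "L i k t (lplus j l 0) = hsum UNIV (\<lambda>((x, y), \<alpha>, \<beta>).
      expand_diff (?M (x, y)) \<alpha> \<beta> \<odot> lplus_dist [x, y] [k, l] [t - \<alpha>, - int \<beta>])"
    by (simp add: lplus_prod_def act_R_def)
  also have "\<dots> = hsum UNIV (\<lambda>i. c i \<odot> v i)"
    by (intro arg_cong[of _ _ "hsum UNIV"] ext)
      (auto simp: c_def v_def lplus_dist_def split: prod.splits)
  finally have Lh: "L i k t (lplus j l 0) = hsum UNIV (\<lambda>i. c i \<odot> v i)" .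
  define T where "T b n = (\<Union>m\<in>{0..n}. {fls_subdegree (fps_nth (?M b) m)..t})" for b n
  define S where "S n = (SIGMA b : (UNIV :: ('a \<times> 'a) set). T b n \<times> {0::nat})" for n
  have finT: "finite (T b n)" for b n by (simp add: T_def)
  have finS: "finite (S n)" for n unfolding S_def by (intro finite_SigmaI) (auto simp: finT)
  have c0: "fps_nth (c (b, \<alpha>, \<beta>)) m = 0" if "(b, \<alpha>, \<beta>) \<notin> S n" "m \<le> n" for b \<alpha> \<beta> m n
  proof (cases "\<beta> = 0 \<and> \<alpha> \<le> t")
    case True
    then have "\<alpha> < fls_subdegree (fps_nth (?M b) m)"
      using that by (auto simp: S_def T_def not_le)
    then show ?thesis using True by (simp add: c_def ed)
  qed (auto simp: c_def)
  have c0': "fps_nth (c i) m = 0" if "i \<notin> S n" "m \<le> n" for i m n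
    using c0[of "fst i" "fst (snd i)" "snd (snd i)"] that by simp
  have fin: "finite {i. fps_nth (c i) n \<noteq> 0}" for n
    by (rule finite_subset[OF _ finS[of n]]) (use c0'[OF _ order.refl] in blast)
  have N: "fls_nth (fps_nth (product_series \<psi> k l b) m) (t - \<alpha>) = fps_nth (\<psi> (v (b, \<alpha>, 0))) m" if "\<alpha> \<le> t" for b m \<alpha>
    using that by (simp add: product_series_def v_def lplus_dist_def lplus_prod_def)
  have "fps_nth (\<psi> (L i k t (lplus j l 0))) n = (\<Sum>i\<in>S n. fps_nth (\<psi> (c i \<odot> v i)) n)"
    unfolding Lh
  proof (rule hsums_dual[OF hmod.subspace_UNIV \<psi> VR_hsums_scaled[OF fin] finS])
    fix i assume "i \<notin> S n"
    then have "fps_nth (c i) m = 0" if "m \<le> n" for m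
      using c0' that by blast
    then show "fps_nth (\<psi> (c i \<odot> v i)) n = 0"
      by (simp add: dual_on_scale[OF \<psi>] fps_mult_nth)
  qed
  also have "\<dots> = (\<Sum>b\<in>UNIV. \<Sum>\<alpha>\<in>T b n. fps_nth (\<psi> (c (b, \<alpha>, 0) \<odot> v (b, \<alpha>, 0))) n)"
    by (subst sum.Sigma, simp, simp add: finT,
        rule sum.reindex_bij_witness[of _ "\<lambda>(b, \<alpha>). (b, \<alpha>, 0)" "\<lambda>(b, \<alpha>, \<beta>). (b, \<alpha>)"])
      (auto simp: S_def)
  also have "\<dots> = (\<Sum>b\<in>UNIV. \<Sum>\<alpha>\<in>T b n. \<Sum>m=0..n. fls_nth (fps_nth (?M b) m) \<alpha> *
      fls_nth (fps_nth (product_series \<psi> k l b) (n - m)) (t - \<alpha>))"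
    by (intro sum.cong refl) (auto simp: dual_on_scale[OF \<psi>] fps_mult_nth c_def ed N T_def)
  also have "\<dots> = (\<Sum>b\<in>UNIV. \<Sum>m=0..n. \<Sum>\<alpha>\<in>T b n. fls_nth (fps_nth (?M b) m) \<alpha> *
      fls_nth (fps_nth (product_series \<psi> k l b) (n - m)) (t - \<alpha>))"
    by (rule sum.cong[OF refl], rule sum.swap)
  also have "\<dots> = (\<Sum>b\<in>UNIV. \<Sum>m=0..n. fls_nth (fps_nth (?M b) m * fps_nth (product_series \<psi> k l b) (n - m)) t)"
  proof (intro sum.cong refl fls_times_nth_superset[symmetric] finT)
    fix b m \<alpha> assume "m \<in> {0..n}" "\<alpha> \<notin> T b n"
    then have "\<alpha> < fls_subdegree (fps_nth (?M b) m) \<or> t - \<alpha> < 0" by (auto simp: T_def not_le)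
    then show "fls_nth (fps_nth (?M b) m) \<alpha> * fls_nth (fps_nth (product_series \<psi> k l b) (n - m)) (t - \<alpha>) = 0"
      by (auto simp: product_series_def)
  qed
  finally show ?thesis by (simp add: fps_sum_nth fls_nth_sum fps_mult_nth)
qed

section \<open>Weak associativity and absence of poles\<close>

text \<open>
  The subring \<open>\<complex>[[x]][[h]]\<close> of \<open>\<complex>((x))[[h]]\<close>.
\<close>

definition regular :: "complex fls fps \<Rightarrow> bool"
  where "regular F \<longleftrightarrow> (\<forall>n. \<exists>R. fps_nth F n = fps_to_fls R)"

lemma fps_to_fls_sum: "fps_to_fls (sum f A) = (\<Sum>i\<in>A. fps_to_fls (f i))"
  by (induction A rule: infinite_finite_induct) simp_all

lemma regularI: "(\<And>n. fps_nth F n = fps_to_fls (f n)) \<Longrightarrow> regular F"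
  unfolding regular_def by blast

lemma regularE:
  assumes "regular F"
  obtains f where "\<And>n. fps_nth F n = fps_to_fls (f n)"
proof -
  from choice[OF assms[unfolded regular_def]] obtain f where "\<forall>n. fps_nth F n = fps_to_fls (f n)" ..
  then show ?thesis using that by blast
qed

lemma regular_mult:
  assumes "regular F" "regular G"
  shows "regular (F * G)"
proof -
  obtain f where "\<And>n. fps_nth F n = fps_to_fls (f n)" using regularE[OF assms(1)] by blast
  moreover obtain g where "\<And>n. fps_nth G n = fps_to_fls (g n)" using regularE[OF assms(2)] by blast
  ultimately show ?thesis
    by (intro regularI[of _ "\<lambda>n. \<Sum>i=0..n. f i * g (n - i)"])
      (simp add: fps_mult_nth fps_to_fls_sum fls_times_fps_to_fls)
qed

lemma regular_diff:
  assumes "regular F" "regular G"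
  shows "regular (F - G)"
proof -
  obtain f where "\<And>n. fps_nth F n = fps_to_fls (f n)" using regularE[OF assms(1)] by blast
  moreover obtain g where "\<And>n. fps_nth G n = fps_to_fls (g n)" using regularE[OF assms(2)] by blast
  ultimately show ?thesis by (intro regularI[of _ "\<lambda>n. f n - g n"]) simp
qed

lemma regular_1: "regular 1"
  by (rule regularI[of _ "\<lambda>n. if n = 0 then 1 else 0"]) (simp add: fps_one_nth)

lemma regular_uminus: "regular F \<Longrightarrow> regular (- F)"
  using regular_diff[OF regular_diff[OF regular_1 regular_1]] by simp

lemma regular_scalar: "regular (fls_scalar c)"
  by (rule regularI[of _ "\<lambda>n. fps_const (fps_nth c n)"]) simp

lemma regular_exp: "regular exp_fls"
  by (rule regularI[of _ "\<lambda>n. if n = 0 then fps_exp 1 else 0"]) (simp add: exp_fls_def)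

lemma regular_product_series: "regular (product_series \<psi> k l b)"
  unfolding product_series_def by (rule regularI) (rule fps_nth_Abs_fps)

lemma regular_E: "regular (E_fls c)"
  by (simp add: E_fls_def regular_scalar)

text \<open>
  All poles of \<open>R(e\<^sup>x)\<^sup>-\<^sup>1\<close> at \<open>x = 0\<close> are cancelled by R-bar, since the product is the scalar
  \<open>g\<^sup>-\<^sup>1 = - e\<^sup>-\<^sup>h\<^sup>/\<^sup>2 (1 - e\<^sup>x\<^sup>+\<^sup>h)\<close>, up to the normalization of R-bar by \<open>e\<^sup>-\<^sup>h\<^sup>/\<^sup>2\<close>.
\<close>

lemma Rbar_L_regular:
  fixes a :: "'n::{finite,linorder} \<times> 'n"
  shows "regular (\<Sum>e\<in>UNIV. Rbar_at exp_fls a e * (\<Sum>b\<in>UNIV. matrix_inv (R_exp 1) $ e $ b * product_series \<psi> k l b))"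
proof -
  let ?M = "matrix_inv (R_exp 1) :: complex fls fps^('n \<times> 'n)^('n \<times> 'n)"
  have "(\<Sum>e\<in>UNIV. Rbar_at exp_fls a e * (\<Sum>b\<in>UNIV. ?M $ e $ b * product_series \<psi> k l b)) =
      (\<Sum>e\<in>UNIV. \<Sum>b\<in>UNIV. E_fls (- 1/2) * (Rbar_entry E_fls exp_fls 1 a e * ?M $ e $ b) * product_series \<psi> k l b)"
    unfolding Rbar_at_def Rbar_coeff_fls by (simp add: sum_distrib_left mult.assoc)
  also have "\<dots> = (\<Sum>b\<in>UNIV. \<Sum>e\<in>UNIV. E_fls (- 1/2) * (Rbar_entry E_fls exp_fls 1 a e * ?M $ e $ b) * product_series \<psi> k l b)"
    by (rule sum.swap)
  also have "\<dots> = (\<Sum>b\<in>UNIV. E_fls (- 1/2) * (if a = b then gfactor_inv E_fls exp_fls else 0) * product_series \<psi> k l b)"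
    by (simp only: sum_distrib_left[symmetric] sum_distrib_right[symmetric] R_exp_inverse)
  also have "\<dots> = E_fls (- 1/2) * gfactor_inv E_fls exp_fls * product_series \<psi> k l a"
    by (simp add: if_distrib[of "(*) _"] if_distrib[of "\<lambda>x. x * _"] cong: if_cong)
  finally show ?thesis
    by (simp only: gfactor_inv_def)
      (intro regular_mult regular_diff regular_uminus regular_1 regular_exp regular_E regular_product_series)
qed

context field_action begin

text \<open>
  On the line \<open>p + q = s\<close>, the product with \<open>(z\<^sub>1 - z\<^sub>2)\<^sup>r\<close> depends on the line \<open>p + q = s - r\<close> of the factor.
\<close>

lemma dual_mult_diff:
  assumes \<Lambda>: "dual_on W \<Lambda>" and A: "\<And>p q. A p q \<in> W"
  shows "fps_nth (\<Lambda> (mult_diff r A p (s - p))) n = shift_diffs r (\<lambda>p. fps_nth (\<Lambda> (A p (s - int r - p))) n) p"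
proof -
  have "fps_nth (\<Lambda> (mult_diff r A p (s - p))) n =
      (\<Sum>i\<le>r. fps_nth (((- 1) ^ i * of_nat (r choose i)) * \<Lambda> (A (p - int (r - i)) (s - p - int i))) n)"
    unfolding mult_diff_def
    by (simp add: dual_on_sum[OF \<Lambda> subspace] dual_on_scale[OF \<Lambda>] A hmod.subspace_scale[OF subspace] fps_sum_nth)
  also have "\<dots> = (\<Sum>i\<le>r. (- 1) ^ i * of_nat (r choose i) * fps_nth (\<Lambda> (A (p - int (r - i)) (s - int r - (p - int (r - i))))) n)"
  proof (rule sum.cong[OF refl])
    fix i assume "i \<in> {..r}"
    then have "s - p - int i = s - int r - (p - int (r - i))" by (simp add: of_nat_diff)
    moreover have "((- 1) ^ i * of_nat (r choose i) :: complex fps) = fps_const ((- 1) ^ i * of_nat (r choose i))"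
      by (simp add: fps_of_nat flip: fps_const_mult fps_const_power fps_const_neg)
    ultimately show "fps_nth (((- 1) ^ i * of_nat (r choose i)) * \<Lambda> (A (p - int (r - i)) (s - p - int i))) n =
        (- 1) ^ i * of_nat (r choose i) * fps_nth (\<Lambda> (A (p - int (r - i)) (s - int r - (p - int (r - i))))) n"
      by (simp only: fps_mult_left_const_nth)
  qed
  finally show ?thesis by (simp add: shift_diffs_eq)
qed

lemma mult_diff_in:
  assumes "\<And>p q. A p q \<in> W"
  shows "mult_diff r A p q \<in> W"
  unfolding mult_diff_def
  by (rule hmod.subspace_sum[OF subspace], rule hmod.subspace_scale[OF subspace], rule assms)

text \<open>
  For the exponent \<open>r\<close>, weak associativity holds modulo \<open>h\<^sup>n\<^sup>+\<^sup>1\<close>, as an identity between Laurent series in \<open>z\<^sub>0\<close> for each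
  coefficient of \<open>h\<close>: in the applications \<open>Z s b\<close> is the coefficient of \<open>h\<^sup>b z\<^sub>2\<^sup>s\<close> in \<open>Y\<^sub>W(Y(u,z\<^sub>0)v, z\<^sub>2) w\<close>,
  tested against \<open>\<Lambda>\<close>.
\<close>

definition weak_assoc_order :: "('w \<Rightarrow> complex fps) \<Rightarrow> 'w \<Rightarrow> 'n VR \<Rightarrow> 'n VR \<Rightarrow> nat \<Rightarrow> (int \<Rightarrow> nat \<Rightarrow> complex fls) \<Rightarrow> nat \<Rightarrow> bool"
  where "weak_assoc_order \<Lambda> w u v n Z r \<longleftrightarrow> (\<forall>s b. b \<le> n \<longrightarrow>
    (let \<beta> = shift_diffs r (\<lambda>p. fps_nth (\<Lambda> (YW u p (YW v (s - p) w))) b) in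
      finite {p. \<beta> p \<noteq> 0} \<and> fps_to_fls (exp_sum \<beta>) = fps_to_fls ((fps_exp 1 - 1) ^ r) * Z s b))"

lemma weak_assoc_order_Suc:
  assumes "weak_assoc_order \<Lambda> w u v n Z r"
  shows "weak_assoc_order \<Lambda> w u v n Z (Suc r)"
  unfolding weak_assoc_order_def Let_def
proof (intro allI impI)
  fix s b assume "b \<le> n"
  let ?f = "\<lambda>p. fps_nth (\<Lambda> (YW u p (YW v (s - p) w))) b"
  have fin: "finite {p. shift_diffs r ?f p \<noteq> 0}"
    and eq: "fps_to_fls (exp_sum (shift_diffs r ?f)) = fps_to_fls ((fps_exp 1 - 1) ^ r) * Z s b"
    using assms \<open>b \<le> n\<close> unfolding weak_assoc_order_def Let_def by blast+
  have "fps_to_fls (exp_sum (shift_diff (shift_diffs r ?f))) =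
      fps_to_fls (fps_exp 1 - 1) * (fps_to_fls ((fps_exp 1 - 1) ^ r) * Z s b)"
    by (simp only: exp_sum_shift_diff(2)[OF fin] fls_times_fps_to_fls eq)
  also have "\<dots> = fps_to_fls ((fps_exp 1 - 1) ^ Suc r) * Z s b"
    by (simp only: power_Suc fls_times_fps_to_fls mult.assoc)
  finally show "finite {p. shift_diffs (Suc r) ?f p \<noteq> 0} \<and>
      fps_to_fls (exp_sum (shift_diffs (Suc r) ?f)) = fps_to_fls ((fps_exp 1 - 1) ^ Suc r) * Z s b"
    using exp_sum_shift_diff(1)[OF fin] by (simp only: funpow.simps o_apply simp_thms)
qed

text \<open>
  Both sides get the factor \<open>e\<^sup>z - 1\<close> when \<open>r\<close> grows, so one exponent serves any finite number of pairs \<open>(u, v)\<close>.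
\<close>

lemma weak_assoc_order_mono:
  assumes "weak_assoc_order \<Lambda> w u v n Z r" "r \<le> r'"
  shows "weak_assoc_order \<Lambda> w u v n Z r'"
  using assms(2,1) by (induction rule: dec_induct) (auto intro: weak_assoc_order_Suc)

text \<open>
  Comparison of the coefficients of \<open>z\<^sub>0\<^sup>t z\<^sub>2\<^sup>s\<^sup>+\<^sup>r\<close>: the truncated sum contributes the coefficient of \<open>z\<^sub>0\<^sup>t\<close> in
  \<open>\<Sum> \<beta>(p) e\<^sup>p\<^sup>z\<close>, taken over a bounded range of \<open>p\<close>, and the other term a coefficient of a product of Laurent series.
\<close>

lemma weak_associativity_order:
  assumes WA: "weak_associativity Y W YW" and Y: "\<And>u v. laurent_h UNIV (\<lambda>s. Y u s v)"
    and w: "w \<in> W" and \<Lambda>: "dual_on W \<Lambda>"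
    and Z: "\<And>s b t. fls_nth (Z s b) t = fps_nth (\<Lambda> (YW (Y u t v) s w)) b"
  shows "\<exists>r. weak_assoc_order \<Lambda> w u v n Z r"
proof -
  let ?K = "Suc n"
  obtain r where r: "let A = mult_diff r (\<lambda>p q. YW u p (YW v q w)) in
      (\<exists>M. \<forall>p q. p < M \<or> q < M \<longrightarrow> A p q \<in> hpow ?K W) \<and>
      (\<forall>t s. (if t < 0 then 0
               else trunc_sum ?K W (\<lambda>p. fps_const (of_int p ^ nat t / fact (nat t)) \<odot> A p (s - p)))
             - hsum W (\<lambda>i. fps_const (fps_nth ((fps_exp 1 - 1) ^ r) i) \<odot>
                 YW (Y u (t - int i) v) (s - int r) w)
           \<in> hpow ?K W)"
    using WA w unfolding weak_associativity_def by meson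
  define A where "A = mult_diff r (\<lambda>p q. YW u p (YW v q w))"
  obtain M where M: "\<And>p q. p < M \<or> q < M \<Longrightarrow> A p q \<in> hpow ?K W"
    using r unfolding A_def Let_def by blast
  let ?e = "(fps_exp 1 - 1 :: complex fps) ^ r"
  let ?f = "\<lambda>s t i. fps_const (fps_nth ?e i) \<odot> YW (Y u (t - int i) v) s w"
  have sub: "(if t < 0 then 0
               else trunc_sum ?K W (\<lambda>p. fps_const (of_int p ^ nat t / fact (nat t)) \<odot> A p (s + int r - p)))
             - hsum W (?f s t) \<in> hpow ?K W" for s t
    using spec[OF spec[OF conjunct2[OF r[unfolded Let_def]], of t], of "s + int r"]
    unfolding A_def by (simp only: add_diff_cancel_right')
  have AW: "A p q \<in> W" for p q
    unfolding A_def by (rule mult_diff_in) (simp add: YW_in w)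
  have hs: "hsums W (?f s t) (hsum W (?f s t))" for s t
  proof (rule hsums_hsum)
    show "?f s t i \<in> W" for i by (simp add: hmod.subspace_scale[OF subspace] YW_in w)
    fix k
    obtain m where m: "\<And>x. x < m \<Longrightarrow> Y u x v \<in> hpow k UNIV"
      using Y[of u v] unfolding laurent_h_def by blast
    have "?f s t i \<in> hpow k W" if "t - int i < m" for i
      by (intro hmod.subspace_scale[OF subspace_hpow[OF subspace]] YW_hpow_left m w that)
    then have "{i. ?f s t i \<notin> hpow k W} \<subseteq> {..nat (t - m)}" by force
    then show "finite {i. ?f s t i \<notin> hpow k W}" by (rule finite_subset) simp
  qed
  have "weak_assoc_order \<Lambda> w u v n Z r"
    unfolding weak_assoc_order_def Let_def
  proof (intro allI impI)
    fix s b assume "b \<le> n"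
    then have b: "b < ?K" by simp
    let ?\<beta> = "shift_diffs r (\<lambda>p. fps_nth (\<Lambda> (YW u p (YW v (s - p) w))) b)"
    have \<beta>: "?\<beta> p = fps_nth (\<Lambda> (A p (s + int r - p))) b" for p
      unfolding A_def by (subst dual_mult_diff[OF \<Lambda>]) (simp_all add: YW_in w)
    define I where "I = {M..s + int r - M}"
    have I: "A p (s + int r - p) \<in> hpow ?K W" if "p \<notin> I" for p
      by (rule M) (use that in \<open>auto simp: I_def\<close>)
    have \<beta>0: "?\<beta> p = 0" if "p \<notin> I" for p
      unfolding \<beta> by (rule dual_on_hpow[OF \<Lambda> I[OF that] b])
    have finI: "finite I" by (simp add: I_def)
    have "{p. ?\<beta> p \<noteq> 0} \<subseteq> I" using \<beta>0 by blast
    then have fin: "finite {p. ?\<beta> p \<noteq> 0}" using finI by (rule finite_subset)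
    have rhs: "fps_nth (\<Lambda> (hsum W (?f s t))) b = fls_nth (fps_to_fls ?e * Z s b) t" for t
    proof -
      define S where "S = {..nat (t - fls_subdegree (Z s b))}"
      have fi: "fps_nth (\<Lambda> (?f s t i)) b = fps_nth ?e i * fls_nth (Z s b) (t - int i)" for i
        by (simp add: dual_on_scale[OF \<Lambda>] YW_in w Z)
      have "fps_nth (\<Lambda> (hsum W (?f s t))) b = (\<Sum>i\<in>S. fps_nth (\<Lambda> (?f s t i)) b)"
        by (rule hsums_dual[OF subspace \<Lambda> hs]) (auto simp: S_def fi)
      also have "\<dots> = (\<Sum>m\<in>int ` S. fls_nth (fps_to_fls ?e) m * fls_nth (Z s b) (t - m))"
        by (subst sum.reindex) (auto simp: fi)
      also have "\<dots> = fls_nth (fps_to_fls ?e * Z s b) t"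
      proof (rule fls_times_nth_superset[symmetric])
        fix m assume m: "m \<notin> int ` S"
        show "fls_nth (fps_to_fls ?e) m * fls_nth (Z s b) (t - m) = 0"
        proof (cases "m < 0")
          case False
          then have "m = int (nat m)" by simp
          then have "nat m \<notin> S" using m by blast
          then show ?thesis by (simp add: S_def)
        qed simp
      qed (simp add: S_def)
      finally show ?thesis .
    qed
    have "fls_nth (fps_to_fls (exp_sum ?\<beta>)) t = fls_nth (fps_to_fls ?e * Z s b) t" for t
    proof -
      let ?g = "\<lambda>p. fps_const (of_int p ^ nat t / fact (nat t)) \<odot> A p (s + int r - p)"
      have gW: "?g p \<in> W" for p by (rule hmod.subspace_scale[OF subspace AW])
      have hsW: "hsum W (?f s t) \<in> W" using hs by (simp add: hsums_def)
      have tW: "trunc_sum ?K W ?g \<in> W" unfolding trunc_sum_def by (rule hmod.subspace_sum[OF subspace gW])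
      show ?thesis
      proof (cases "t < 0")
        case True
        then have "fps_nth (\<Lambda> (0 - hsum W (?f s t))) b = 0"
          using dual_on_hpow[OF \<Lambda> sub[of t s] b] by simp
        moreover have "\<Lambda> (0 - hsum W (?f s t)) = 0 - \<Lambda> (hsum W (?f s t))"
          using dual_on_diff[OF \<Lambda> subspace hmod.subspace_0[OF subspace] hsW]
          unfolding dual_on_0[OF \<Lambda> subspace] .
        ultimately have "fps_nth (\<Lambda> (hsum W (?f s t))) b = 0" by simp
        then show ?thesis using True by (simp add: rhs)
      next
        case False
        have gI: "?g p \<in> hpow ?K W" if "p \<notin> I" for p
          by (rule hmod.subspace_scale[OF subspace_hpow[OF subspace] I[OF that]])
        let ?T = "{p. ?g p \<notin> hpow ?K W}"
        have T: "?T \<subseteq> I"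
        proof
          fix p assume "p \<in> ?T"
          then show "p \<in> I" using gI[of p] by (cases "p \<in> I") simp_all
        qed
        have "fps_nth (\<Lambda> (trunc_sum ?K W ?g - hsum W (?f s t))) b = 0"
          using dual_on_hpow[OF \<Lambda> sub[of t s] b] False by simp
        then have "fps_nth (\<Lambda> (hsum W (?f s t))) b = fps_nth (\<Lambda> (trunc_sum ?K W ?g)) b"
          by (simp add: dual_on_diff[OF \<Lambda> subspace tW hsW])
        also have "\<dots> = (\<Sum>p\<in>?T. fps_nth (\<Lambda> (?g p)) b)"
          unfolding trunc_sum_def by (simp add: dual_on_sum[OF \<Lambda> subspace gW] fps_sum_nth)
        also have "\<dots> = (\<Sum>p\<in>I. fps_nth (\<Lambda> (?g p)) b)"
        proof (rule sum.mono_neutral_left[OF finI T])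
          show "\<forall>p\<in>I - ?T. fps_nth (\<Lambda> (?g p)) b = 0" using dual_on_hpow[OF \<Lambda> _ b] by blast
        qed
        also have "\<dots> = (\<Sum>p\<in>I. of_int p ^ nat t / fact (nat t) * ?\<beta> p)"
          by (simp add: dual_on_scale[OF \<Lambda> AW] \<beta>)
        also have "\<dots> = fps_nth (exp_sum ?\<beta>) (nat t)"
        proof -
          have "exp_sum ?\<beta> = (\<Sum>p\<in>I. fps_const (?\<beta> p) * fps_exp (of_int p))"
            by (rule exp_sum_superset[OF finI]) (rule \<beta>0)
          then show ?thesis by (simp add: fps_sum_nth mult.commute)
        qed
        finally show ?thesis using False by (simp add: rhs)
      qed
    qed
    then have "fps_to_fls (exp_sum ?\<beta>) = fps_to_fls ?e * Z s b" by (rule fls_eqI)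
    with fin show "finite {p. ?\<beta> p \<noteq> 0} \<and> fps_to_fls (exp_sum ?\<beta>) = fps_to_fls ?e * Z s b" by blast
  qed
  then show ?thesis by blast
qed

end

section \<open>The RTT relation\<close>

text \<open>
  The action of a matrix with entries \<open>c\<^sub>0 + c\<^sub>1 x\<close> over \<open>\<complex>[[h]]\<close> on series \<open>\<Sum> B\<^sub>e(p) x\<^sup>p\<close>, for the coefficient of \<open>h\<^sup>n\<close>;
  \<open>B e b p\<close> is the coefficient of \<open>h\<^sup>b\<close> in \<open>B\<^sub>e(p)\<close>.  Both sides of the RTT relation have this form on each line
  \<open>p + q = s\<close>, with \<open>x = z\<^sub>1/z\<^sub>2\<close>.
\<close>

definition first_order_comb :: "('e::finite \<Rightarrow> complex fps) \<Rightarrow> ('e \<Rightarrow> complex fps) \<Rightarrow> ('e \<Rightarrow> nat \<Rightarrow> int \<Rightarrow> complex) \<Rightarrow> nat \<Rightarrow> int \<Rightarrow> complex"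
  where "first_order_comb c\<^sub>0 c\<^sub>1 B n p = (\<Sum>e\<in>UNIV. \<Sum>b=0..n.
    fps_nth (c\<^sub>0 e) (n - b) * B e b p + fps_nth (c\<^sub>1 e) (n - b) * B e b (p - 1))"

lemma first_order_comb_0: "(\<And>e b. b \<le> n \<Longrightarrow> B e b p = 0) \<Longrightarrow> (\<And>e b. b \<le> n \<Longrightarrow> B e b (p - 1) = 0) \<Longrightarrow> first_order_comb c\<^sub>0 c\<^sub>1 B n p = 0"
  unfolding first_order_comb_def by (intro sum.neutral ballI) simp

lemma shift_diffs_first_order_comb:
  "shift_diffs r (first_order_comb c\<^sub>0 c\<^sub>1 B n) p = first_order_comb c\<^sub>0 c\<^sub>1 (\<lambda>e b. shift_diffs r (B e b)) n p"
proof (induction r arbitrary: p)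
  case (Suc r)
  have "shift_diffs (Suc r) (first_order_comb c\<^sub>0 c\<^sub>1 B n) p =
      first_order_comb c\<^sub>0 c\<^sub>1 (\<lambda>e b. shift_diffs r (B e b)) n (p - 1) - first_order_comb c\<^sub>0 c\<^sub>1 (\<lambda>e b. shift_diffs r (B e b)) n p"
    unfolding funpow.simps o_apply by (subst shift_diff_def) (simp only: Suc)
  also have "\<dots> = first_order_comb c\<^sub>0 c\<^sub>1 (\<lambda>e b. shift_diffs (Suc r) (B e b)) n p"
  proof -
    have step: "shift_diffs (Suc r) h p = shift_diffs r h (p - 1) - shift_diffs r h p" for h p
      by (simp only: funpow.simps o_apply) (rule shift_diff_def)
    show ?thesis
      unfolding first_order_comb_def sum_subtractf[symmetric] step by (simp add: algebra_simps)
  qed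
  finally show ?case .
qed simp

lemma first_order_comb_diff: "first_order_comb c\<^sub>0 c\<^sub>1 B n p - first_order_comb c\<^sub>0 c\<^sub>1 C n p = first_order_comb c\<^sub>0 c\<^sub>1 (\<lambda>e b p. B e b p - C e b p) n p"
  unfolding first_order_comb_def sum_subtractf[symmetric] by (simp add: algebra_simps)

lemma exp_sum_first_order_comb:
  assumes fin: "\<And>e b. b \<le> n \<Longrightarrow> finite {p. \<beta> e b p \<noteq> 0}"
  shows "finite {p. first_order_comb c\<^sub>0 c\<^sub>1 \<beta> n p \<noteq> 0}"
    "exp_sum (first_order_comb c\<^sub>0 c\<^sub>1 \<beta> n) = (\<Sum>e\<in>UNIV. \<Sum>b=0..n.
      (fps_const (fps_nth (c\<^sub>0 e) (n - b)) + fps_const (fps_nth (c\<^sub>1 e) (n - b)) * fps_exp 1) * exp_sum (\<beta> e b))"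
proof -
  let ?S = "(\<Union>e\<in>UNIV. \<Union>b\<in>{0..n}. {p. \<beta> e b p \<noteq> 0})"
  let ?T = "(\<Union>e\<in>UNIV. \<Union>b\<in>{0..n}. {p. \<beta> e b (p - 1) \<noteq> 0})"
  have "finite (?S \<union> ?T)"
    using fin finite_shift_support[OF fin, of _ _ 1] by auto
  moreover have "{p. first_order_comb c\<^sub>0 c\<^sub>1 \<beta> n p \<noteq> 0} \<subseteq> ?S \<union> ?T"
    using first_order_comb_0[of n \<beta> _ c\<^sub>0 c\<^sub>1] by fastforce
  ultimately show "finite {p. first_order_comb c\<^sub>0 c\<^sub>1 \<beta> n p \<noteq> 0}" using finite_subset by blast
  let ?A = "(UNIV :: 'a set) \<times> {0..n}"
  let ?h = "\<lambda>p. \<Sum>x\<in>?A. fps_nth (c\<^sub>0 (fst x)) (n - snd x) * \<beta> (fst x) (snd x) p"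
  let ?h' = "\<lambda>p. \<Sum>x\<in>?A. - fps_nth (c\<^sub>1 (fst x)) (n - snd x) * \<beta> (fst x) (snd x) (p - 1)"
  have finA: "finite ?A" by simp
  have f: "finite {p. \<beta> (fst x) (snd x) p \<noteq> 0}" if "x \<in> ?A" for x using fin that by auto
  have f': "finite {p. \<beta> (fst x) (snd x) (p - 1) \<noteq> 0}" if "x \<in> ?A" for x
    by (rule finite_shift_support[OF f[OF that]])
  have "finite {p. ?h p \<noteq> 0}"
    by (rule finite_subset[of _ "\<Union>x\<in>?A. {p. \<beta> (fst x) (snd x) p \<noteq> 0}"])
      (use f in \<open>auto intro: sum.neutral simp del: sum.cartesian_product' elim!: sum.not_neutral_contains_not_neutral\<close>)
  moreover have "finite {p. ?h' p \<noteq> 0}"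
    by (rule finite_subset[of _ "\<Union>x\<in>?A. {p. \<beta> (fst x) (snd x) (p - 1) \<noteq> 0}"])
      (use f' in \<open>auto intro: sum.neutral elim!: sum.not_neutral_contains_not_neutral\<close>)
  ultimately have "exp_sum (\<lambda>p. ?h p - ?h' p) = exp_sum ?h - exp_sum ?h'"
    by (rule exp_sum_diff)
  also have "(\<lambda>p. ?h p - ?h' p) = first_order_comb c\<^sub>0 c\<^sub>1 \<beta> n"
    unfolding first_order_comb_def sum.cartesian_product by (simp add: split_def sum_subtractf[symmetric])
  also have "exp_sum ?h = (\<Sum>x\<in>?A. fps_const (fps_nth (c\<^sub>0 (fst x)) (n - snd x)) * exp_sum (\<beta> (fst x) (snd x)))"
    by (rule exp_sum_lincomb[OF finA f])
  also have "exp_sum ?h' = (\<Sum>x\<in>?A. fps_const (- fps_nth (c\<^sub>1 (fst x)) (n - snd x)) * exp_sum (\<lambda>p. \<beta> (fst x) (snd x) (p - 1)))"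
    by (rule exp_sum_lincomb[OF finA f'])
  also have "\<dots> = (\<Sum>x\<in>?A. fps_const (- fps_nth (c\<^sub>1 (fst x)) (n - snd x)) * (fps_exp 1 * exp_sum (\<beta> (fst x) (snd x))))"
    using exp_sum_shift[OF f, of _ 1] by (intro sum.cong refl) simp
  finally show "exp_sum (first_order_comb c\<^sub>0 c\<^sub>1 \<beta> n) = (\<Sum>e\<in>UNIV. \<Sum>b=0..n.
      (fps_const (fps_nth (c\<^sub>0 e) (n - b)) + fps_const (fps_nth (c\<^sub>1 e) (n - b)) * fps_exp 1) * exp_sum (\<beta> e b))"
    unfolding sum.cartesian_product
    by (simp add: split_def sum_subtractf[symmetric] algebra_simps flip: fps_const_neg)
qed

text \<open>
  The variable of \<open>\<complex>((y))\<close> is \<open>y = z\<^sub>2/z\<^sub>1\<close>, so \<open>x = z\<^sub>1/z\<^sub>2\<close> acts as \<open>y\<^sup>-\<^sup>1\<close>, and the coefficient of \<open>y\<^sup>s\<^sup>-\<^sup>p\<close> belongs to \<open>z\<^sub>1\<^sup>p z\<^sub>2\<^sup>s\<^sup>-\<^sup>p\<close>.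
\<close>

lemma first_order_X_inv_nth:
  "fls_nth (fps_nth (\<Sum>e\<in>UNIV. (fls_scalar (c\<^sub>0 e) + fls_scalar (c\<^sub>1 e) * fps_const fls_X_inv) * F e) n) (s - p) =
    first_order_comb c\<^sub>0 c\<^sub>1 (\<lambda>e b p. fls_nth (fps_nth (F e) b) (s - p)) n p"
proof -
  have "fls_nth (fps_nth (\<Sum>e\<in>UNIV. (fls_scalar (c\<^sub>0 e) + fls_scalar (c\<^sub>1 e) * fps_const fls_X_inv) * F e) n) (s - p) =
      (\<Sum>e\<in>UNIV. fls_nth (fps_nth (F e * (fls_scalar (c\<^sub>0 e) + fls_scalar (c\<^sub>1 e) * fps_const fls_X_inv)) n) (s - p))"
    by (simp add: fps_sum_nth fls_nth_sum mult.commute)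
  also have "\<dots> = first_order_comb c\<^sub>0 c\<^sub>1 (\<lambda>e b p. fls_nth (fps_nth (F e) b) (s - p)) n p"
    unfolding first_order_comb_def
  proof (rule sum.cong[OF refl])
    fix e
    have entry: "fps_nth (fls_scalar (c\<^sub>0 e) + fls_scalar (c\<^sub>1 e) * fps_const fls_X_inv) m =
        fls_const (fps_nth (c\<^sub>0 e) m) + fls_X_inv * fls_const (fps_nth (c\<^sub>1 e) m)" for m
      by (simp add: mult.commute)
    have prod: "fls_nth (G * (fls_const x + fls_X_inv * fls_const y)) (s - p) =
        x * fls_nth G (s - p) + y * fls_nth G (s - (p - 1))" for G :: "complex fls" and x y
    proof -
      have "G * (fls_const x + fls_X_inv * fls_const y) = fls_const x * G + fls_const y * (fls_X_inv * G)"
        by (simp only: algebra_simps)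
      then show ?thesis by (simp add: fls_X_inv_times_conv_shift(1) algebra_simps)
    qed
    show "fls_nth (fps_nth (F e * (fls_scalar (c\<^sub>0 e) + fls_scalar (c\<^sub>1 e) * fps_const fls_X_inv)) n) (s - p) =
      (\<Sum>b=0..n. fps_nth (c\<^sub>0 e) (n - b) * fls_nth (fps_nth (F e) b) (s - p) +
        fps_nth (c\<^sub>1 e) (n - b) * fls_nth (fps_nth (F e) b) (s - (p - 1)))"
      unfolding fps_mult_nth[of "F e"] entry fls_nth_sum prod ..
  qed
  finally show ?thesis .
qed

context field_action begin

lemma dual_first_order_comb:
  assumes \<Lambda>: "dual_on W \<Lambda>" and X: "\<And>e p. X e p \<in> W"
  shows "fps_nth (\<Lambda> (\<Sum>e\<in>UNIV. c\<^sub>0 e \<odot> X e p + c\<^sub>1 e \<odot> X e (p - 1))) n =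
    first_order_comb c\<^sub>0 c\<^sub>1 (\<lambda>e b p. fps_nth (\<Lambda> (X e p)) b) n p"
proof -
  note S = hmod.subspace_scale[OF subspace X]
  have "\<Lambda> (\<Sum>e\<in>UNIV. c\<^sub>0 e \<odot> X e p + c\<^sub>1 e \<odot> X e (p - 1)) =
      (\<Sum>e\<in>UNIV. \<Lambda> (X e p) * c\<^sub>0 e + \<Lambda> (X e (p - 1)) * c\<^sub>1 e)"
    by (simp add: dual_on_sum[OF \<Lambda> subspace] hmod.subspace_add[OF subspace] S dual_on_add[OF \<Lambda>]
        dual_on_scale[OF \<Lambda>] X mult.commute)
  then show ?thesis
    by (simp only: fps_sum_nth fps_add_nth fps_mult_nth first_order_comb_def sum.distrib mult.commute[of "fps_nth (\<Lambda> _) _"])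
qed

definition T :: "'n \<Rightarrow> 'n \<Rightarrow> int \<Rightarrow> 'w \<Rightarrow> 'w"
  where "T i j = YW (lplus i j 0)"

text \<open>
  The coefficients vanish for large \<open>p\<close> because \<open>T\<^sub>2(z\<^sub>2) w\<close> is bounded below.  After multiplication with a large power of
  \<open>z\<^sub>1 - z\<^sub>2\<close> and the substitution \<open>z\<^sub>1 = z\<^sub>2 e\<^sup>z\<close>, weak associativity expresses them by
  R-bar times \<open>Y(L\<^sup>+(0)1, z) L\<^sup>+(0)1\<close>, which has no pole.
\<close>

lemma left_side_finite:
  fixes a :: "'n \<times> 'n" and k l :: 'n and s :: int
  assumes L: "L_operator L" and Y: "vertex_operator_map L Y" and WA: "weak_associativity Y W YW"
    and w: "w \<in> W" and \<Lambda>: "dual_on W \<Lambda>"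
  defines "B \<equiv> \<lambda>e b p. fps_nth (\<Lambda> (T (fst e) k p (T (snd e) l (s - p) w))) b"
  shows "finite {p. first_order_comb (Rbar_coeff 0 a) (Rbar_coeff 1 a) B n p \<noteq> 0}"
proof -
  let ?f = "first_order_comb (Rbar_coeff 0 a) (Rbar_coeff 1 a) B n"
  define Z where "Z s e = (\<Sum>b\<in>UNIV. matrix_inv (R_exp 1) $ e $ b * product_series (\<lambda>v. \<Lambda> (YW v s w)) k l b)"
    for s and e :: "'n \<times> 'n"
  have Zt: "fls_nth (fps_nth (Z s e) b) t = fps_nth (\<Lambda> (YW (Y (lplus (fst e) k 0) t (lplus (snd e) l 0)) s w)) b"
    for s e b t
    using L_lplus[OF L dual_on_YW[OF \<Lambda> w, of s], where i = "fst e" and k = k and t = t and j = "snd e" and l = l and n = b]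
    by (simp add: Z_def Y_lplus[OF Y])
  have laurent: "\<And>u v. laurent_h UNIV (\<lambda>s. Y u s v)"
    using Y unfolding vertex_operator_map_def by blast
  have "\<exists>r. weak_assoc_order \<Lambda> w (lplus (fst e) k 0) (lplus (snd e) l 0) n (\<lambda>s. fps_nth (Z s e)) r" for e
    by (rule weak_associativity_order[OF WA laurent w \<Lambda> Zt])
  then obtain R where R: "\<And>e. weak_assoc_order \<Lambda> w (lplus (fst e) k 0) (lplus (snd e) l 0) n (\<lambda>s. fps_nth (Z s e)) (R e)"
    by metis
  \<comment> \<open>There are finitely many matrix indices, so a common exponent exists.\<close>
  define r where "r = Max (range R)"
  have "weak_assoc_order \<Lambda> w (lplus (fst e) k 0) (lplus (snd e) l 0) n (\<lambda>s. fps_nth (Z s e)) r" for e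
    by (rule weak_assoc_order_mono[OF R]) (simp add: r_def)
  then have fin: "finite {p. shift_diffs r (B e b) p \<noteq> 0}"
    and eq: "fps_to_fls (exp_sum (shift_diffs r (B e b))) = fps_to_fls ((fps_exp 1 - 1) ^ r) * fps_nth (Z s e) b"
    if "b \<le> n" for e b
    using that unfolding weak_assoc_order_def Let_def B_def T_def by blast+
  let ?c = "first_order_comb (Rbar_coeff 0 a) (Rbar_coeff 1 a) (\<lambda>e b. shift_diffs r (B e b)) n"
  have shift: "shift_diffs r ?f = ?c" by (rule ext) (rule shift_diffs_first_order_comb)
  have "fps_to_fls (exp_sum ?c) = (\<Sum>e\<in>UNIV. \<Sum>b=0..n. (fls_const (fps_nth (Rbar_coeff 0 a e) (n - b)) +
      fls_const (fps_nth (Rbar_coeff 1 a e) (n - b)) * fps_to_fls (fps_exp 1)) * (fps_to_fls ((fps_exp 1 - 1) ^ r) * fps_nth (Z s e) b))"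
    by (subst exp_sum_first_order_comb(2)[where \<beta> = "\<lambda>e b. shift_diffs r (B e b)", OF fin], assumption)
      (simp add: fps_to_fls_sum fls_times_fps_to_fls eq)
  also have "\<dots> = fps_to_fls ((fps_exp 1 - 1) ^ r) * fps_nth (\<Sum>e\<in>UNIV. Z s e * Rbar_at exp_fls a e) n"
  proof -
    have entry: "fps_nth (Rbar_at exp_fls a e) m = fls_const (fps_nth (Rbar_coeff 0 a e) m) +
        fls_const (fps_nth (Rbar_coeff 1 a e) m) * fps_to_fls (fps_exp 1)" for e m
      by (simp add: Rbar_at_def exp_fls_def)
    show ?thesis
      unfolding fps_sum_nth fps_mult_nth entry sum_distrib_left by (simp only: mult_ac)
  qed
  also have "(\<Sum>e\<in>UNIV. Z s e * Rbar_at exp_fls a e) = (\<Sum>e\<in>UNIV. Rbar_at exp_fls a e * Z s e)"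
    by (simp only: mult.commute)
  finally have "fps_to_fls (exp_sum ?c) = fps_to_fls ((fps_exp 1 - 1) ^ r) * fps_nth (\<Sum>e\<in>UNIV. Rbar_at exp_fls a e * Z s e) n" .
  moreover obtain reg where "fps_nth (\<Sum>e\<in>UNIV. Rbar_at exp_fls a e * Z s e) n = fps_to_fls reg"
    using Rbar_L_regular[of a "\<lambda>v. \<Lambda> (YW v s w)" k l] unfolding regular_def Z_def by blast
  ultimately have exp: "exp_sum (shift_diffs r ?f) = (fps_exp 1 - 1) ^ r * reg"
    unfolding shift by (simp add: fls_times_fps_to_fls[symmetric])
  have finc: "finite {p. shift_diffs r ?f p \<noteq> 0}"
    unfolding shift by (rule exp_sum_first_order_comb(1)[where \<beta> = "\<lambda>e b. shift_diffs r (B e b)", OF fin])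
  have "\<exists>M. \<forall>p q. q < M \<longrightarrow> fps_nth (\<Lambda> (T (fst e) k p (T (snd e) l q w))) b = 0" for e b
    using product_bounded_below[OF w \<Lambda>] unfolding T_def by metis
  then obtain M where M: "\<And>e b p q. q < M e b \<Longrightarrow> fps_nth (\<Lambda> (T (fst e) k p (T (snd e) l q w))) b = 0"
    by metis
  define m where "m = Min ((\<lambda>(e, b). M e b) ` (UNIV \<times> {0..n}))"
  have m: "m \<le> M e b" if "b \<le> n" for e b
    unfolding m_def by (rule Min_le) (use that in auto)
  have "?f p = 0" if "p > s - m + 1" for p
  proof (rule first_order_comb_0)
    fix e b assume "b \<le> n"
    then show "B e b p = 0" "B e b (p - 1) = 0"
      unfolding B_def using m[of b e] that by (auto intro!: M)
  qed
  from shift_diffs_finite[OF this finc exp] show ?thesis .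
qed

text \<open>
  This is \<open>sigma_exchange\<close>, read off on one line of exponents.
\<close>

lemma left_side_eq_sigma:
  assumes \<sigma>: "sigma_map \<sigma>" and w: "w \<in> W" and \<Lambda>: "dual_on W \<Lambda>"
  shows "first_order_comb (Rbar_coeff 0 (i, j)) (Rbar_coeff 1 (i, j)) (\<lambda>e b p. fps_nth (\<Lambda> (T (fst e) k p (T (snd e) l (s - p) w))) b) n p =
    first_order_comb (\<lambda>e. Rbar_coeff 0 e (k, l)) (\<lambda>e. Rbar_coeff 1 e (k, l))
      (\<lambda>e b p. fps_nth (\<Lambda> (eval_VVz W YW (\<sigma> (lplus i (fst e) 0) (lplus j (snd e) 0)) w p (s - p))) b) n p"
proof -
  let ?D = "diagonal_series \<Lambda> w s"
  have "(\<Sum>c\<in>UNIV. Rbar_at (fps_const fls_X_inv) c (k, l) * vvz_eval ?D (\<sigma> (lplus i (fst c) 0) (lplus j (snd c) 0)))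
    = (\<Sum>b\<in>UNIV. Rbar_at (fps_const fls_X_inv) (i, j) b * ?D (lplus (fst b) k 0, lplus (snd b) l 0))"
    using sigma_exchange[OF \<sigma> bilinear_diagonal_series[OF w \<Lambda>, of s], of "(i, j)" "(k, l)"] by (simp add: mult.commute)
  from arg_cong[OF this, of "\<lambda>F. fls_nth (fps_nth F n) (s - p)"]
  show ?thesis
    unfolding Rbar_at_def first_order_X_inv_nth
    by (simp add: diagonal_series_nth[OF w \<Lambda>] dual_eval_VVz(2)[OF w \<Lambda>] T_def)
qed

text \<open>
  The exponent depends on the vectors and on \<open>n\<close> but not on the line \<open>p + q = s\<close>.
\<close>

lemma sigma_locality_shift_diffs:
  assumes loc: "sigma_locality \<sigma> W YW" and w: "w \<in> W" and \<Lambda>: "dual_on W \<Lambda>"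
  shows "\<exists>r. \<forall>s p b. b \<le> n \<longrightarrow> shift_diffs r (\<lambda>p. fps_nth (\<Lambda> (eval_VVz W YW (\<sigma> u v) w p (s - p))) b
    - fps_nth (\<Lambda> (YW v (s - p) (YW u p w))) b) p = 0"
proof -
  obtain r where r: "\<And>p q. mult_diff r (eval_VVz W YW (\<sigma> u v) w) p q - mult_diff r (\<lambda>p q. YW v q (YW u p w)) p q
      \<in> hpow (Suc n) W"
    using loc w unfolding sigma_locality_def by meson
  have E: "eval_VVz W YW (\<sigma> u v) w p q \<in> W" for p q by (rule dual_eval_VVz(1)[OF w \<Lambda>])
  have A: "YW v q (YW u p w) \<in> W" for p q by (simp add: YW_in w)
  have "shift_diffs r (\<lambda>p. fps_nth (\<Lambda> (eval_VVz W YW (\<sigma> u v) w p (s - p))) b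
    - fps_nth (\<Lambda> (YW v (s - p) (YW u p w))) b) p = 0" if "b \<le> n" for s p b
  proof -
    \<comment> \<open>Multiplication by \<open>(z\<^sub>1 - z\<^sub>2)\<^sup>r\<close> moves the line \<open>p + q = s\<close> to \<open>p + q = s + r\<close>.\<close>
    let ?s = "s + int r"
    have "fps_nth (\<Lambda> (mult_diff r (eval_VVz W YW (\<sigma> u v) w) p (?s - p) - mult_diff r (\<lambda>p q. YW v q (YW u p w)) p (?s - p))) b = 0"
      using that by (intro dual_on_hpow[OF \<Lambda> r]) simp
    then have "fps_nth (\<Lambda> (mult_diff r (eval_VVz W YW (\<sigma> u v) w) p (?s - p))) b -
        fps_nth (\<Lambda> (mult_diff r (\<lambda>p q. YW v q (YW u p w)) p (?s - p))) b = 0"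
      by (simp add: dual_on_diff[OF \<Lambda> subspace mult_diff_in[OF E] mult_diff_in[OF A]])
    then have "shift_diffs r (\<lambda>p. fps_nth (\<Lambda> (eval_VVz W YW (\<sigma> u v) w p (s - p))) b) p -
        shift_diffs r (\<lambda>p. fps_nth (\<Lambda> (YW v (s - p) (YW u p w))) b) p = 0"
      unfolding dual_mult_diff[OF \<Lambda> E] dual_mult_diff[OF \<Lambda> A] by simp
    then show ?thesis
      using shift_diffs_sum[of r "\<lambda>i. if i then 1 else - 1"
        "\<lambda>i. if i then (\<lambda>p. fps_nth (\<Lambda> (eval_VVz W YW (\<sigma> u v) w p (s - p))) b)
          else (\<lambda>p. fps_nth (\<Lambda> (YW v (s - p) (YW u p w))) b)" "UNIV :: bool set" p]
      by (simp add: UNIV_bool)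
  qed
  then show ?thesis by blast
qed

text \<open>
  For every functional and every power of \<open>h\<close> the two sides give sequences \<open>f\<close> and \<open>g\<close> on the line through \<open>(p, q)\<close>.
  Locality shows that some power of \<open>x - 1\<close> annihilates \<open>f - g\<close>.  The sequence \<open>g\<close> vanishes for small arguments
  because \<open>T\<^sub>1(z\<^sub>1) w\<close> is bounded below, and \<open>f\<close> has finite support, so \<open>f = g\<close>.
\<close>

theorem RTT:
  assumes L: "L_operator L" and Y: "vertex_operator_map L Y" and WA: "weak_associativity Y W YW"
    and \<sigma>: "sigma_map \<sigma>" and loc: "sigma_locality \<sigma> W YW" and w: "w \<in> W"
  shows "(\<Sum>e\<in>UNIV. Rbar_coeff 0 (i, j) e \<odot> T (fst e) k p (T (snd e) l q w)
        + Rbar_coeff 1 (i, j) e \<odot> T (fst e) k (p - 1) (T (snd e) l (q + 1) w)) =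
    (\<Sum>e\<in>UNIV. Rbar_coeff 0 e (k, l) \<odot> T j (snd e) q (T i (fst e) p w)
        + Rbar_coeff 1 e (k, l) \<odot> T j (snd e) (q + 1) (T i (fst e) (p - 1) w))" (is "?F = ?G")
proof -
  have TW: "T i j s x \<in> W" if "x \<in> W" for i j s x
    using that by (simp add: T_def YW_in)
  define s where "s = p + q"
  have "\<Lambda> (?F - ?G) = 0" if \<Lambda>: "dual_on W \<Lambda>" for \<Lambda>
  proof (rule fps_ext)
    fix n
    let ?B = "\<lambda>e b p. fps_nth (\<Lambda> (T (fst e) k p (T (snd e) l (s - p) w))) b"
    let ?C = "\<lambda>e b p. fps_nth (\<Lambda> (T j (snd e) (s - p) (T i (fst e) p w))) b"
    let ?E = "\<lambda>e b p. fps_nth (\<Lambda> (eval_VVz W YW (\<sigma> (lplus i (fst e) 0) (lplus j (snd e) 0)) w p (s - p))) b"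
    define f where "f = first_order_comb (Rbar_coeff 0 (i, j)) (Rbar_coeff 1 (i, j)) ?B n"
    define g where "g = first_order_comb (\<lambda>e. Rbar_coeff 0 e (k, l)) (\<lambda>e. Rbar_coeff 1 e (k, l)) ?C n"
    have f: "f = first_order_comb (\<lambda>e. Rbar_coeff 0 e (k, l)) (\<lambda>e. Rbar_coeff 1 e (k, l)) ?E n"
      unfolding f_def by (rule ext) (rule left_side_eq_sigma[OF \<sigma> w \<Lambda>])
    have "\<exists>r. \<forall>p b. b \<le> n \<longrightarrow> shift_diffs r (\<lambda>p. ?E e b p - ?C e b p) p = 0" for e
    proof -
      obtain r where r: "\<forall>s p b. b \<le> n \<longrightarrow>
          shift_diffs r (\<lambda>p. fps_nth (\<Lambda> (eval_VVz W YW (\<sigma> (lplus i (fst e) 0) (lplus j (snd e) 0)) w p (s - p))) b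
            - fps_nth (\<Lambda> (YW (lplus j (snd e) 0) (s - p) (YW (lplus i (fst e) 0) p w))) b) p = 0"
        using sigma_locality_shift_diffs[OF loc w \<Lambda>] by (rule exE)
      show ?thesis unfolding T_def by (rule exI[of _ r]) (rule spec[OF r])
    qed
    then have "\<forall>e. \<exists>r. \<forall>p b. b \<le> n \<longrightarrow> shift_diffs r (\<lambda>p. ?E e b p - ?C e b p) p = 0" ..
    from choice[OF this] obtain R where
      "\<forall>e. \<forall>p b. b \<le> n \<longrightarrow> shift_diffs (R e) (\<lambda>p. ?E e b p - ?C e b p) p = 0" ..
    then have R: "shift_diffs (R e) (\<lambda>p. ?E e b p - ?C e b p) p = 0" if "b \<le> n" for e b p
      using that by blast
    define r where "r = Max (range R)"
    have "shift_diffs r (\<lambda>p. ?E e b p - ?C e b p) p = 0" if "b \<le> n" for e b p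
      by (rule shift_diffs_mono_0[OF R[OF that]]) (simp add: r_def)
    then have killed: "shift_diffs r (\<lambda>p. f p - g p) p = 0" for p
      unfolding f g_def first_order_comb_diff shift_diffs_first_order_comb by (intro first_order_comb_0)
    have "finite {p. f p \<noteq> 0}"
      unfolding f_def by (rule left_side_finite[OF L Y WA w \<Lambda>])
    then have "f p = 0" if "p < Min (insert 0 {p. f p \<noteq> 0})" for p
      using that Min_le[of "insert 0 {p. f p \<noteq> 0}" p] by fastforce
    then obtain P where P: "\<And>p. p < P \<Longrightarrow> f p = 0" by blast
    have "\<exists>M. \<forall>q p. p < M \<longrightarrow> fps_nth (\<Lambda> (T j (snd e) q (T i (fst e) p w))) b = 0" for e b
      using product_bounded_below[OF w \<Lambda>] unfolding T_def by metis
    then obtain M where M: "\<And>e b p q. p < M e b \<Longrightarrow> fps_nth (\<Lambda> (T j (snd e) q (T i (fst e) p w))) b = 0"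
      by metis
    define m where "m = Min (insert P ((\<lambda>(e, b). M e b) ` (UNIV \<times> {0..n})))"
    have m: "m \<le> P" "b \<le> n \<Longrightarrow> m \<le> M e b" for e b
      unfolding m_def by (rule Min_le; force)+
    have low: "f p - g p = 0" if "p < m" for p
    proof -
      have "g p = 0"
        unfolding g_def
      proof (rule first_order_comb_0)
        fix e b assume "b \<le> n"
        then show "?C e b p = 0" "?C e b (p - 1) = 0"
          using m(2)[of b e] that by (auto intro!: M)
      qed
      then show ?thesis using P[of p] m(1) that by simp
    qed
    have "f p - g p = 0"
      by (rule shift_diffs_cancel[where P = m and f = "\<lambda>p. f p - g p", OF _ killed]) (rule low)
    moreover have "fps_nth (\<Lambda> ?F) n = f p" "fps_nth (\<Lambda> ?G) n = g p"
      unfolding f_def g_def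
      by (subst dual_first_order_comb[OF \<Lambda>, symmetric], simp add: TW w, simp add: s_def algebra_simps)+
    ultimately show "fps_nth (\<Lambda> (?F - ?G)) n = fps_nth 0 n"
      by (subst dual_on_diff[OF \<Lambda> subspace])
        (auto intro!: hmod.subspace_sum[OF subspace] hmod.subspace_add[OF subspace] hmod.subspace_scale[OF subspace] TW w)
  qed
  then have "?F - ?G = 0"
    by (intro dual_separates hmod.subspace_diff[OF subspace] hmod.subspace_sum[OF subspace]
        hmod.subspace_add[OF subspace] hmod.subspace_scale[OF subspace] TW w)
  then show ?thesis by simp
qed

end

section \<open>Modules over the Yangian\<close>

lemma poly_mapping_sum_induct [case_names zero add single]:
  fixes x :: "'a \<Rightarrow>\<^sub>0 'b::comm_monoid_add"
  assumes "P 0" "\<And>x y. P x \<Longrightarrow> P y \<Longrightarrow> P (x + y)" "\<And>u c. P (Poly_Mapping.single u c)"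
  shows "P x"
proof -
  have "x = (\<Sum>u\<in>Poly_Mapping.keys x. Poly_Mapping.single u (Poly_Mapping.lookup x u))"
    by (rule poly_mapping_eqI)
      (auto simp: lookup_sum lookup_single when_def in_keys_iff sum.delta' cong: if_cong)
  moreover have "P (\<Sum>u\<in>A. Poly_Mapping.single u (Poly_Mapping.lookup x u))" for A
    by (induction A rule: infinite_finite_induct) (auto intro: assms)
  ultimately show ?thesis by metis
qed

text \<open>
  A family of linear operators on \<open>W\<close> is the same as an action of the free algebra on the symbols \<open>\<tau>\<^sub>i\<^sub>j\<^sup>(\<^sup>r\<^sup>)\<close>.
\<close>

locale operator_family = top_free W for W :: "'w::hmodule set" +
  fixes T :: "'n::{finite,linorder} \<Rightarrow> 'n \<Rightarrow> int \<Rightarrow> 'w \<Rightarrow> 'w"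
  assumes T_in: "w \<in> W \<Longrightarrow> T i j s w \<in> W"
    and T_add: "w \<in> W \<Longrightarrow> w' \<in> W \<Longrightarrow> T i j s (w + w') = T i j s w + T i j s w'"
    and T_scale: "w \<in> W \<Longrightarrow> T i j s (c \<odot> w) = c \<odot> T i j s w"
begin

definition word_act :: "('n \<times> 'n \<times> int) fword \<Rightarrow> 'w \<Rightarrow> 'w"
  where "word_act u = foldr (\<lambda>(i, j, s). T i j s) (letters u)"

lemma word_act_plus: "word_act (u + v) w = word_act u (word_act v w)"
  by (simp add: word_act_def plus_fword_def)

lemma word_act_linear:
  assumes "w \<in> W" "w' \<in> W"
  shows "word_act u w \<in> W" "word_act u (w + w') = word_act u w + word_act u w'"
    "word_act u (c \<odot> w) = c \<odot> word_act u w"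
proof -
  have "foldr (\<lambda>(i, j, s). T i j s) gs w \<in> W" if "w \<in> W" for gs w
    using that by (induction gs) (auto simp: T_in)
  note fW = this
  show "word_act u w \<in> W" using fW assms by (simp add: word_act_def)
  have "foldr (\<lambda>(i, j, s). T i j s) gs (w + w') = foldr (\<lambda>(i, j, s). T i j s) gs w + foldr (\<lambda>(i, j, s). T i j s) gs w'" for gs
    using assms fW by (induction gs) (auto simp: T_add)
  then show "word_act u (w + w') = word_act u w + word_act u w'" by (simp add: word_act_def)
  have "foldr (\<lambda>(i, j, s). T i j s) gs (c \<odot> w) = c \<odot> foldr (\<lambda>(i, j, s). T i j s) gs w" for gs
    using assms fW by (induction gs) (auto simp: T_scale)
  then show "word_act u (c \<odot> w) = c \<odot> word_act u w" by (simp add: word_act_def)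
qed

definition free_act :: "'n yfree \<Rightarrow> 'w \<Rightarrow> 'w"
  where "free_act x w = (\<Sum>u\<in>Poly_Mapping.keys x. Poly_Mapping.lookup x u \<odot> word_act u w)"

lemma free_act_superset:
  assumes "finite A" "Poly_Mapping.keys x \<subseteq> A"
  shows "free_act x w = (\<Sum>u\<in>A. Poly_Mapping.lookup x u \<odot> word_act u w)"
  unfolding free_act_def
  by (rule sum.mono_neutral_left) (use assms in \<open>auto simp: in_keys_iff\<close>)

lemma free_act_add: "free_act (x + y) w = free_act x w + free_act y w"
proof -
  let ?A = "Poly_Mapping.keys x \<union> Poly_Mapping.keys y"
  have "free_act z w = (\<Sum>u\<in>?A. Poly_Mapping.lookup z u \<odot> word_act u w)"
    if "z = x \<or> z = y \<or> z = x + y" for z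
    using that by (intro free_act_superset) (auto simp: in_keys_iff lookup_add)
  then show ?thesis
    by (simp add: lookup_add hscale_left_distrib sum.distrib)
qed

lemma free_act_0 [simp]: "free_act 0 w = 0"
  by (simp add: free_act_def)

lemma free_act_diff: "free_act (x - y) w = free_act x w - free_act y w"
  using free_act_add[of "x - y" y w] by simp

lemma free_act_sum: "free_act (sum f A) w = (\<Sum>i\<in>A. free_act (f i) w)"
  by (induction A rule: infinite_finite_induct) (simp_all add: free_act_add)

lemma free_act_single: "free_act (Poly_Mapping.single u c) w = c \<odot> word_act u w"
  by (subst free_act_superset[of "{u}"]) (auto simp: lookup_single)

lemma free_act_linear:
  assumes "w \<in> W" "w' \<in> W"
  shows "free_act x w \<in> W" "free_act x (w + w') = free_act x w + free_act x w'"
    "free_act x (c \<odot> w) = c \<odot> free_act x w"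
  using word_act_linear[OF assms]
  by (auto simp: free_act_def hscale_right_distrib sum.distrib hmod.scale_sum_right hscale_hscale mult.commute
      intro!: hmod.subspace_sum[OF subspace] hmod.subspace_scale[OF subspace])

lemma free_act_mult:
  assumes w: "w \<in> W"
  shows "free_act (x * y) w = free_act x (free_act y w)"
proof (induction x rule: poly_mapping_sum_induct)
  case (add x x')
  then show ?case by (simp add: distrib_right free_act_add)
next
  case (single u c)
  show ?case
  proof (induction y rule: poly_mapping_sum_induct)
    case zero
    show ?case using word_act_linear(3)[OF hmod.subspace_0[OF subspace] hmod.subspace_0[OF subspace], of u 0]
      by (simp add: free_act_single)
  next
    case (add y y')
    then show ?case
      by (simp add: distrib_left free_act_add free_act_linear(2) free_act_linear(1)[OF w w])
  next
    case (single v d)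
    show ?case
      using word_act_linear(1,3)[OF w w]
      by (simp add: mult_single free_act_single word_act_plus hscale_hscale)
         (metis hscale_hscale word_act_linear(1,3))
  qed
qed simp

lemma free_act_gen: "free_act (yfree_gen i j s) w = T i j s w"
  by (simp add: yfree_gen_def free_act_single word_act_def hscale_one)

lemma free_act_scalar: "free_act (yfree_scalar c) w = c \<odot> w"
  by (simp add: yfree_scalar_def free_act_single word_act_def zero_fword_def)

lemma free_act_relator:
  assumes w: "w \<in> W"
  shows "free_act (y_relator i j k l p q) w =
    (\<Sum>e\<in>UNIV. Rbar_coeff 0 (i, j) e \<odot> T (fst e) k p (T (snd e) l q w)
        + Rbar_coeff 1 (i, j) e \<odot> T (fst e) k (p - 1) (T (snd e) l (q + 1) w)) -
    (\<Sum>e\<in>UNIV. Rbar_coeff 0 e (k, l) \<odot> T j (snd e) q (T i (fst e) p w)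
        + Rbar_coeff 1 e (k, l) \<odot> T j (snd e) (q + 1) (T i (fst e) (p - 1) w))"
proof -
  have two: "(\<Sum>m\<le>degree P. coeff P m \<odot> X m) = coeff P 0 \<odot> X 0 + coeff P 1 \<odot> X 1"
    if "degree P \<le> 1" for P and X :: "nat \<Rightarrow> 'w"
  proof -
    have "(\<Sum>m\<le>degree P. coeff P m \<odot> X m) = (\<Sum>m\<le>1. coeff P m \<odot> X m)"
      by (rule sum.mono_neutral_left) (use that in \<open>auto simp: coeff_eq_0\<close>)
    then show ?thesis by (simp add: atMost_Suc)
  qed
  have lin: "T i j s w \<in> W" "T i j s (c \<odot> w) = c \<odot> T i j s w" if "w \<in> W" for i j s w c
    using that by (simp_all add: T_in T_scale)
  have left: "free_act (yfree_scalar c * (yfree_gen i j s * yfree_gen i' j' s')) w = c \<odot> T i j s (T i' j' s' w)"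
    for c i j s i' j' s'
    by (simp add: free_act_mult w free_act_scalar free_act_gen lin)
  have right: "free_act (yfree_gen i j s * yfree_gen i' j' s' * yfree_scalar c) w = c \<odot> T i j s (T i' j' s' w)"
    for c i j s i' j' s'
    by (simp add: free_act_mult w free_act_scalar free_act_gen lin hmod.subspace_scale[OF subspace])
  show ?thesis
    unfolding y_relator_def split_def free_act_diff free_act_sum left right two[OF degree_Rbar_poly]
    by (simp add: Rbar_coeff_def)
qed

end

lemma yangian_generated [case_names one add scale tau]:
  fixes x :: "'n::{finite,linorder} yangian"
  assumes "P 1" "\<And>x y. P x \<Longrightarrow> P y \<Longrightarrow> P (x + y)" "\<And>c x. P x \<Longrightarrow> P (c \<odot> x)"
    "\<And>i j s x. P x \<Longrightarrow> P (tau i j s * x)"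
  shows "P x"
proof -
  have word: "P (abs_yangian (Poly_Mapping.single (FWord gs) 1))" for gs :: "('n \<times> 'n \<times> int) list"
  proof (induction gs)
    case Nil
    have "(Poly_Mapping.single (FWord []) 1 :: 'n yfree) = 1"
      by (simp flip: zero_fword_def)
    then show ?case using assms(1) by (simp add: one_yangian_def)
  next
    case (Cons g gs)
    obtain i j s where g: "g = (i, j, s)" by (cases g)
    have "(Poly_Mapping.single (FWord (g # gs)) 1 :: 'n yfree) = yfree_gen i j s * Poly_Mapping.single (FWord gs) 1"
      by (simp add: yfree_gen_def mult_single plus_fword_def g)
    then show ?case
      using assms(4)[OF Cons, of i j s] by (simp add: tau.abs_eq times_yangian.abs_eq)
  qed
  have "P (abs_yangian X)" for X
  proof (induction X rule: poly_mapping_sum_induct)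
    case zero
    have "(0 :: 'n yangian) = 0 \<odot> 1" by simp
    then show ?case using assms(3)[OF assms(1), of 0] by (simp add: zero_yangian_def)
  next
    case (add X Y)
    then show ?case using assms(2) by (simp add: plus_yangian.abs_eq[symmetric])
  next
    case (single u c)
    have "(Poly_Mapping.single u c :: 'n yfree) = yfree_scalar c * Poly_Mapping.single u 1"
      by (simp add: yfree_scalar_def mult_single)
    then have "abs_yangian (Poly_Mapping.single u c) = c \<odot> abs_yangian (Poly_Mapping.single (FWord (letters u)) 1)"
      by (simp add: hscale_yangian.abs_eq)
    then show ?case using assms(3)[OF word[of "letters u"], of c] by simp
  qed
  then show ?thesis by (induction x) simp
qed

text \<open>
  The elements of the free algebra that act by zero form an ideal, which contains the relators.
\<close>

lemma (in operator_family) yangian_module_exists: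
  assumes RTT: "\<And>i j k l p q w. w \<in> W \<Longrightarrow>
    (\<Sum>e\<in>UNIV. Rbar_coeff 0 (i, j) e \<odot> T (fst e) k p (T (snd e) l q w)
        + Rbar_coeff 1 (i, j) e \<odot> T (fst e) k (p - 1) (T (snd e) l (q + 1) w)) =
    (\<Sum>e\<in>UNIV. Rbar_coeff 0 e (k, l) \<odot> T j (snd e) q (T i (fst e) p w)
        + Rbar_coeff 1 e (k, l) \<odot> T j (snd e) (q + 1) (T i (fst e) (p - 1) w))"
  obtains act where "yangian_module W act" "\<And>i j s w. w \<in> W \<Longrightarrow> act (tau i j s) w = T i j s w"
proof
  define act where "act x = restrict (free_act (rep_yangian x)) W" for x :: "'n yangian"
  define I where "I = {x. \<forall>w\<in>W. free_act x w = 0}"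
  have z: "free_act x 0 = 0" for x
    using free_act_linear(3)[OF hmod.subspace_0[OF subspace] hmod.subspace_0[OF subspace], of x 0] by simp
  have "two_sided_ideal I"
    unfolding two_sided_ideal_def I_def
    by (auto simp: free_act_add free_act_mult z free_act_linear(1))
  moreover have "y_relator i j k l p q \<in> I" for i j k l p q
    unfolding I_def by (intro CollectI ballI) (simp only: free_act_relator RTT diff_self)
  ultimately have I: "I \<in> y_ideals" unfolding y_ideals_def by blast
  have act: "act (abs_yangian x) w = free_act x w" if w: "w \<in> W" for x w
  proof -
    have "y_rel (rep_yangian (abs_yangian x)) x"
      by (rule Quotient3_rep_abs[OF Quotient3_yangian]) (rule y_relI, rule refl)
    then have "rep_yangian (abs_yangian x) - x \<in> I" using I unfolding y_rel_def by blast
    then have "free_act (rep_yangian (abs_yangian x) - x) w = 0" using w unfolding I_def by blast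
    then show ?thesis using w by (simp add: act_def free_act_diff)
  qed
  show "act (tau i j s) w = T i j s w" if "w \<in> W" for i j s w
    using act[OF that] by (simp add: tau.abs_eq free_act_gen)
  have abs: "\<exists>X. x = abs_yangian X" for x :: "'n yangian"
    by (induction x) blast
  show "yangian_module W act"
    unfolding yangian_module_def
  proof (intro conjI allI ballI)
    show "hmod.subspace W" by (rule subspace)
    show "act x \<in> extensional W" "act x ` W \<subseteq> W" for x
      by (auto simp: act_def free_act_linear(1))
    fix w assume w: "w \<in> W"
    show "act x (w + w') = act x w + act x w'" if "w' \<in> W" for x w'
      using w that by (simp add: act_def free_act_linear(2) hmod.subspace_add[OF subspace])
    show "act x (c \<odot> w) = c \<odot> act x w" for x c
      using w by (simp add: act_def free_act_linear(3) hmod.subspace_scale[OF subspace])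
    show "act (x + y) w = act x w + act y w" for x y
      using abs[of x] abs[of y] w by (auto simp: plus_yangian.abs_eq act free_act_add)
    show "act (c \<odot> x) w = c \<odot> act x w" for c x
      using abs[of x] w by (auto simp: hscale_yangian.abs_eq act free_act_mult free_act_scalar)
    show "act 1 w = w"
      using w free_act_scalar[of 1 w] by (simp add: one_yangian_def act yfree_scalar_simps(3) hscale_one)
    show "act (x * y) w = act x (act y w)" for x y
      using abs[of x] abs[of y] w by (auto simp: times_yangian.abs_eq act free_act_mult free_act_linear(1))
  qed
qed

lemma yangian_module_unique:
  assumes "yangian_module W act" "yangian_module W act'"
    "\<And>i j s w. w \<in> W \<Longrightarrow> act (tau i j s) w = act' (tau i j s) w"
  shows "act = act'"
proof (intro ext)
  fix x w
  note M = assms(1,2)[unfolded yangian_module_def]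
  have "\<forall>w\<in>W. act x w = act' x w"
  proof (induction x rule: yangian_generated)
    case (tau i j s x)
    then show ?case using M assms(3) by (metis image_subset_iff)
  qed (use M in simp_all)
  then show "act x w = act' x w"
    using M by (cases "w \<in> W") (auto simp: extensional_def)
qed

lemma yangian_submodule_if_tau:
  assumes act: "yangian_module W act" and U: "U \<subseteq> W" "hmod.subspace U"
    and tau: "\<And>i j s u. u \<in> U \<Longrightarrow> act (tau i j s) u \<in> U"
  shows "yangian_submodule U W act"
proof -
  note M = act[unfolded yangian_module_def]
  have "\<forall>u\<in>U. act x u \<in> U" for x
  proof (induction x rule: yangian_generated)
    case one
    then show ?case using M U(1) by auto
  next
    case (add x y)
    then show ?case using M U by (metis hmod.subspace_add subsetD)
  next
    case (scale c x)
    then show ?case using M U by (metis hmod.subspace_scale subsetD)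
  next
    case (tau i j s x)
    then show ?case using M U assms(4) by (metis subsetD)
  qed
  then show ?thesis using U unfolding yangian_submodule_def by blast
qed

theorem corollary5p8:
  fixes L :: "'n::{finite,linorder} \<Rightarrow> 'n \<Rightarrow> int \<Rightarrow> 'n VR \<Rightarrow> 'n VR"
    and Y :: "'n VR \<Rightarrow> int \<Rightarrow> 'n VR \<Rightarrow> 'n VR"
    and \<sigma> :: "'n VR \<Rightarrow> 'n VR \<Rightarrow> 'n VVz"
    and W :: "'w::hmodule set"
    and YW :: "'n VR \<Rightarrow> int \<Rightarrow> 'w \<Rightarrow> 'w"
  assumes "CARD('n) \<ge> 2"
    and "L_operator L" and "vertex_operator_map L Y" and "sigma_map \<sigma>"
    and "phi_module Y \<sigma> W YW"
  shows "(\<exists>!act. restricted_yangian_module W act \<and>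
            (\<forall>i j s. \<forall>w\<in>W. act (tau i j s) w = YW (lplus i j 0) s w)) \<and>
         (\<forall>act W1. restricted_yangian_module W act \<and>
            (\<forall>i j s. \<forall>w\<in>W. act (tau i j s) w = YW (lplus i j 0) s w) \<and>
            phi_submodule Y \<sigma> W1 W YW \<longrightarrow> yangian_submodule W1 W act)"
proof -
  note phi = assms(5)[unfolded phi_module_def]
  note sub = phi[THEN conjunct1]
  note tf = phi[THEN conjunct2, THEN conjunct1]
  note add = phi[THEN conjunct2, THEN conjunct2, THEN conjunct1]
  note scale = phi[THEN conjunct2, THEN conjunct2, THEN conjunct2, THEN conjunct1]
  note hom = phi[THEN conjunct2, THEN conjunct2, THEN conjunct2, THEN conjunct2, THEN conjunct1]
  note laurent = phi[THEN conjunct2, THEN conjunct2, THEN conjunct2, THEN conjunct2, THEN conjunct2, THEN conjunct1]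
  note WA = phi[THEN conjunct2, THEN conjunct2, THEN conjunct2, THEN conjunct2, THEN conjunct2, THEN conjunct2, THEN conjunct2, THEN conjunct1]
  note loc = phi[THEN conjunct2, THEN conjunct2, THEN conjunct2, THEN conjunct2, THEN conjunct2, THEN conjunct2, THEN conjunct2, THEN conjunct2]
  interpret field_action W YW
  proof (intro field_action.intro top_free.intro field_action_axioms.intro)
    fix v s c w w'
    show "hmod.subspace W" "topologically_free W" by (rule sub tf)+
    assume w: "w \<in> W"
    show "YW v s (w + w') = YW v s w + YW v s w'" if "w' \<in> W" using add w that by blast
    show "YW v s (c \<odot> w) = c \<odot> YW v s w" using scale w by blast
    show "hlinear (\<lambda>v. YW v s w)" "laurent_h W (\<lambda>s. YW v s w)" using hom laurent w by simp_all
  qed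
  interpret operator_family W T
    by unfold_locales (use YW_add YW_scale YW_in in \<open>simp_all add: T_def\<close>)
  obtain act where act: "yangian_module W act" "\<And>i j s w. w \<in> W \<Longrightarrow> act (tau i j s) w = T i j s w"
    using yangian_module_exists[OF RTT[OF assms(2,3) WA assms(4) loc]] by blast
  have "laurent_h W (\<lambda>s. act (tau i j s) w)" if "w \<in> W" for i j w
    using YW_laurent[OF that, of "lplus i j 0"] act(2)[OF that] by (simp add: T_def)
  then have A: "restricted_yangian_module W act"
    unfolding restricted_yangian_module_def using act(1) free by blast
  have B: "\<forall>i j s. \<forall>w\<in>W. act (tau i j s) w = YW (lplus i j 0) s w"
    using act(2) by (simp add: T_def)
  have C: "act' = act" if "restricted_yangian_module W act'"
    "\<forall>i j s. \<forall>w\<in>W. act' (tau i j s) w = YW (lplus i j 0) s w" for act'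
    using that act unfolding restricted_yangian_module_def
    by (intro yangian_module_unique[of W]) (auto simp: T_def)
  have unique: "\<exists>!act. restricted_yangian_module W act \<and>
      (\<forall>i j s. \<forall>w\<in>W. act (tau i j s) w = YW (lplus i j 0) s w)"
    by (rule ex1I[of _ act], rule conjI[OF A B], elim conjE, rule C)
  have submodule: "yangian_submodule U W act"
    if "restricted_yangian_module W act" and tau: "\<forall>i j s. \<forall>w\<in>W. act (tau i j s) w = YW (lplus i j 0) s w"
      and sub: "phi_submodule Y \<sigma> U W YW" for act U
  proof -
    obtain YU where U: "U \<subseteq> W" "hmod.subspace U" "phi_module Y \<sigma> U YU" "\<forall>v s. \<forall>u\<in>U. YU v s u = YW v s u"
      using sub unfolding phi_submodule_def by (elim conjE exE) (rule that)
    have "\<forall>v. \<forall>u\<in>U. laurent_h U (\<lambda>s. YU v s u)"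
      using U(3) unfolding phi_module_def by (elim conjE)
    then have "YU v s u \<in> U" if "u \<in> U" for v s u
      using that by (auto simp: laurent_h_def)
    then have "act (tau i j s) u \<in> U" if "u \<in> U" for i j s u
      using that U(1,4) tau by (metis subsetD)
    with that(1) U(1,2) show ?thesis
      unfolding restricted_yangian_module_def by (blast intro: yangian_submodule_if_tau)
  qed
  show ?thesis
    by (intro conjI unique allI impI, elim conjE, rule submodule)
qed

end
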